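(* Let $K$ be an algebraically closed field, let $p,q,s,k$ be integers such that $p,q\geq 0$, $k\geq 2$, $1\leq s\leq k-1$, $\gcd(s,k)=1$, $\gcd(s+2,k)=1$, and let $\lambda\in K\setminus\{0\}$. Let $\Lambda=\Lambda(p,q,k,s,\lambda)$ and let $\Lambda_\eta$ (depending on a parameter $t\in K$) be the algebra defined in the context. Then $\Lambda_\eta$ is a non-trivial deformation of $\Lambda$. Moreover, the algebras $\Lambda$ and $\Lambda_\eta$ are socle equivalent (for every value of the parameter $t\in K$).
   Context: Paths in quivers are written from left to right. The algebra $\Lambda(p,q,k,s,\lambda)=K\mathcal Q/I$ with $\mathcal Q=\mathcal Q(p,q,k,s)$ and $I=I(p,q,k,s,\lambda)$ is defined as follows. Indices $i$ of the vertices $1,\dots,k$ (and all expressions such as $i-1$, $i+1$, $s+i$, $s+i+1$ used as indices) are read modulo $k$ in $\{1,\dots,k\}$. The quiver has vertices $1,\dots,k$, together with, for each $i\in\{1,\dots,k\}$, vertices $(i,1),\dots,(i,q)$ and $i^1,\dots,i^p$. For each $i$ there is a path $i\xrightarrow{\alpha_{(i,0)}}(i,1)\xrightarrow{\alpha_{(i,1)}}(i,2)\to\cdots\to(i,q)\xrightarrow{\alpha_{(i,q)}} i-1$ of $q+1$ arrows, and a path $i-1\xrightarrow{\beta_{i^0}} i^1\xrightarrow{\beta_{i^1}} i^2\to\cdots\to i^p\xrightarrow{\beta_{i^p}} i+s$ of $p+1$ arrows; these are all the arrows. Abbreviate $A_i=\alpha_{(i,0)}\alpha_{(i,1)}\cdots\alpha_{(i,q)}$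 and $B_i=\beta_{i^0}\beta_{i^1}\cdots\beta_{i^p}$. The ideal $I$ is generated by: $\beta_{i^p}\beta_{(s+i+1)^0}$ and $\alpha_{(i,q)}\alpha_{(i-1,0)}$ for $i=1,\dots,k$; $\alpha_{(i,t')}\cdots\alpha_{(i,q)}\,B_i\,\alpha_{(s+i,0)}\cdots\alpha_{(s+i,t')}$ for $t'=0,\dots,q$, $i=1,\dots,k$; $\beta_{i^j}\cdots\beta_{i^p}\,A_{s+i}\,\beta_{(s+i)^0}\cdots\beta_{(s+i)^j}$ for $j=0,\dots,p$, $i=1,\dots,k$; $A_iB_i-B_{i+1}A_{s+i+1}$ for $i=2,\dots,k$; and $A_1B_1-\lambda B_2A_{s+2}$. Put $f^2_{1,1}=A_1B_1-\lambda B_2A_{s+2}$; $f^2_{1,i}=A_iB_i-B_{i+1}A_{s+i+1}$ for $2\le i\le k$; and for $1\le i\le k$: $f^2_{2,i}=\beta_{i^p}\beta_{(s+i+1)^0}$; $f^2_{3,i}=\alpha_{(i,q)}\alpha_{(i-1,0)}$; $f^2_{4,i,j}=\beta_{i^j}\cdots\beta_{i^p}A_{s+i}\beta_{(s+i)^0}\cdots\beta_{(s+i)^j}$ for $j\in\{1,\dots,p-1\}$; $f^2_{5,i,t'}=\alpha_{(i,t')}\cdots\alpha_{(i,q)}B_i\alpha_{(s+i,0)}\cdots\alpha_{(s+i,t')}$ for $t'\in\{1,\dots,q-1\}$. Let $\rho_1=A_1B_1$, a path from vertex $1$ to vertex $s+1$. Here $\eta\in\mathrm{HH}^2(\Lambda)$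 is the class of the $\Lambda,\Lambda$-bimodule map $h_1$ from $Q^2=\bigoplus_{x\in f^2}\Lambda\mathfrak o(x)\otimes_K\mathfrak t(x)\Lambda$ (the degree 2 term of the minimal projective bimodule resolution of $\Lambda$, with $f^2$ the set of elements just listed and $\mathfrak o(x),\mathfrak t(x)$ the start and end vertices of $x$) to $\Lambda$ sending the generator $\mathfrak o(f^2_{1,1})\otimes\mathfrak t(f^2_{1,1})$ to $\rho_1$ and all other generators to $0$. For a parameter $t\in K$, $\Lambda_\eta=K\mathcal Q/I_\eta$, where $I_\eta$ is the ideal generated by: (1) $f^2_{1,1}-t\rho_1$ and $f^2_{1,j}$ for $j\in\{2,\dots,k\}$; (2) for all $i\in\{1,\dots,k\}$, $f^2_{2,i}$, $f^2_{3,i}$, $f^2_{4,i,j}$ ($j\in\{1,\dots,p-1\}$), $f^2_{5,i,t'}$ ($t'\in\{1,\dots,q-1\}$); (3) $\rho_1a$ for all arrows $a$ starting at the end vertex of $\rho_1$; (4) $a\rho_1$ for all arrows $a$ ending at the start vertex of $\rho_1$. Terminology: that the family $\Lambda_\eta$ is a deformation of $\Lambda$ is taken by the paper to mean that $\dim_K\Lambda_\eta=\dim_K\Lambda$ for all $t$; it is non-trivial if $\Lambda_\eta$ is not isomorphic to $\Lambda$ for some value of $t$. Two finite-dimensional algebras $R,R'$ are socle equivalent if $R/\mathrm{soc}(R)\cong R'/\mathrm{soc}(R')$ as algebras.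
   Formalization: With soc the one-sided (right or left) socle, socle equivalence fails at t=1 (e.g. p=q=0, k=2, s=1: quotient dimensions 6 and 5); proved for every t with soc the socle of R as a bimodule, and for the right and left socles for every t≠1. *)

theory Defs
  imports
    "HOL-Computational_Algebra.Polynomial"
    "HOL-Algebra.Algebra"
    "Graph_Theory.Graph_Theory"
begin

section \<open>Algebras over a field\<close>

text \<open>
  A \<open>K\<close>-algebra is a record of type \<^typ>\<open>('k, 'a) module\<close> whose ring part is not assumed
  commutative. \<open>FactRing\<close> forgets scalar multiplication; \<open>quot_algebra\<close> puts it back.
\<close>

definition quot_algebra :: "('k, 'a) module \<Rightarrow> 'a set \<Rightarrow> ('k, 'a set) module" where
  "quot_algebra A I =
     \<lparr>carrier = carrier (A Quot I), mult = mult (A Quot I), one = one (A Quot I),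
      ring.zero = ring.zero (A Quot I), add = add (A Quot I),
      smult = (\<lambda>c C. \<Union>x\<in>C. I +>\<^bsub>A\<^esub> (c \<odot>\<^bsub>A\<^esub> x))\<rparr>"

definition algebra_iso :: "('k, 'a) module \<Rightarrow> ('k, 'b) module \<Rightarrow> ('a \<Rightarrow> 'b) set" where
  "algebra_iso A B =
     {h \<in> ring_iso A B. \<forall>c. \<forall>x\<in>carrier A. h (c \<odot>\<^bsub>A\<^esub> x) = c \<odot>\<^bsub>B\<^esub> h x}"

definition isomorphic_algebras :: "('k, 'a) module \<Rightarrow> ('k, 'b) module \<Rightarrow> bool" where
  "isomorphic_algebras A B \<longleftrightarrow> algebra_iso A B \<noteq> {}"

text \<open>
  \<open>ring.dimension\<close> measures dimension over a subfield of the ring, here the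
  copy \<open>K\<cdot>1\<close> of the ground field.
\<close>

definition algebra_dimension :: "('k, 'a) module \<Rightarrow> nat \<Rightarrow> bool" where
  "algebra_dimension A n \<longleftrightarrow>
     ring.dimension A n (range (\<lambda>c. c \<odot>\<^bsub>A\<^esub> \<one>\<^bsub>A\<^esub>)) (carrier A)"

definition is_deformation :: "('k, 'a) module \<Rightarrow> ('k \<Rightarrow> ('k, 'b) module) \<Rightarrow> bool" where
  "is_deformation A D \<longleftrightarrow> (\<forall>t. \<exists>n. algebra_dimension A n \<and> algebra_dimension (D t) n)"

definition nontrivial_deformation :: "('k, 'a) module \<Rightarrow> ('k \<Rightarrow> ('k, 'b) module) \<Rightarrow> bool" where
  "nontrivial_deformation A D \<longleftrightarrow>
     is_deformation A D \<and> (\<exists>t. \<not> isomorphic_algebras (D t) A)"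

section \<open>Socles\<close>

definition right_ideal :: "'a set \<Rightarrow> ('a, 'm) ring_scheme \<Rightarrow> bool" where
  "right_ideal J R \<longleftrightarrow>
     additive_subgroup J R \<and> (\<forall>x\<in>J. \<forall>r\<in>carrier R. x \<otimes>\<^bsub>R\<^esub> r \<in> J)"

definition left_ideal :: "'a set \<Rightarrow> ('a, 'm) ring_scheme \<Rightarrow> bool" where
  "left_ideal J R \<longleftrightarrow>
     additive_subgroup J R \<and> (\<forall>x\<in>J. \<forall>r\<in>carrier R. r \<otimes>\<^bsub>R\<^esub> x \<in> J)"

text \<open>
  For a kind \<open>P\<close> of ideals (two-sided, right or left), a minimal ideal is a minimal nonzero
  one, i.e. a simple submodule of \<open>R\<close> viewed as bimodule, right module or left module.
  The socle is the sum of these, i.e. the smallest ideal of that kind containing all of them.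
\<close>

definition minimal_wrt :: "('a set \<Rightarrow> ('a, 'm) ring_scheme \<Rightarrow> bool) \<Rightarrow> ('a, 'm) ring_scheme
    \<Rightarrow> 'a set \<Rightarrow> bool" where
  "minimal_wrt P R M \<longleftrightarrow> P M R \<and> M \<noteq> {\<zero>\<^bsub>R\<^esub>} \<and>
     (\<forall>J. P J R \<and> J \<subseteq> M \<longrightarrow> J = {\<zero>\<^bsub>R\<^esub>} \<or> J = M)"

definition socle_wrt :: "('a set \<Rightarrow> ('a, 'm) ring_scheme \<Rightarrow> bool) \<Rightarrow> ('a, 'm) ring_scheme
    \<Rightarrow> 'a set" where
  "socle_wrt P R = \<Inter>{J. P J R \<and> (\<forall>M. minimal_wrt P R M \<longrightarrow> M \<subseteq> J)}"

text \<open>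
  The three socles agree for self-injective finite-dimensional algebras, but not in general.
  \<open>socle_equivalent\<close> uses the socle of \<open>R\<close> as a bimodule over itself.
\<close>

definition socle_equivalent :: "('k, 'a) module \<Rightarrow> ('k, 'b) module \<Rightarrow> bool" where
  "socle_equivalent A B \<longleftrightarrow>
     isomorphic_algebras (quot_algebra A (socle_wrt ideal A))
                         (quot_algebra B (socle_wrt ideal B))"

definition right_socle_equivalent :: "('k, 'a) module \<Rightarrow> ('k, 'b) module \<Rightarrow> bool" where
  "right_socle_equivalent A B \<longleftrightarrow>
     isomorphic_algebras (quot_algebra A (socle_wrt right_ideal A))
                         (quot_algebra B (socle_wrt right_ideal B))"

definition left_socle_equivalent :: "('k, 'a) module \<Rightarrow> ('k, 'b) module \<Rightarrow> bool" where
  "left_socle_equivalent A B \<longleftrightarrow>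
     isomorphic_algebras (quot_algebra A (socle_wrt left_ideal A))
                         (quot_algebra B (socle_wrt left_ideal B))"

section \<open>Path algebras\<close>

text \<open>
  A quiver is a multigraph \<^typ>\<open>('v, 'e) pre_digraph\<close>; a path is a pair \<open>(u, w)\<close> of a start
  vertex and a walk \<open>w\<close> from \<open>u\<close>, read from left to right, so that \<open>(u, [])\<close> is the trivial
  path at \<open>u\<close>. An element of the path algebra is its coefficient function, and the
  product of paths is concatenation: the coefficient of a path in \<open>f \<cdot> g\<close> is a sum over all its
  splittings into two paths.
\<close>

definition path_algebra ::
    "('v, 'e) pre_digraph \<Rightarrow> ('k::field, 'v \<times> 'e list \<Rightarrow> 'k) module" where
  "path_algebra G =
     \<lparr>carrier = {f. finite {x. f x \<noteq> 0} \<and>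
                    (\<forall>u w. f (u, w) \<noteq> 0 \<longrightarrow> (\<exists>v. pre_digraph.awalk G u w v))},
      mult = (\<lambda>f g (u, w). \<Sum>n\<le>length w.
                f (u, take n w) * g (pre_digraph.awlast G u (take n w), drop n w)),
      one = (\<lambda>(u, w). if u \<in> verts G \<and> w = [] then 1 else 0),
      ring.zero = (\<lambda>x. 0),
      add = (\<lambda>f g x. f x + g x),
      smult = (\<lambda>c f x. c * f x)\<rparr>"

text \<open>The basis element given by a nontrivial path, written as the list of its arrows.\<close>

definition path_elem :: "('v, 'e) pre_digraph \<Rightarrow> 'e list \<Rightarrow> ('v \<times> 'e list \<Rightarrow> 'k::field)" where
  "path_elem G w = (\<lambda>x. if x = (tail G (hd w), w) then 1 else 0)"

section \<open>The algebras\<close>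

text \<open>
  \<open>V i\<close>, \<open>VA i j\<close>, \<open>VB i j\<close> stand for the vertices \<open>i\<close>, \<open>(i,j)\<close>, \<open>i\<^sup>j\<close>;
  \<open>Al i j\<close> is the arrow \<open>\<alpha>\<close> with index \<open>(i,j)\<close>, and \<open>Be i j\<close> is the arrow \<open>\<beta>\<close> with index \<open>i\<^sup>j\<close>.
\<close>

datatype vertex = V nat | VA nat nat | VB nat nat

datatype arrow = Al nat nat | Be nat nat

definition idx :: "nat \<Rightarrow> nat \<Rightarrow> nat" where
  "idx k n = (if n mod k = 0 then k else n mod k)"

fun quiver_tail :: "nat \<Rightarrow> arrow \<Rightarrow> vertex" where
  "quiver_tail k (Al i j) = (if j = 0 then V i else VA i j)"
| "quiver_tail k (Be i j) = (if j = 0 then V (idx k (i - 1)) else VB i j)"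

fun quiver_head :: "nat \<Rightarrow> nat \<Rightarrow> nat \<Rightarrow> nat \<Rightarrow> arrow \<Rightarrow> vertex" where
  "quiver_head p q k s (Al i j) = (if j = q then V (idx k (i - 1)) else VA i (j + 1))"
| "quiver_head p q k s (Be i j) = (if j = p then V (idx k (i + s)) else VB i (j + 1))"

definition quiver :: "nat \<Rightarrow> nat \<Rightarrow> nat \<Rightarrow> nat \<Rightarrow> (vertex, arrow) pre_digraph" where
  "quiver p q k s =
     \<lparr>verts = {V i | i. i \<in> {1..k}} \<union> {VA i j | i j. i \<in> {1..k} \<and> j \<in> {1..q}}
              \<union> {VB i j | i j. i \<in> {1..k} \<and> j \<in> {1..p}},
      arcs = {Al i j | i j. i \<in> {1..k} \<and> j \<in> {0..q}} \<union> {Be i j | i j. i \<in> {1..k} \<and> j \<in> {0..p}},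
      tail = quiver_tail k,
      head = quiver_head p q k s\<rparr>"

type_synonym 'k kq = "vertex \<times> arrow list \<Rightarrow> 'k"

abbreviation KQ :: "nat \<Rightarrow> nat \<Rightarrow> nat \<Rightarrow> nat \<Rightarrow> ('k::field, 'k kq) module" where
  "KQ p q k s \<equiv> path_algebra (quiver p q k s)"

text \<open>
  The paths \<open>\<alpha>\<^bsub>(i,a)\<^esub> \<dots> \<alpha>\<^bsub>(i,b)\<^esub>\<close> and \<open>\<beta>\<^bsub>i^a\<^esub> \<dots> \<beta>\<^bsub>i^b\<^esub>\<close>, the index \<open>i\<close> being reduced into
  \<open>{1..k}\<close>.
\<close>

definition seg\<alpha> :: "nat \<Rightarrow> nat \<Rightarrow> nat \<Rightarrow> nat \<Rightarrow> arrow list" where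
  "seg\<alpha> k i a b = map (Al (idx k i)) [a..<Suc b]"

definition seg\<beta> :: "nat \<Rightarrow> nat \<Rightarrow> nat \<Rightarrow> nat \<Rightarrow> arrow list" where
  "seg\<beta> k i a b = map (Be (idx k i)) [a..<Suc b]"

definition pathA :: "nat \<Rightarrow> nat \<Rightarrow> nat \<Rightarrow> arrow list" where
  "pathA q k i = seg\<alpha> k i 0 q"

definition pathB :: "nat \<Rightarrow> nat \<Rightarrow> nat \<Rightarrow> arrow list" where
  "pathB p k i = seg\<beta> k i 0 p"

definition f1 :: "nat \<Rightarrow> nat \<Rightarrow> nat \<Rightarrow> nat \<Rightarrow> 'k::field \<Rightarrow> nat \<Rightarrow> 'k kq" where
  "f1 p q k s lam i =
     path_elem (quiver p q k s) (pathA q k i @ pathB p k i)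
     \<ominus>\<^bsub>KQ p q k s\<^esub> (if i = 1 then lam else 1) \<odot>\<^bsub>KQ p q k s\<^esub>
       path_elem (quiver p q k s) (pathB p k (i + 1) @ pathA q k (s + i + 1))"

definition f2 :: "nat \<Rightarrow> nat \<Rightarrow> nat \<Rightarrow> nat \<Rightarrow> nat \<Rightarrow> 'k::field kq" where
  "f2 p q k s i = path_elem (quiver p q k s) (seg\<beta> k i p p @ seg\<beta> k (s + i + 1) 0 0)"

definition f3 :: "nat \<Rightarrow> nat \<Rightarrow> nat \<Rightarrow> nat \<Rightarrow> nat \<Rightarrow> 'k::field kq" where
  "f3 p q k s i = path_elem (quiver p q k s) (seg\<alpha> k i q q @ seg\<alpha> k (i - 1) 0 0)"

definition f4 :: "nat \<Rightarrow> nat \<Rightarrow> nat \<Rightarrow> nat \<Rightarrow> nat \<Rightarrow> nat \<Rightarrow> 'k::field kq" where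
  "f4 p q k s i j =
     path_elem (quiver p q k s) (seg\<beta> k i j p @ pathA q k (s + i) @ seg\<beta> k (s + i) 0 j)"

definition f5 :: "nat \<Rightarrow> nat \<Rightarrow> nat \<Rightarrow> nat \<Rightarrow> nat \<Rightarrow> nat \<Rightarrow> 'k::field kq" where
  "f5 p q k s i j =
     path_elem (quiver p q k s) (seg\<alpha> k i j q @ pathB p k i @ seg\<alpha> k (s + i) 0 j)"

definition relI :: "nat \<Rightarrow> nat \<Rightarrow> nat \<Rightarrow> nat \<Rightarrow> 'k::field \<Rightarrow> 'k kq set" where
  "relI p q k s lam =
     f1 p q k s lam ` {1..k} \<union> f2 p q k s ` {1..k} \<union> f3 p q k s ` {1..k}
     \<union> {f4 p q k s i j | i j. i \<in> {1..k} \<and> j \<in> {0..p}}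
     \<union> {f5 p q k s i j | i j. i \<in> {1..k} \<and> j \<in> {0..q}}"

definition Lambda :: "nat \<Rightarrow> nat \<Rightarrow> nat \<Rightarrow> nat \<Rightarrow> 'k::field \<Rightarrow> ('k, 'k kq set) module" where
  "Lambda p q k s lam =
     quot_algebra (KQ p q k s) (Idl\<^bsub>KQ p q k s\<^esub> (relI p q k s lam))"

definition rho :: "nat \<Rightarrow> nat \<Rightarrow> nat \<Rightarrow> arrow list" where
  "rho p q k = pathA q k 1 @ pathB p k 1"

definition relI_eta :: "nat \<Rightarrow> nat \<Rightarrow> nat \<Rightarrow> nat \<Rightarrow> 'k::field \<Rightarrow> 'k \<Rightarrow> 'k kq set" where
  "relI_eta p q k s lam t =
     {f1 p q k s lam 1 \<ominus>\<^bsub>KQ p q k s\<^esub> t \<odot>\<^bsub>KQ p q k s\<^esub> path_elem (quiver p q k s) (rho p q k)}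
     \<union> f1 p q k s lam ` {2..k} \<union> f2 p q k s ` {1..k} \<union> f3 p q k s ` {1..k}
     \<union> {f4 p q k s i j | i j. i \<in> {1..k} \<and> j \<in> {1..p - 1}}
     \<union> {f5 p q k s i j | i j. i \<in> {1..k} \<and> j \<in> {1..q - 1}}
     \<union> {path_elem (quiver p q k s) (rho p q k @ [a]) | a.
          a \<in> arcs (quiver p q k s) \<and> tail (quiver p q k s) a = V (s + 1)}
     \<union> {path_elem (quiver p q k s) (a # rho p q k) | a.
          a \<in> arcs (quiver p q k s) \<and> head (quiver p q k s) a = V 1}"

definition Lambda_eta ::
    "nat \<Rightarrow> nat \<Rightarrow> nat \<Rightarrow> nat \<Rightarrow> 'k::field \<Rightarrow> 'k \<Rightarrow> ('k, 'k kq set) module" where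
  "Lambda_eta p q k s lam t =
     quot_algebra (KQ p q k s) (Idl\<^bsub>KQ p q k s\<^esub> (relI_eta p q k s lam t))"

end

theory Submission
  imports Defs
begin

text \<open>
  Continuing an arrow by the only arrow that does not make the product vanish defines a
  permutation of the arrows. A nontrivial path of the quiver is nonzero in \<open>\<Lambda>\<close> iff it is a chain of this permutation
  of length at most \<open>L = p + q + 2\<close>, and the only linear relations among
  such chains are \<open>B\<^bsub>i+1\<^esub> A\<^bsub>s+i+1\<^esub> = \<nu>\<^sub>i A\<^sub>i B\<^sub>i\<close>. Passing from \<open>\<Lambda>\<close> to \<open>\<Lambda>\<^sub>\<eta>\<close> only changes \<open>\<nu>\<^sub>1\<close> from
  \<open>1/\<lambda>\<close> to \<open>(1 - t)/\<lambda>\<close>. Hence both algebras have the same monomial basis, and dividing by the span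
  of the chains of length \<open>L\<close> gives the same monomial algebra. This span is the two-sided socle for
  every \<open>\<nu>\<close>, and also the right and the left socle if no \<open>\<nu>\<^sub>i\<close> vanishes.
  At \<open>t = 1\<close> the coefficient \<open>\<nu>\<^sub>1\<close> is zero and the right socle becomes larger than the two-sided one, so
  \<open>\<Lambda>\<^sub>\<eta>\<close> is not isomorphic to \<open>\<Lambda>\<close>.
\<close>

section \<open>Algebras over a field and their quotients\<close>

text \<open>The deformed relation reads (1 - t) A_1 B_1 = lam B_2 A_{s+2}. Solving it for the second
  path divides by lam and never by 1 - t, so t = 1 stays inside the family; this is why A_i B_i is
  the path kept as basis element in each pair of parallel paths. A generated ideal gives no direct
  access to linear independence modulo it. The target ideal is therefore described by linear
  equations on coefficients, from which independence of the monomial basis can be read off. An ideal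
  whose elements satisfy these equations and which still suffices to reduce every path to the basis
  must coincide with it, so each presentation needs only two checks. The obstacle is the second
  check for the deformed presentation: zero relations of length L + 1 with extreme index are absent
  there and have to be won back from the commutativity relations. At t = 1 the relation with index 1
  says nothing about A_1 B_1, and the generators built from rho_1 fill exactly this gap.\<close>

lemma ring_cong:
  assumes "ring R" and "carrier S = carrier R" "mult S = mult R" "one S = one R"
    "ring.zero S = ring.zero R" "add S = add R"
  shows "ring S"
proof -
  interpret ring R by fact
  show ?thesis
  proof (rule ringI)
    show "abelian_group S"
    proof (rule abelian_groupI)
      fix x assume "x \<in> carrier S"
      then show "\<exists>y\<in>carrier S. y \<oplus>\<^bsub>S\<^esub> x = \<zero>\<^bsub>S\<^esub>"
        using assms by (intro bexI[of _ "\<ominus>\<^bsub>R\<^esub> x"]) (simp_all add: l_neg)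
    qed (use assms in \<open>simp_all add: a_ac\<close>)
    show "Group.monoid S"
      by (rule monoidI) (use assms in \<open>auto simp: m_assoc\<close>)
  qed (use assms in \<open>auto simp: l_distr r_distr\<close>)
qed

text \<open>Scalars act through the elements c 1, which the two multiplication axioms make central.
  Closure of ideals under scalars and distributivity of scalars over sums then follow from the ring
  structure. The same copy of the field inside the ring is the one over which
  \<open>algebra_dimension\<close> counts.\<close>

locale K_algebra = ring A for A :: "('k::field, 'a) module" (structure) +
  assumes smult_closed [simp, intro]: "x \<in> carrier A \<Longrightarrow> c \<odot> x \<in> carrier A"
    and smult_one_mult: "x \<in> carrier A \<Longrightarrow> (c \<odot> \<one>) \<otimes> x = c \<odot> x"
    and mult_smult_one: "x \<in> carrier A \<Longrightarrow> x \<otimes> (c \<odot> \<one>) = c \<odot> x"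

definition algebra_hom :: "('k, 'a) module \<Rightarrow> ('k, 'b) module \<Rightarrow> ('a \<Rightarrow> 'b) set" where
  "algebra_hom A B = {h \<in> ring_hom A B. \<forall>c. \<forall>x\<in>carrier A. h (c \<odot>\<^bsub>A\<^esub> x) = c \<odot>\<^bsub>B\<^esub> h x}"

context K_algebra
begin

lemma ideal_smult_closed:
  assumes "ideal I A" "x \<in> I"
  shows "c \<odot> x \<in> I"
proof -
  interpret ideal I A by fact
  show ?thesis
    using I_l_closed[OF assms(2), of "c \<odot> \<one>"] smult_one_mult[OF a_Hcarr[OF assms(2)]] by simp
qed

lemma smult_r_distr:
  assumes "x \<in> carrier A" "y \<in> carrier A"
  shows "c \<odot> (x \<oplus> y) = c \<odot> x \<oplus> c \<odot> y"
  using assms r_distr[of x y "c \<odot> \<one>"] by (simp add: smult_one_mult)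

lemma quot_carrier: "carrier (quot_algebra A I) = (+>) I ` carrier A"
  by (auto simp: quot_algebra_def FactRing_simps)

text \<open>The union in \<open>quot_algebra\<close> runs over all representatives of the coset.
  They differ by elements of \<open>I\<close>, which stays stable under scalars, so all members of
  the union are one and the same coset.\<close>

lemma quot_smult:
  assumes "ideal I A" "x \<in> carrier A"
  shows "c \<odot>\<^bsub>quot_algebra A I\<^esub> (I +> x) = I +> (c \<odot> x)"
proof -
  interpret ideal I A by fact
  have "I +> (c \<odot> y) = I +> (c \<odot> x)" if "y \<in> I +> x" for y
  proof -
    obtain i where i: "i \<in> I" "y = i \<oplus> x" using \<open>y \<in> I +> x\<close> by (auto simp: a_r_coset_def r_coset_def)
    then have "c \<odot> y = c \<odot> i \<oplus> c \<odot> x" using assms(2) by (simp add: a_Hcarr smult_r_distr)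
    moreover have "c \<odot> i \<in> I" by (rule ideal_smult_closed[OF assms(1) i(1)])
    ultimately have "c \<odot> y \<in> I +> (c \<odot> x)" by (auto simp: a_r_coset_def r_coset_def)
    then show ?thesis using a_repr_independence'[of "c \<odot> y" "c \<odot> x"] assms(2) by simp
  qed
  then have "(\<Union>y\<in>I +> x. I +> (c \<odot> y)) = (\<Union>y\<in>I +> x. I +> (c \<odot> x))" by (rule SUP_cong[OF refl])
  moreover have "I +> x \<noteq> {}" using a_rcos_self assms(2) by auto
  ultimately have "(\<Union>y\<in>I +> x. I +> (c \<odot> y)) = I +> (c \<odot> x)" by simp
  then show ?thesis by (simp add: quot_algebra_def)
qed

lemma quot_ring:
  assumes "ideal I A"
  shows "ring (quot_algebra A I)"
  by (rule ring_cong[OF ideal.quotient_is_ring[OF assms]]) (simp_all add: quot_algebra_def)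

lemma quot_hom:
  assumes "ideal I A"
  shows "(+>) I \<in> algebra_hom A (quot_algebra A I)"
proof -
  have "ring_hom A (quot_algebra A I) = ring_hom A (A Quot I)"
    by (simp add: ring_hom_def quot_algebra_def)
  then show ?thesis
    using ideal.rcos_ring_hom[OF assms] by (simp add: algebra_hom_def quot_smult[OF assms])
qed

lemma quot_eq_zero_iff:
  assumes "ideal I A" "x \<in> carrier A"
  shows "I +> x = \<zero>\<^bsub>quot_algebra A I\<^esub> \<longleftrightarrow> x \<in> I"
proof -
  interpret ideal I A by fact
  have "\<zero>\<^bsub>quot_algebra A I\<^esub> = I" by (simp add: quot_algebra_def FactRing_def)
  then show ?thesis
    using a_coset_join1[OF _ assms(2)] a_coset_join2[OF assms(2)] a_subgroup by metis
qed

lemma quot_K_algebra: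
  assumes "ideal I A"
  shows "K_algebra (quot_algebra A I)"
proof -
  let ?Q = "quot_algebra A I"
  interpret Q: ring ?Q by (rule quot_ring[OF assms])
  have h: "(+>) I \<in> ring_hom A ?Q" using quot_hom[OF assms] by (simp add: algebra_hom_def)
  have one: "\<one>\<^bsub>?Q\<^esub> = I +> \<one>" using ring_hom_one[OF h] by simp
  show ?thesis
  proof
    fix C c assume "C \<in> carrier ?Q"
    then obtain x where x: "x \<in> carrier A" "C = I +> x" by (auto simp: quot_carrier)
    show "c \<odot>\<^bsub>?Q\<^esub> C \<in> carrier ?Q"
      using x by (auto simp: quot_smult[OF assms] quot_carrier)
    show "c \<odot>\<^bsub>?Q\<^esub> \<one>\<^bsub>?Q\<^esub> \<otimes>\<^bsub>?Q\<^esub> C = c \<odot>\<^bsub>?Q\<^esub> C"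
      using x by (simp add: quot_smult[OF assms] one ring_hom_mult[OF h, symmetric] smult_one_mult)
    show "C \<otimes>\<^bsub>?Q\<^esub> (c \<odot>\<^bsub>?Q\<^esub> \<one>\<^bsub>?Q\<^esub>) = c \<odot>\<^bsub>?Q\<^esub> C"
      using x by (simp add: quot_smult[OF assms] one ring_hom_mult[OF h, symmetric] mult_smult_one)
  qed
qed

end

text \<open>First isomorphism theorem. The ring version supplies the bijection; compatibility with
  scalars is checked on representatives.\<close>

lemma isomorphic_algebras_kernel:
  assumes "K_algebra A" "K_algebra B" and h: "h \<in> algebra_hom A B" and surj: "h ` carrier A = carrier B"
    and I: "I = {x \<in> carrier A. h x = \<zero>\<^bsub>B\<^esub>}"
  shows "isomorphic_algebras (quot_algebra A I) B"
proof -
  interpret A: K_algebra A by fact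
  interpret B: K_algebra B by fact
  interpret h: ring_hom_ring A B h
    using h by (intro ring_hom_ringI2 A.ring_axioms B.ring_axioms) (simp add: algebra_hom_def)
  have I': "I = a_kernel A B h" unfolding I a_kernel_def' ..
  have idI: "ideal I A" unfolding I' by (rule h.kernel_is_ideal)
  let ?f = "\<lambda>C. the_elem (h ` C)"
  have "?f \<in> ring_iso (A Quot I) B" unfolding I' by (rule h.FactRing_iso_set[OF surj])
  moreover have "ring_iso (quot_algebra A I) B = ring_iso (A Quot I) B"
    by (simp add: ring_iso_def ring_hom_def quot_algebra_def)
  ultimately have f: "?f \<in> ring_iso (quot_algebra A I) B" by simp
  have fx: "?f (I +>\<^bsub>A\<^esub> x) = h x" if "x \<in> carrier A" for x unfolding I' by (rule h.the_elem_simp[OF that])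
  have "?f (c \<odot>\<^bsub>quot_algebra A I\<^esub> C) = c \<odot>\<^bsub>B\<^esub> ?f C" if "C \<in> carrier (quot_algebra A I)" for c C
  proof -
    obtain x where x: "x \<in> carrier A" "C = I +>\<^bsub>A\<^esub> x" using \<open>C \<in> _\<close> by (auto simp: A.quot_carrier)
    show ?thesis
      unfolding x(2) A.quot_smult[OF idI x(1)] fx[OF x(1)] fx[OF A.smult_closed[OF x(1)]]
      using h x(1) by (simp add: algebra_hom_def)
  qed
  then have "?f \<in> algebra_iso (quot_algebra A I) B"
    using f unfolding algebra_iso_def by blast
  then show ?thesis unfolding isomorphic_algebras_def by blast
qed

lemma isomorphic_algebras_sym:
  assumes "K_algebra A" "isomorphic_algebras A B"
  shows "isomorphic_algebras B A"
proof -
  interpret A: K_algebra A by fact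
  obtain h where h: "h \<in> ring_iso A B" and hs: "\<And>c x. x \<in> carrier A \<Longrightarrow> h (c \<odot>\<^bsub>A\<^esub> x) = c \<odot>\<^bsub>B\<^esub> h x"
    using assms(2) by (auto simp: isomorphic_algebras_def algebra_iso_def)
  have bij: "bij_betw h (carrier A) (carrier B)" using h by (simp add: ring_iso_def)
  let ?g = "inv_into (carrier A) h"
  have g: "?g \<in> ring_iso B A" using ring_iso_set_sym[OF A.ring_axioms h] .
  have "?g (c \<odot>\<^bsub>B\<^esub> y) = c \<odot>\<^bsub>A\<^esub> ?g y" if "y \<in> carrier B" for c y
  proof -
    have y: "?g y \<in> carrier A" "h (?g y) = y"
      using bij that by (auto simp: bij_betw_def inv_into_into f_inv_into_f)
    then have "c \<odot>\<^bsub>B\<^esub> y = h (c \<odot>\<^bsub>A\<^esub> ?g y)" by (simp add: hs)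
    then show ?thesis using bij y by (simp add: bij_betw_def inv_into_f_f)
  qed
  then show ?thesis using g by (auto simp: isomorphic_algebras_def algebra_iso_def)
qed

lemma isomorphic_algebras_trans:
  assumes "isomorphic_algebras A B" "isomorphic_algebras B C"
  shows "isomorphic_algebras A C"
proof -
  obtain f g where f: "f \<in> algebra_iso A B" and g: "g \<in> algebra_iso B C"
    using assms by (auto simp: isomorphic_algebras_def)
  have "g \<circ> f \<in> ring_iso A C" using f g ring_iso_set_trans by (auto simp: algebra_iso_def)
  moreover have "f x \<in> carrier B" if "x \<in> carrier A" for x
    using f that by (auto simp: algebra_iso_def ring_iso_def ring_hom_def)
  ultimately have "g \<circ> f \<in> algebra_iso A C" using f g by (auto simp: algebra_iso_def)
  then show ?thesis by (auto simp: isomorphic_algebras_def)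
qed

text \<open>Third isomorphism theorem with the kernel written as a preimage. It lets quotients of
  two different algebras be compared inside the path algebra that both come from: only the preimage
  \<open>M\<close> matters.\<close>

lemma isomorphic_algebras_double_quotient:
  assumes "K_algebra A" and J: "ideal J A"
    and S: "ideal S (quot_algebra A J)" and M: "M = {x \<in> carrier A. J +>\<^bsub>A\<^esub> x \<in> S}"
  shows "isomorphic_algebras (quot_algebra A M) (quot_algebra (quot_algebra A J) S)"
proof -
  interpret A: K_algebra A by fact
  let ?Q = "quot_algebra A J"
  interpret Q: K_algebra ?Q by (rule A.quot_K_algebra[OF J])
  let ?h = "\<lambda>x. S +>\<^bsub>?Q\<^esub> (J +>\<^bsub>A\<^esub> x)"
  have mem: "J +>\<^bsub>A\<^esub> x \<in> carrier ?Q" if "x \<in> carrier A" for x using that by (auto simp: A.quot_carrier)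
  show ?thesis
  proof (rule isomorphic_algebras_kernel[where h = ?h])
    show "?h \<in> algebra_hom A (quot_algebra ?Q S)"
      using A.quot_hom[OF J] Q.quot_hom[OF S] mem
      by (auto simp: algebra_hom_def ring_hom_def)
    show "?h ` carrier A = carrier (quot_algebra ?Q S)"
      by (auto simp: A.quot_carrier Q.quot_carrier)
    show "M = {x \<in> carrier A. ?h x = \<zero>\<^bsub>quot_algebra ?Q S\<^esub>}"
      unfolding M using Q.quot_eq_zero_iff[OF S mem] by auto
  qed (use assms Q.quot_K_algebra[OF S] in auto)
qed

text \<open>
  The invariant that separates \<open>\<Lambda>\<close> from \<open>\<Lambda>\<^sub>\<eta>\<close> at \<open>t = 1\<close>. In both algebras the radical consists of nilpotent elements
  and is generated by square-zero ones, so it compares the right with the left annihilator of the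
  radical without having to transport the radical along an isomorphism.
\<close>

definition square_zero_annihilators_right_to_left :: "('a, 'm) ring_scheme \<Rightarrow> bool" where
  "square_zero_annihilators_right_to_left R \<longleftrightarrow>
    (\<forall>x\<in>carrier R. (\<forall>y\<in>carrier R. y \<otimes>\<^bsub>R\<^esub> y = \<zero>\<^bsub>R\<^esub> \<longrightarrow> x \<otimes>\<^bsub>R\<^esub> y = \<zero>\<^bsub>R\<^esub>) \<longrightarrow>
       (\<forall>y\<in>carrier R. y \<otimes>\<^bsub>R\<^esub> y = \<zero>\<^bsub>R\<^esub> \<longrightarrow> y \<otimes>\<^bsub>R\<^esub> x = \<zero>\<^bsub>R\<^esub>))"

lemma square_zero_annihilators_iso:
  assumes "ring R" "ring S" "h \<in> ring_iso R S" "square_zero_annihilators_right_to_left S"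
  shows "square_zero_annihilators_right_to_left R"
proof -
  interpret h: ring_hom_ring R S h
    using assms by (intro ring_hom_ringI2) (auto simp: ring_iso_def)
  have bij: "bij_betw h (carrier R) (carrier S)" using assms(3) by (simp add: ring_iso_def)
  then have img: "h ` carrier R = carrier S" by (simp add: bij_betw_def)
  have z: "h a = \<zero>\<^bsub>S\<^esub> \<longleftrightarrow> a = \<zero>\<^bsub>R\<^esub>" if "a \<in> carrier R" for a
    using inj_on_eq_iff[OF bij_betw_imp_inj_on[OF bij] that h.R.zero_closed] by simp
  have tr: "h a \<otimes>\<^bsub>S\<^esub> h b = \<zero>\<^bsub>S\<^esub> \<longleftrightarrow> a \<otimes>\<^bsub>R\<^esub> b = \<zero>\<^bsub>R\<^esub>"
    if "a \<in> carrier R" "b \<in> carrier R" for a b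
    using z[of "a \<otimes>\<^bsub>R\<^esub> b"] h.hom_mult[OF that] that by simp
  show ?thesis
    unfolding square_zero_annihilators_right_to_left_def
  proof (intro ballI impI)
    fix x y assume x: "x \<in> carrier R"
      and r: "\<forall>y\<in>carrier R. y \<otimes>\<^bsub>R\<^esub> y = \<zero>\<^bsub>R\<^esub> \<longrightarrow> x \<otimes>\<^bsub>R\<^esub> y = \<zero>\<^bsub>R\<^esub>"
      and y: "y \<in> carrier R" "y \<otimes>\<^bsub>R\<^esub> y = \<zero>\<^bsub>R\<^esub>"
    have "\<forall>v\<in>carrier S. v \<otimes>\<^bsub>S\<^esub> v = \<zero>\<^bsub>S\<^esub> \<longrightarrow> h x \<otimes>\<^bsub>S\<^esub> v = \<zero>\<^bsub>S\<^esub>"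
    proof (intro ballI impI)
      fix v assume "v \<in> carrier S" and vv: "v \<otimes>\<^bsub>S\<^esub> v = \<zero>\<^bsub>S\<^esub>"
      then obtain u where u: "u \<in> carrier R" "v = h u" unfolding img[symmetric] by blast
      then show "h x \<otimes>\<^bsub>S\<^esub> v = \<zero>\<^bsub>S\<^esub>" using r vv tr[OF x u(1)] tr[OF u(1) u(1)] by blast
    qed
    then have "h y \<otimes>\<^bsub>S\<^esub> h x = \<zero>\<^bsub>S\<^esub>"
      using assms(4) h.hom_closed[OF x] h.hom_closed[OF y(1)] y(2) tr[OF y(1) y(1)]
      unfolding square_zero_annihilators_right_to_left_def by blast
    then show "y \<otimes>\<^bsub>R\<^esub> x = \<zero>\<^bsub>R\<^esub>" using tr[OF y(1) x] by blast
  qed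
qed

text \<open>A minimal \<open>T\<close> meets \<open>S\<close> in a nonzero ideal of the same kind,
  hence lies in \<open>S\<close>; so \<open>S\<close> is one of the ideals being intersected.
  Conversely \<open>span\<close> places \<open>S\<close> inside every competitor. No sum of ideals
  has to be formed.\<close>

lemma socle_wrt_eqI:
  assumes sub: "\<And>T. P T R \<Longrightarrow> additive_subgroup T R"
    and int: "\<And>T. P T R \<Longrightarrow> P (S \<inter> T) R"
    and S: "P S R"
    and meets: "\<And>T. P T R \<Longrightarrow> T \<noteq> {\<zero>\<^bsub>R\<^esub>} \<Longrightarrow> S \<inter> T \<noteq> {\<zero>\<^bsub>R\<^esub>}"
    and span: "\<And>U. additive_subgroup U R \<Longrightarrow> (\<And>T. minimal_wrt P R T \<Longrightarrow> T \<subseteq> U) \<Longrightarrow> S \<subseteq> U"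
  shows "socle_wrt P R = S"
proof
  have "T \<subseteq> S" if T: "minimal_wrt P R T" for T
  proof -
    have "P T R" "T \<noteq> {\<zero>\<^bsub>R\<^esub>}" using T by (auto simp: minimal_wrt_def)
    then have "P (S \<inter> T) R" "S \<inter> T \<noteq> {\<zero>\<^bsub>R\<^esub>}" by (auto intro: int dest: meets)
    then have "S \<inter> T = T" using T unfolding minimal_wrt_def by (metis Int_lower2)
    then show ?thesis by blast
  qed
  then show "socle_wrt P R \<subseteq> S" using S by (auto simp: socle_wrt_def)
  show "S \<subseteq> socle_wrt P R"
    unfolding socle_wrt_def
  proof (rule Inter_greatest)
    fix U assume "U \<in> {J. P J R \<and> (\<forall>M. minimal_wrt P R M \<longrightarrow> M \<subseteq> J)}"
    then show "S \<subseteq> U" by (intro span sub) auto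
  qed
qed

lemma ideal_image:
  assumes "ring_hom_ring R S h" and surj: "h ` carrier R = carrier S" and "ideal I R"
  shows "ideal (h ` I) S"
proof -
  interpret h: ring_hom_ring R S h by fact
  interpret I: ideal I R by fact
  note I_sub = I.additive_subgroup_axioms
  show ?thesis
  proof (rule idealI[OF h.S.ring_axioms])
    show "subgroup (h ` I) (add_monoid S)"
    proof (rule h.S.add.subgroupI)
      show "h ` I \<subseteq> carrier S" using surj I.a_subset by blast
      show "h ` I \<noteq> {}" using additive_subgroup.zero_closed[OF I_sub] by blast
      fix y assume "y \<in> h ` I"
      then obtain x where x: "x \<in> I" "y = h x" by blast
      have "h (\<ominus>\<^bsub>R\<^esub> x) = \<ominus>\<^bsub>S\<^esub> y" using x I.a_Hcarr by simp
      then show "\<ominus>\<^bsub>S\<^esub> y \<in> h ` I" using additive_subgroup.a_inv_closed[OF I_sub x(1)] by (metis imageI)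
      fix y' assume "y' \<in> h ` I"
      then obtain x' where x': "x' \<in> I" "y' = h x'" by blast
      have "h (x \<oplus>\<^bsub>R\<^esub> x') = y \<oplus>\<^bsub>S\<^esub> y'" using x x' I.a_Hcarr by simp
      then show "y \<oplus>\<^bsub>S\<^esub> y' \<in> h ` I"
        using additive_subgroup.a_closed[OF I_sub x(1) x'(1)] by (metis imageI)
    qed
    fix y r assume "y \<in> h ` I" "r \<in> carrier S"
    then obtain x t where x: "x \<in> I" "y = h x" and t: "t \<in> carrier R" "r = h t"
      using surj by blast
    have "h (t \<otimes>\<^bsub>R\<^esub> x) = r \<otimes>\<^bsub>S\<^esub> y" "h (x \<otimes>\<^bsub>R\<^esub> t) = y \<otimes>\<^bsub>S\<^esub> r" using x t I.a_Hcarr by simp_all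
    then show "r \<otimes>\<^bsub>S\<^esub> y \<in> h ` I" "y \<otimes>\<^bsub>S\<^esub> r \<in> h ` I"
      using I.I_l_closed[OF x(1) t(1)] I.I_r_closed[OF x(1) t(1)] by (metis imageI)+
  qed
qed

lemma (in ring) additive_subgroup_Int:
  assumes "additive_subgroup S R" "additive_subgroup T R"
  shows "additive_subgroup (S \<inter> T) R"
  using assms add.subgroups_Inter_pair unfolding additive_subgroup_def by blast

section \<open>Path algebras of finite quivers\<close>

text \<open>Scalar multiple of a basis path. In contrast to \<open>path_elem\<close>, the start
  vertex is explicit, so trivial paths are included.\<close>

definition single :: "'a \<Rightarrow> 'k \<Rightarrow> 'a \<Rightarrow> 'k::zero" where
  "single x c = (\<lambda>y. if y = x then c else 0)"

lemma single_apply: "single x c y = (if y = x then c else 0)"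
  by (simp add: single_def)

text \<open>Serves associativity: the left side runs over pairs of cut points m <= n of a path of
  length N, the right side records the second cut by its distance l from the first.\<close>

lemma sum_triangle:
  fixes F :: "nat \<Rightarrow> nat \<Rightarrow> 'a::comm_monoid_add"
  shows "(\<Sum>n\<le>N. \<Sum>m\<le>n. F m n) = (\<Sum>m\<le>N. \<Sum>l\<le>N - m. F m (m + l))"
proof -
  have "(\<Sum>n\<le>N. \<Sum>m\<le>n. F m n) = (\<Sum>(n, m)\<in>(SIGMA n:{..N}. {..n}). F m n)"
    by (simp add: sum.Sigma)
  also have "\<dots> = (\<Sum>(m, l)\<in>(SIGMA m:{..N}. {..N - m}). F m (m + l))"
    by (rule sum.reindex_bij_witness[where j = "\<lambda>(n, m). (m, n - m)" and i = "\<lambda>(m, l). (m + l, m)"]) auto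
  also have "\<dots> = (\<Sum>m\<le>N. \<Sum>l\<le>N - m. F m (m + l))"
    by (simp add: sum.Sigma)
  finally show ?thesis .
qed

context pre_digraph
begin

definition is_path :: "'a \<times> 'b list \<Rightarrow> bool" where
  "is_path x \<longleftrightarrow> (\<exists>v. awalk (fst x) (snd x) v)"

definition path_end :: "'a \<times> 'b list \<Rightarrow> 'a" where
  "path_end x = awlast (fst x) (snd x)"

lemma path_algebra_carrier:
  "f \<in> carrier (path_algebra G) \<longleftrightarrow> finite {x. f x \<noteq> 0} \<and> (\<forall>x. f x \<noteq> 0 \<longrightarrow> is_path x)"
  by (auto simp: path_algebra_def is_path_def)

lemma path_algebra_is_path: "f \<in> carrier (path_algebra G) \<Longrightarrow> f x \<noteq> 0 \<Longrightarrow> is_path x"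
  unfolding path_algebra_carrier by blast

lemma path_algebra_mult:
  "(f \<otimes>\<^bsub>path_algebra G\<^esub> g) (u, w) =
    (\<Sum>n\<le>length w. f (u, take n w) * g (awlast u (take n w), drop n w))"
  by (simp add: path_algebra_def)

lemma path_algebra_one: "\<one>\<^bsub>path_algebra G\<^esub> = (\<lambda>x. if fst x \<in> verts G \<and> snd x = [] then 1 else 0)"
  by (auto simp: path_algebra_def fun_eq_iff)

lemma path_algebra_zero: "\<zero>\<^bsub>path_algebra G\<^esub> = (\<lambda>x. 0)"
  by (simp add: path_algebra_def)

lemma path_algebra_add: "f \<oplus>\<^bsub>path_algebra G\<^esub> g = (\<lambda>x. f x + g x)"
  by (simp add: path_algebra_def)

lemma path_algebra_smult: "c \<odot>\<^bsub>path_algebra G\<^esub> f = (\<lambda>x. c * f x)"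
  by (simp add: path_algebra_def)

lemmas path_algebra_pointwise = path_algebra_zero path_algebra_add path_algebra_smult

lemma path_elem_eq_single: "path_elem G w = single (tail G (hd w), w) 1"
  by (auto simp: path_elem_def single_def)

lemma path_algebra_single:
  assumes "is_path x"
  shows "single x c \<in> carrier (path_algebra G)"
proof -
  have "{y. single x c y \<noteq> 0} \<subseteq> {x}" by (auto simp: single_def)
  then have "finite {y. single x c y \<noteq> 0}" by (rule finite_subset) simp
  then show ?thesis using assms by (auto simp: path_algebra_carrier single_def)
qed

text \<open>Adds up the finitely many terms of \<open>f\<close>. The last case is restricted to the
  support of \<open>f\<close> with its actual coefficients, so that what is known about
  \<open>f\<close> can be used on each single path.\<close>

lemma path_algebra_induct [consumes 1, case_names zero add single]:
  assumes f: "f \<in> carrier (path_algebra G)"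
    and zero: "(\<lambda>x. 0) \<in> S"
    and add: "\<And>g h. g \<in> S \<Longrightarrow> h \<in> S \<Longrightarrow> (\<lambda>x. g x + h x) \<in> S"
    and single: "\<And>x. f x \<noteq> 0 \<Longrightarrow> single x (f x) \<in> S"
  shows "f \<in> S"
proof -
  have fin: "finite {x. f x \<noteq> 0}" using f by (simp add: path_algebra_carrier)
  have "(\<lambda>x. if x \<in> F then f x else 0) \<in> S" if "finite F" "F \<subseteq> {x. f x \<noteq> 0}" for F
    using that
  proof (induction F rule: finite_induct)
    case empty
    then show ?case using zero by simp
  next
    case (insert y F)
    have "(\<lambda>x. if x \<in> insert y F then f x else 0) =
        (\<lambda>x. single y (f y) x + (if x \<in> F then f x else 0))"
      using insert.hyps(2) by (auto simp: single_def)
    moreover have "single y (f y) \<in> S" using insert.prems single by blast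
    moreover have "(\<lambda>x. if x \<in> F then f x else 0) \<in> S" using insert by blast
    ultimately show ?case using add by simp
  qed
  from this[OF fin] have "(\<lambda>x. if f x \<noteq> 0 then f x else 0) \<in> S" by simp
  moreover have "(\<lambda>x. if f x \<noteq> 0 then f x else 0) = f" by auto
  ultimately show ?thesis by simp
qed

text \<open>Among all cuts of the path only the one leaving a tail of the length of
  \<open>snd y\<close> can match the second factor.\<close>

lemma mult_single_append:
  fixes f :: "'a \<times> 'b list \<Rightarrow> 'k::field"
  assumes "awlast u w = fst y"
  shows "(f \<otimes>\<^bsub>path_algebra G\<^esub> single y c) (u, w @ snd y) = f (u, w) * c"
proof -
  let ?t = "\<lambda>n. f (u, take n (w @ snd y)) * single y c (awlast u (take n (w @ snd y)), drop n (w @ snd y))"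
  have "?t n = 0" if "n \<le> length (w @ snd y)" "n \<noteq> length w" for n
  proof -
    have "length (drop n (w @ snd y)) \<noteq> length (snd y)" using that by simp
    then have "drop n (w @ snd y) \<noteq> snd y" by metis
    then have "(awlast u (take n (w @ snd y)), drop n (w @ snd y)) \<noteq> y" by (metis snd_conv)
    then show ?thesis unfolding single_apply by simp
  qed
  then have "(\<Sum>n\<le>length (w @ snd y). ?t n) = (\<Sum>n\<in>{length w}. ?t n)"
    by (intro sum.mono_neutral_right) auto
  also have "\<dots> = f (u, w) * c" using assms by (simp add: single_def)
  finally show ?thesis by (simp only: path_algebra_mult)
qed

lemma mult_single_eq_0:
  fixes f :: "'a \<times> 'b list \<Rightarrow> 'k::field"
  assumes "\<And>v. w = v @ snd y \<Longrightarrow> awlast u v \<noteq> fst y"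
  shows "(f \<otimes>\<^bsub>path_algebra G\<^esub> single y c) (u, w) = 0"
  unfolding path_algebra_mult
proof (intro sum.neutral ballI)
  fix n assume "n \<in> {..length w}"
  have "single y c (awlast u (take n w), drop n w) = 0"
    using assms[of "take n w"] by (auto simp: single_def)
  then show "f (u, take n w) * single y c (awlast u (take n w), drop n w) = 0" by simp
qed

lemma single_mult_append:
  fixes f :: "'a \<times> 'b list \<Rightarrow> 'k::field"
  shows "(single y c \<otimes>\<^bsub>path_algebra G\<^esub> f) (fst y, snd y @ w) = c * f (path_end y, w)"
proof -
  let ?t = "\<lambda>n. single y c (fst y, take n (snd y @ w)) * f (awlast (fst y) (take n (snd y @ w)), drop n (snd y @ w))"
  have "?t n = 0" if "n \<le> length (snd y @ w)" "n \<noteq> length (snd y)" for n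
  proof -
    have "length (take n (snd y @ w)) \<noteq> length (snd y)" using that by simp
    then have "take n (snd y @ w) \<noteq> snd y" by metis
    then show ?thesis by (auto simp: single_def prod_eq_iff)
  qed
  then have "(\<Sum>n\<le>length (snd y @ w). ?t n) = (\<Sum>n\<in>{length (snd y)}. ?t n)"
    by (intro sum.mono_neutral_right) auto
  also have "\<dots> = c * f (path_end y, w)" by (simp add: single_def path_end_def)
  finally show ?thesis by (simp only: path_algebra_mult)
qed

lemma single_mult_eq_0:
  fixes f :: "'a \<times> 'b list \<Rightarrow> 'k::field"
  assumes "\<And>v. (u, w) \<noteq> (fst y, snd y @ v)"
  shows "(single y c \<otimes>\<^bsub>path_algebra G\<^esub> f) (u, w) = 0"
  unfolding path_algebra_mult
proof (intro sum.neutral ballI)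
  fix n assume "n \<in> {..length w}"
  have "single y c (u, take n w) = 0"
    using assms[of "drop n w"] append_take_drop_id[of n w] by (auto simp: single_def)
  then show "single y c (u, take n w) * f (awlast u (take n w), drop n w) = 0" by simp
qed

lemma mult_single:
  assumes "path_end x = fst y"
  shows "single x c \<otimes>\<^bsub>path_algebra G\<^esub> single y d = single (fst x, snd x @ snd y) ((c::'k::field) * d)"
proof
  fix z :: "'a \<times> 'b list" obtain u w where z: "z = (u, w)" by (cases z)
  show "(single x c \<otimes>\<^bsub>path_algebra G\<^esub> single y d) z = single (fst x, snd x @ snd y) (c * d) z"
  proof (cases "\<exists>v. (u, w) = (fst x, snd x @ v)")
    case True
    then obtain v where v: "u = fst x" "w = snd x @ v" by auto
    have "(v = snd y) = ((path_end x, v) = y)" using assms by (auto simp: prod_eq_iff)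
    then show ?thesis
      unfolding z v single_mult_append by (simp add: single_apply)
  next
    case False
    then show ?thesis using single_mult_eq_0[of u w x c "single y d"] by (auto simp: z single_apply)
  qed
qed

end

context wf_digraph
begin

lemma is_path_append_iff:
  "is_path (u, v @ w) \<longleftrightarrow> is_path (u, v) \<and> is_path (awlast u v, w)"
  unfolding is_path_def by (auto simp: awalk_append_iff)

lemma is_path_Nil_iff: "is_path (u, []) \<longleftrightarrow> u \<in> verts G"
  by (simp add: is_path_def awalk_Nil_iff)

lemma is_path_Cons_iff: "is_path (u, a # w) \<longleftrightarrow> a \<in> arcs G \<and> tail G a = u \<and> is_path (head G a, w)"
  by (auto simp: is_path_def awalk_Cons_iff)

lemma path_end_in_verts: "is_path x \<Longrightarrow> path_end x \<in> verts G"
  unfolding is_path_def path_end_def by auto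

end

context fin_digraph
begin

text \<open>Each path in the support of the product is a concatenation of one path from either
  support, which gives both finiteness and the path property.\<close>

lemma mult_closed:
  assumes "f \<in> carrier (path_algebra G)" "g \<in> carrier (path_algebra G)"
  shows "f \<otimes>\<^bsub>path_algebra G\<^esub> g \<in> carrier (path_algebra G :: ('k::field, _) module)"
proof -
  let ?S = "{x. f x \<noteq> 0}" and ?T = "{x. g x \<noteq> 0}"
  have *: "\<exists>n. f (u, take n w) \<noteq> 0 \<and> g (awlast u (take n w), drop n w) \<noteq> 0"
    if "(f \<otimes>\<^bsub>path_algebra G\<^esub> g) (u, w) \<noteq> 0" for u w
  proof (rule ccontr)
    assume "\<nexists>n. f (u, take n w) \<noteq> 0 \<and> g (awlast u (take n w), drop n w) \<noteq> 0"
    then have "(f \<otimes>\<^bsub>path_algebra G\<^esub> g) (u, w) = 0"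
      unfolding path_algebra_mult by (intro sum.neutral) auto
    then show False using that by simp
  qed
  have "{x. (f \<otimes>\<^bsub>path_algebra G\<^esub> g) x \<noteq> 0} \<subseteq> (\<lambda>(x, y). (fst x, snd x @ snd y)) ` (?S \<times> ?T)"
  proof
    fix z assume "z \<in> {x. (f \<otimes>\<^bsub>path_algebra G\<^esub> g) x \<noteq> 0}"
    moreover obtain u w where z: "z = (u, w)" by (cases z)
    ultimately obtain n where "f (u, take n w) \<noteq> 0" "g (awlast u (take n w), drop n w) \<noteq> 0"
      using *[of u w] by auto
    then show "z \<in> (\<lambda>(x, y). (fst x, snd x @ snd y)) ` (?S \<times> ?T)"
      unfolding z by (intro image_eqI[of _ _ "((u, take n w), (awlast u (take n w), drop n w))"]) auto
  qed
  then have "finite {x. (f \<otimes>\<^bsub>path_algebra G\<^esub> g) x \<noteq> 0}"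
    by (rule finite_subset) (use assms in \<open>auto simp: path_algebra_carrier\<close>)
  moreover have "is_path (u, w)" if nz: "(f \<otimes>\<^bsub>path_algebra G\<^esub> g) (u, w) \<noteq> 0" for u w
  proof -
    obtain n where n: "f (u, take n w) \<noteq> 0" "g (awlast u (take n w), drop n w) \<noteq> 0"
      using *[OF nz] by blast
    then have "is_path (u, take n w)" "is_path (awlast u (take n w), drop n w)"
      using assms by (auto simp: path_algebra_carrier)
    then have "is_path (u, take n w @ drop n w)" unfolding is_path_append_iff by blast
    then show ?thesis by simp
  qed
  ultimately show ?thesis unfolding path_algebra_carrier by auto
qed

lemma mult_assoc:
  fixes f g h :: "'a \<times> 'b list \<Rightarrow> 'k::field"
  shows "(f \<otimes>\<^bsub>path_algebra G\<^esub> g) \<otimes>\<^bsub>path_algebra G\<^esub> h = f \<otimes>\<^bsub>path_algebra G\<^esub> (g \<otimes>\<^bsub>path_algebra G\<^esub> h)"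
proof
  fix z :: "'a \<times> 'b list" obtain u w where z: "z = (u, w)" by (cases z)
  let ?F = "\<lambda>m n. f (u, take m w) * g (awlast u (take m w), drop m (take n w))
    * h (awlast u (take n w), drop n w)"
  have "((f \<otimes>\<^bsub>path_algebra G\<^esub> g) \<otimes>\<^bsub>path_algebra G\<^esub> h) z = (\<Sum>n\<le>length w. \<Sum>m\<le>n. ?F m n)"
    by (auto simp: z path_algebra_mult sum_distrib_right min_def intro!: sum.cong)
  also have "\<dots> = (\<Sum>m\<le>length w. \<Sum>l\<le>length w - m. ?F m (m + l))" by (rule sum_triangle)
  also have "\<dots> = (f \<otimes>\<^bsub>path_algebra G\<^esub> (g \<otimes>\<^bsub>path_algebra G\<^esub> h)) z"
    unfolding z path_algebra_mult sum_distrib_left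
  proof (rule sum.cong[OF refl], rule sum.cong)
    fix m l
    have "take (m + l) w = take m w @ take l (drop m w)" by (rule take_add)
    then have "awlast (awlast u (take m w)) (take l (drop m w)) = awlast u (take (m + l) w)"
      by (simp only: awlast_append)
    then show "?F m (m + l) = f (u, take m w) * (g (awlast u (take m w), take l (drop m w)) *
        h (awlast (awlast u (take m w)) (take l (drop m w)), drop l (drop m w)))"
      by (simp add: drop_take ac_simps)
  qed simp
  finally show "((f \<otimes>\<^bsub>path_algebra G\<^esub> g) \<otimes>\<^bsub>path_algebra G\<^esub> h) z
    = (f \<otimes>\<^bsub>path_algebra G\<^esub> (g \<otimes>\<^bsub>path_algebra G\<^esub> h)) z" .
qed

lemma scalar_mult:
  fixes f :: "'a \<times> 'b list \<Rightarrow> 'k::field"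
  assumes "f \<in> carrier (path_algebra G)"
  shows "(c \<odot>\<^bsub>path_algebra G\<^esub> \<one>\<^bsub>path_algebra G\<^esub>) \<otimes>\<^bsub>path_algebra G\<^esub> f = c \<odot>\<^bsub>path_algebra G\<^esub> f"
proof
  fix z :: "'a \<times> 'b list" obtain u w where z: "z = (u, w)" by (cases z)
  let ?t = "\<lambda>n. (c \<odot>\<^bsub>path_algebra G\<^esub> \<one>\<^bsub>path_algebra G\<^esub>) (u, take n w) * f (awlast u (take n w), drop n w)"
  have "(\<Sum>n\<le>length w. ?t n) = (\<Sum>n\<in>{0}. ?t n)"
    by (rule sum.mono_neutral_right) (auto simp: path_algebra_smult path_algebra_one)
  \<comment> \<open>If \<open>u\<close> is not a vertex, the unit has coefficient 0 at
    \<open>(u, [])\<close>; but then \<open>(u, w)\<close> is no path and \<open>f\<close> vanishes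
    there as well.\<close>
  also have "\<dots> = c * f (u, w)"
    using assms by (auto simp: path_algebra_smult path_algebra_one path_algebra_carrier is_path_def)
  finally have "((c \<odot>\<^bsub>path_algebra G\<^esub> \<one>\<^bsub>path_algebra G\<^esub>) \<otimes>\<^bsub>path_algebra G\<^esub> f) z = c * f z"
    by (simp only: z path_algebra_mult)
  then show "((c \<odot>\<^bsub>path_algebra G\<^esub> \<one>\<^bsub>path_algebra G\<^esub>) \<otimes>\<^bsub>path_algebra G\<^esub> f) z = (c \<odot>\<^bsub>path_algebra G\<^esub> f) z"
    by (simp add: path_algebra_smult)
qed

lemma mult_scalar:
  fixes f :: "'a \<times> 'b list \<Rightarrow> 'k::field"
  assumes "f \<in> carrier (path_algebra G)"
  shows "f \<otimes>\<^bsub>path_algebra G\<^esub> (c \<odot>\<^bsub>path_algebra G\<^esub> \<one>\<^bsub>path_algebra G\<^esub>) = c \<odot>\<^bsub>path_algebra G\<^esub> f"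
proof
  fix z :: "'a \<times> 'b list" obtain u w where z: "z = (u, w)" by (cases z)
  let ?t = "\<lambda>n. f (u, take n w) * (c \<odot>\<^bsub>path_algebra G\<^esub> \<one>\<^bsub>path_algebra G\<^esub>) (awlast u (take n w), drop n w)"
  have "(\<Sum>n\<le>length w. ?t n) = (\<Sum>n\<in>{length w}. ?t n)"
    by (rule sum.mono_neutral_right) (auto simp: path_algebra_smult path_algebra_one)
  also have "\<dots> = c * f (u, w)"
    using assms by (auto simp: path_algebra_smult path_algebra_one path_algebra_carrier is_path_def)
  finally have "(f \<otimes>\<^bsub>path_algebra G\<^esub> (c \<odot>\<^bsub>path_algebra G\<^esub> \<one>\<^bsub>path_algebra G\<^esub>)) z = c * f z"
    by (simp only: z path_algebra_mult)
  then show "(f \<otimes>\<^bsub>path_algebra G\<^esub> (c \<odot>\<^bsub>path_algebra G\<^esub> \<one>\<^bsub>path_algebra G\<^esub>)) z = (c \<odot>\<^bsub>path_algebra G\<^esub> f) z"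
    by (simp add: path_algebra_smult)
qed

lemma one_closed: "\<one>\<^bsub>path_algebra G\<^esub> \<in> carrier (path_algebra G :: ('k::field, _) module)"
proof -
  have "{x :: 'a \<times> 'b list. fst x \<in> verts G \<and> snd x = []} = (\<lambda>u. (u, [])) ` verts G" by auto
  then show ?thesis by (auto simp: path_algebra_carrier path_algebra_one is_path_Nil_iff)
qed

lemma smult_closed:
  assumes "f \<in> carrier (path_algebra G)"
  shows "(\<lambda>x. c * f x) \<in> carrier (path_algebra G :: ('k::field, _) module)"
proof -
  have "{x. c * f x \<noteq> 0} \<subseteq> {x. f x \<noteq> 0}" by auto
  then show ?thesis using assms by (auto simp: path_algebra_carrier intro: finite_subset)
qed

lemma add_closed:
  assumes "f \<in> carrier (path_algebra G)" "g \<in> carrier (path_algebra G)"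
  shows "(\<lambda>x. f x + g x) \<in> carrier (path_algebra G :: ('k::field, _) module)"
proof -
  have "{x. f x + g x \<noteq> 0} \<subseteq> {x. f x \<noteq> 0} \<union> {x. g x \<noteq> 0}" by auto
  then have "finite {x. f x + g x \<noteq> 0}"
    by (rule finite_subset) (use assms in \<open>auto simp: path_algebra_carrier\<close>)
  moreover have "is_path x" if "f x + g x \<noteq> 0" for x
    using that path_algebra_is_path[OF assms(1), of x] path_algebra_is_path[OF assms(2), of x]
    by (cases "f x = 0") simp_all
  ultimately show ?thesis by (simp add: path_algebra_carrier)
qed

lemma zero_closed: "(\<lambda>x. 0) \<in> carrier (path_algebra G :: ('k::field, _) module)"
  by (simp add: path_algebra_carrier)

lemma path_algebra_ring: "ring (path_algebra G :: ('k::field, _) module)"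
proof (rule ringI)
  show "abelian_group (path_algebra G :: ('k, _) module)"
  proof (rule abelian_groupI)
    fix f :: "'a \<times> 'b list \<Rightarrow> 'k" assume f: "f \<in> carrier (path_algebra G)"
    show "\<exists>g\<in>carrier (path_algebra G). g \<oplus>\<^bsub>path_algebra G\<^esub> f = \<zero>\<^bsub>path_algebra G\<^esub>"
      using smult_closed[OF f, of "-1"]
      by (intro bexI[of _ "\<lambda>x. - f x"]) (auto simp: path_algebra_pointwise)
  qed (auto simp: path_algebra_pointwise add_closed zero_closed ac_simps)
  show "Group.monoid (path_algebra G :: ('k, _) module)"
  proof (rule monoidI)
    fix f :: "'a \<times> 'b list \<Rightarrow> 'k" assume f: "f \<in> carrier (path_algebra G)"
    show "\<one>\<^bsub>path_algebra G\<^esub> \<otimes>\<^bsub>path_algebra G\<^esub> f = f"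
      using scalar_mult[OF f, of 1] by (simp add: path_algebra_smult)
    show "f \<otimes>\<^bsub>path_algebra G\<^esub> \<one>\<^bsub>path_algebra G\<^esub> = f"
      using mult_scalar[OF f, of 1] by (simp add: path_algebra_smult)
  qed (simp_all only: mult_closed one_closed mult_assoc)
qed (simp_all add: fun_eq_iff path_algebra_add path_algebra_mult sum.distrib[symmetric] distrib_left distrib_right)

lemma path_algebra_K_algebra: "K_algebra (path_algebra G :: ('k::field, _) module)"
proof -
  interpret ring "path_algebra G :: ('k, _) module" by (rule path_algebra_ring)
  show ?thesis
  proof
    fix f :: "'a \<times> 'b list \<Rightarrow> 'k" and c assume f: "f \<in> carrier (path_algebra G)"
    show "c \<odot>\<^bsub>path_algebra G\<^esub> f \<in> carrier (path_algebra G)"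
      unfolding path_algebra_smult by (rule smult_closed[OF f])
    show "c \<odot>\<^bsub>path_algebra G\<^esub> \<one>\<^bsub>path_algebra G\<^esub> \<otimes>\<^bsub>path_algebra G\<^esub> f = c \<odot>\<^bsub>path_algebra G\<^esub> f"
      by (rule scalar_mult[OF f])
    show "f \<otimes>\<^bsub>path_algebra G\<^esub> (c \<odot>\<^bsub>path_algebra G\<^esub> \<one>\<^bsub>path_algebra G\<^esub>) = c \<odot>\<^bsub>path_algebra G\<^esub> f"
      by (rule mult_scalar[OF f])
  qed
qed

lemma path_algebra_minus:
  fixes f g :: "'a \<times> 'b list \<Rightarrow> 'k::field"
  assumes "f \<in> carrier (path_algebra G)" "g \<in> carrier (path_algebra G)"
  shows "f \<ominus>\<^bsub>path_algebra G\<^esub> g = (\<lambda>x. f x - g x)"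
proof -
  interpret ring "path_algebra G :: ('k, _) module" by (rule path_algebra_ring)
  have g': "(\<lambda>x. - g x) \<in> carrier (path_algebra G)" using smult_closed[OF assms(2), of "-1"] by simp
  have "\<ominus>\<^bsub>path_algebra G\<^esub> g = (\<lambda>x. - g x)"
    by (rule minus_equality[OF _ assms(2) g']) (simp add: path_algebra_pointwise)
  then show ?thesis unfolding a_minus_def by (simp add: path_algebra_add)
qed

lemma path_algebra_subgroupI:
  fixes S :: "('a \<times> 'b list \<Rightarrow> 'k::field) set"
  assumes "S \<subseteq> carrier (path_algebra G)" "(\<lambda>x. 0) \<in> S"
    and "\<And>f g. f \<in> S \<Longrightarrow> g \<in> S \<Longrightarrow> (\<lambda>x. f x + g x) \<in> S"
    and "\<And>f c. f \<in> S \<Longrightarrow> (\<lambda>x. c * f x) \<in> S"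
  shows "additive_subgroup S (path_algebra G)"
proof -
  interpret ring "path_algebra G :: ('k, _) module" by (rule path_algebra_ring)
  have "\<ominus>\<^bsub>path_algebra G\<^esub> f \<in> S" if "f \<in> S" for f
  proof -
    have f: "f \<in> carrier (path_algebra G)" using that assms(1) by blast
    have "(\<lambda>x. - f x) \<in> S" using assms(4)[OF that, of "-1"] by simp
    moreover have "\<ominus>\<^bsub>path_algebra G\<^esub> f = (\<lambda>x. - f x)"
      by (rule minus_equality[OF _ f]) (use calculation assms(1) in \<open>auto simp: path_algebra_pointwise\<close>)
    ultimately show ?thesis by simp
  qed
  then show ?thesis
    using assms
    by (intro additive_subgroupI add.subgroupI) (auto simp: path_algebra_pointwise a_inv_def)
qed

lemma path_algebra_idealI:
  fixes S :: "('a \<times> 'b list \<Rightarrow> 'k::field) set"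
  assumes "S \<subseteq> carrier (path_algebra G)" "(\<lambda>x. 0) \<in> S"
    and "\<And>f g. f \<in> S \<Longrightarrow> g \<in> S \<Longrightarrow> (\<lambda>x. f x + g x) \<in> S"
    and "\<And>f c. f \<in> S \<Longrightarrow> (\<lambda>x. c * f x) \<in> S"
    and "\<And>f r. f \<in> S \<Longrightarrow> r \<in> carrier (path_algebra G) \<Longrightarrow> r \<otimes>\<^bsub>path_algebra G\<^esub> f \<in> S"
    and "\<And>f r. f \<in> S \<Longrightarrow> r \<in> carrier (path_algebra G) \<Longrightarrow> f \<otimes>\<^bsub>path_algebra G\<^esub> r \<in> S"
  shows "ideal S (path_algebra G)"
proof -
  interpret additive_subgroup S "path_algebra G" by (rule path_algebra_subgroupI[OF assms(1-4)])
  show ?thesis by (rule idealI[OF path_algebra_ring a_subgroup assms(5,6)])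
qed

text \<open>Multiplication by the prefix, which carries the scalar \<open>c\<close>, and by the
  suffix. Since \<open>w\<close> is nonempty, its start vertex is forced by its first arrow, which
  makes the factors composable.\<close>

lemma ideal_single:
  fixes I :: "('a \<times> 'b list \<Rightarrow> 'k::field) set"
  assumes I: "ideal I (path_algebra G)" and path: "is_path (u, v @ w @ v')" and "w \<noteq> []"
    and w: "single (tail G (hd w), w) 1 \<in> I"
  shows "single (u, v @ w @ v') c \<in> I"
proof -
  interpret ideal I "path_algebra G" by fact
  have p: "is_path (u, v)" "is_path (awlast u v, w)" "is_path (awlast (awlast u v) w, v')"
    using path unfolding is_path_append_iff by auto
  have h: "awlast u v = tail G (hd w)" using p(2) \<open>w \<noteq> []\<close> by (cases w) (auto simp: is_path_Cons_iff)
  have "single (u, v) c \<otimes>\<^bsub>path_algebra G\<^esub> single (tail G (hd w), w) 1 \<in> I"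
    by (rule I_l_closed[OF w path_algebra_single[OF p(1)]])
  then have "single (u, v @ w) c \<in> I" using h by (simp add: mult_single path_end_def)
  then have "single (u, v @ w) c \<otimes>\<^bsub>path_algebra G\<^esub> single (awlast (awlast u v) w, v') 1 \<in> I"
    by (rule I_r_closed[OF _ path_algebra_single[OF p(3)]])
  then show ?thesis by (simp add: mult_single path_end_def awlast_append)
qed

end

section \<open>Quivers with a successor permutation\<close>

text \<open>
  \<open>nxt a\<close> is the only arrow \<open>b\<close> for which the path \<open>ab\<close> survives in the quotient, and \<open>L\<close> is the
  length of the maximal nonzero paths. Every arrow starts one such path; the ones starting
  with \<open>a \<in> D\<close> and with \<open>\<sigma> a \<in> E\<close> are parallel and are to be made proportional.
\<close>

locale chain_quiver = fin_digraph G for G :: "('v, 'e) pre_digraph" +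
  fixes nxt :: "'e \<Rightarrow> 'e" and L :: nat and D E :: "'e set" and \<sigma> :: "'e \<Rightarrow> 'e"
  assumes nxt_bij: "bij_betw nxt (arcs G) (arcs G)"
    and tail_nxt: "a \<in> arcs G \<Longrightarrow> tail G (nxt a) = head G a"
    and nxt_neq: "a \<in> arcs G \<Longrightarrow> nxt a \<noteq> a"
    and two_le_L: "2 \<le> L"
    and out_arc: "v \<in> verts G \<Longrightarrow> \<exists>a\<in>arcs G. tail G a = v"
    and D_arcs: "D \<subseteq> arcs G" and E_arcs: "E \<subseteq> arcs G" and D_E: "D \<inter> E = {}"
    and \<sigma>_bij: "bij_betw \<sigma> D E"
    and tail_\<sigma>: "a \<in> D \<Longrightarrow> tail G (\<sigma> a) = tail G a"
    and end_\<sigma>: "a \<in> D \<Longrightarrow> tail G ((nxt ^^ L) (\<sigma> a)) = tail G ((nxt ^^ L) a)"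
    and nxt_E: "a \<in> E \<Longrightarrow> nxt a \<notin> E"
begin

lemma nxt_arc: "a \<in> arcs G \<Longrightarrow> nxt a \<in> arcs G"
  using nxt_bij by (auto simp: bij_betw_def)

lemma nxt_pow_arc: "a \<in> arcs G \<Longrightarrow> (nxt ^^ n) a \<in> arcs G"
  by (induction n) (auto simp: nxt_arc)

lemma nxt_pow_inj: "a \<in> arcs G \<Longrightarrow> b \<in> arcs G \<Longrightarrow> (nxt ^^ n) a = (nxt ^^ n) b \<longleftrightarrow> a = b"
proof (induction n)
  case (Suc n)
  have "inj_on nxt (arcs G)" using nxt_bij by (simp add: bij_betw_def)
  from inj_on_eq_iff[OF this nxt_pow_arc[OF Suc.prems(1)] nxt_pow_arc[OF Suc.prems(2)]]
  show ?case using Suc by simp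
qed simp

lemma prev_arc: "a \<in> arcs G \<Longrightarrow> \<exists>d\<in>arcs G. nxt d = a"
  using nxt_bij unfolding bij_betw_def by (metis imageE)

lemma \<sigma>_in_E: "a \<in> D \<Longrightarrow> \<sigma> a \<in> E"
  using \<sigma>_bij by (auto simp: bij_betw_def)

lemma \<sigma>_arc: "a \<in> D \<Longrightarrow> \<sigma> a \<in> arcs G"
  using \<sigma>_in_E E_arcs by auto

lemma \<sigma>_neq: "a \<in> D \<Longrightarrow> \<sigma> a \<noteq> a"
  using \<sigma>_in_E[of a] D_E by auto

lemma E_obtain: "b \<in> E \<Longrightarrow> \<exists>a\<in>D. b = \<sigma> a"
  using \<sigma>_bij by (auto simp: bij_betw_def)

section \<open>Chains of the successor permutation\<close>

definition chain :: "'e \<Rightarrow> nat \<Rightarrow> 'e list" where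
  "chain a n = map (\<lambda>i. (nxt ^^ i) a) [0..<n]"

definition is_chain :: "'e list \<Rightarrow> bool" where
  "is_chain = successively (\<lambda>a b. b = nxt a)"

lemma chain_0 [simp]: "chain a 0 = []"
  by (simp add: chain_def)

lemma length_chain [simp]: "length (chain a n) = n"
  by (simp add: chain_def)

lemma chain_Suc: "chain a (Suc n) = a # chain (nxt a) n"
  unfolding chain_def map_upt_Suc by (simp add: funpow_swap1)

lemma chain_add: "chain a (m + n) = chain a m @ chain ((nxt ^^ m) a) n"
  by (induction m arbitrary: a) (simp_all add: chain_Suc funpow_swap1)

lemma chain_Suc_end: "chain a (Suc n) = chain a n @ [(nxt ^^ n) a]"
  using chain_add[of a n 1] chain_Suc[of _ 0] by simp

lemma hd_chain: "0 < n \<Longrightarrow> hd (chain a n) = a"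
  by (cases n) (simp_all add: chain_Suc)

lemma is_chain_chain: "is_chain (chain a n)"
proof (induction n arbitrary: a)
  case (Suc n)
  then show ?case by (cases n) (simp_all add: chain_Suc is_chain_def)
qed (simp add: is_chain_def)

lemma is_chain_append: "is_chain (v @ w) \<Longrightarrow> is_chain v \<and> is_chain w"
  by (simp add: is_chain_def successively_append_iff)

lemma is_chain_eq_chain: "is_chain (a # w) \<Longrightarrow> a # w = chain a (Suc (length w))"
proof (induction w arbitrary: a)
  case Nil
  then show ?case by (simp add: chain_Suc)
next
  case (Cons b w)
  then have "b = nxt a" "is_chain (b # w)" by (auto simp: is_chain_def)
  then show ?case using Cons.IH[of b] by (simp add: chain_Suc)
qed

lemma not_chain_split: "\<not> is_chain w \<Longrightarrow> \<exists>v a b v'. w = v @ [a, b] @ v' \<and> b \<noteq> nxt a"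
proof (induction w rule: induct_list012)
  case (3 a b w)
  show ?case
  proof (cases "b = nxt a")
    case True
    then have "\<not> is_chain (b # w)" using "3.prems" by (simp add: is_chain_def)
    then obtain v c d v' where "b # w = v @ [c, d] @ v'" "d \<noteq> nxt c" using "3.IH" by blast
    then show ?thesis by (metis append_Cons)
  next
    case False
    then show ?thesis by (metis append_Cons append_Nil)
  qed
qed (simp_all add: is_chain_def)

lemma awlast_chain: "a \<in> arcs G \<Longrightarrow> awlast (tail G a) (chain a n) = tail G ((nxt ^^ n) a)"
proof (induction n arbitrary: a)
  case (Suc n)
  have "awlast (tail G a) (chain a (Suc n)) = awlast (head G a) (chain (nxt a) n)"
    by (simp add: chain_Suc)
  then show ?case using Suc.IH[of "nxt a"] Suc.prems by (simp add: tail_nxt nxt_arc funpow_swap1)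
qed simp

lemma is_path_chain: "a \<in> arcs G \<Longrightarrow> is_path (tail G a, chain a n)"
proof (induction n arbitrary: a)
  case (Suc n)
  then show ?case
    using Suc.IH[of "nxt a"] by (simp add: chain_Suc is_path_Cons_iff nxt_arc tail_nxt)
qed (simp add: is_path_Nil_iff)

lemma is_path_arrow: "a \<in> arcs G \<Longrightarrow> is_path (tail G a, [a])"
  by (simp add: is_path_Cons_iff is_path_Nil_iff)

section \<open>Short paths, paths of maximal length, and all others\<close>

definition short :: "'v \<times> 'e list \<Rightarrow> bool" where
  "short x \<longleftrightarrow> is_path x \<and> is_chain (snd x) \<and> length (snd x) < L"

definition top_path :: "'e \<Rightarrow> 'v \<times> 'e list" where
  "top_path a = (tail G a, chain a L)"

lemma short_chain: "a \<in> arcs G \<Longrightarrow> n < L \<Longrightarrow> short (tail G a, chain a n)"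
  by (simp add: short_def is_path_chain is_chain_chain)

lemma short_append:
  assumes "short (u, v @ w)"
  shows "short (u, v)" "short (awlast u v, w)"
  using assms is_chain_append[of v w] by (auto simp: short_def is_path_append_iff)

text \<open>A trivial path is the empty chain of any arrow leaving its vertex, and
  \<open>out_arc\<close> provides one. Thus coefficients at short paths can always be addressed
  through an arrow and a length.\<close>

lemma short_cases:
  assumes "short x"
  obtains a n where "a \<in> arcs G" "n < L" "x = (tail G a, chain a n)"
proof -
  obtain u w where x: "x = (u, w)" by (cases x)
  show thesis
  proof (cases w)
    case Nil
    then obtain a where "a \<in> arcs G" "tail G a = u"
      using assms out_arc[of u] by (auto simp: short_def x is_path_Nil_iff)
    then show thesis using that[of a 0] Nil x two_le_L by simp
  next
    case (Cons a v)
    then have "is_path (u, a # v)" "is_chain (a # v)" "length w < L" using assms x by (auto simp: short_def)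
    then show thesis
      using that[of a "length w"] is_chain_eq_chain[of a v] x Cons by (auto simp: is_path_Cons_iff)
  qed
qed

lemma finite_short: "finite {x. short x}"
proof -
  have "{x. short x} \<subseteq> (\<lambda>(a, n). (tail G a, chain a n)) ` (arcs G \<times> {..<L})"
    by (auto elim!: short_cases)
  then show ?thesis by (rule finite_subset) simp
qed

text \<open>A path that is not a chain has a turn somewhere, and a chain of length above L begins
  with one of length L + 1. The last two cases are the paths to be killed by zero relations; they
  are split into prefix, core and suffix to fit \<open>ideal_single\<close>, hence the empty prefix
  in \<open>long\<close>.\<close>

lemma path_cases:
  assumes "is_path x"
  obtains (short) "short x"
  | (top) a where "a \<in> arcs G" "x = top_path a"
  | (turn) u v a b v' where "x = (u, v @ [a, b] @ v')" "b \<noteq> nxt a"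
  | (long) a v where "a \<in> arcs G" "x = (tail G a, [] @ chain a (Suc L) @ v)"
proof -
  obtain u w where x: "x = (u, w)" by (cases x)
  show thesis
  proof (cases "is_chain w \<and> \<not> length w < L")
    case True
    then obtain a v where w: "w = a # v" using two_le_L by (cases w) auto
    then have wc: "w = chain a (length w)" using is_chain_eq_chain[of a v] True by simp
    have a: "a \<in> arcs G" "u = tail G a" using assms x w by (auto simp: is_path_Cons_iff)
    show thesis
    proof (cases "length w = L")
      case True
      then show thesis using top[of a] a wc x by (simp add: top_path_def)
    next
      case False
      then obtain m where "length w = Suc L + m"
        using \<open>is_chain w \<and> \<not> length w < L\<close> by (metis less_iff_Suc_add add_Suc linorder_neqE_nat)
      then have "w = chain a (Suc L) @ chain ((nxt ^^ Suc L) a) m" using wc chain_add by metis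
      then show thesis using long[of a] a x by simp
    qed
  next
    case False
    then show thesis using short turn not_chain_split[of w] assms x by (auto simp: short_def)
  qed
qed

lemma top_path_not_short: "\<not> short (top_path a)"
  by (simp add: short_def top_path_def)

lemma top_path_inj: "top_path a = top_path b \<longleftrightarrow> a = b"
  using hd_chain[of L] two_le_L by (auto simp: top_path_def) (metis hd_chain less_le_trans zero_less_numeral)

lemma is_path_top: "a \<in> arcs G \<Longrightarrow> is_path (top_path a)"
  by (simp add: top_path_def is_path_chain)

text \<open>
  The quotient by \<open>chain_ideal \<nu>\<close> has \<open>top_path (\<sigma> a) = \<nu> a \<cdot> top_path a\<close>, and \<open>\<nu> a = 0\<close> is allowed.
  The ideal is given by its equations rather than by generators, so that membership in
  it is checked coefficient by coefficient.
\<close>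

definition chain_ideal :: "('e \<Rightarrow> 'k::field) \<Rightarrow> ('v \<times> 'e list \<Rightarrow> 'k) set" where
  "chain_ideal \<nu> = {f \<in> carrier (path_algebra G). (\<forall>x. short x \<longrightarrow> f x = 0)
     \<and> (\<forall>a\<in>arcs G - D - E. f (top_path a) = 0)
     \<and> (\<forall>a\<in>D. f (top_path a) + \<nu> a * f (top_path (\<sigma> a)) = 0)}"

text \<open>It contains every \<open>chain_ideal\<close> and does not involve the coefficients
  \<nu>. It will turn out to be the preimage of the socle, which makes the quotient by the socle the
  same for all \<nu>.\<close>

definition long_ideal :: "('v \<times> 'e list \<Rightarrow> 'k::field) set" where
  "long_ideal = {f \<in> carrier (path_algebra G). \<forall>x. short x \<longrightarrow> f x = 0}"

text \<open>Preimage of the line through a single path of maximal length. Its image in the quotient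
  has dimension at most one, and these images are the building blocks of the socle.\<close>

definition top_ideal :: "'e \<Rightarrow> ('v \<times> 'e list \<Rightarrow> 'k::field) set" where
  "top_ideal a = {f \<in> long_ideal. \<forall>b\<in>arcs G. b \<noteq> a \<longrightarrow> f (top_path b) = 0}"

lemma chain_ideal_carrier: "chain_ideal \<nu> \<subseteq> carrier (path_algebra G)"
  by (auto simp: chain_ideal_def)

lemma long_ideal_carrier: "long_ideal \<subseteq> carrier (path_algebra G)"
  by (auto simp: long_ideal_def)

lemma chain_ideal_long: "chain_ideal \<nu> \<subseteq> long_ideal"
  by (auto simp: chain_ideal_def long_ideal_def)

lemma top_ideal_long: "top_ideal a \<subseteq> long_ideal"
  by (auto simp: top_ideal_def)

text \<open>Prefixes of short paths are short, so every term of the product has a vanishing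
  factor.\<close>

lemma mult_short_l:
  assumes "f \<in> long_ideal" "short x"
  shows "(f \<otimes>\<^bsub>path_algebra G\<^esub> g) x = 0"
proof -
  obtain u w where x: "x = (u, w)" by (cases x)
  have "f (u, take n w) = 0" for n
    using assms short_append(1)[of u "take n w" "drop n w"] by (simp add: x long_ideal_def)
  then show ?thesis by (simp add: x path_algebra_mult)
qed

lemma mult_short_r:
  assumes "f \<in> long_ideal" "short x"
  shows "(g \<otimes>\<^bsub>path_algebra G\<^esub> f) x = 0"
proof -
  obtain u w where x: "x = (u, w)" by (cases x)
  have "f (awlast u (take n w), drop n w) = 0" for n
    using assms short_append(2)[of u "take n w" "drop n w"] by (simp add: x long_ideal_def)
  then show ?thesis by (simp add: x path_algebra_mult)
qed

text \<open>All proper prefixes of a path of length L in a chain are short, so only the cut at the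
  very end survives. Multiplication therefore acts on such a coefficient through one coefficient of
  \<open>g\<close> at a trivial path, and that one depends only on the end vertex.\<close>

lemma mult_top_l:
  assumes f: "f \<in> long_ideal" and a: "a \<in> arcs G"
  shows "(f \<otimes>\<^bsub>path_algebra G\<^esub> g) (top_path a) = f (top_path a) * g (tail G ((nxt ^^ L) a), [])"
proof -
  let ?t = "\<lambda>n. f (tail G a, take n (chain a L)) * g (awlast (tail G a) (take n (chain a L)), drop n (chain a L))"
  have "?t n = 0" if "n < L" for n
  proof -
    have "chain a L = chain a n @ chain ((nxt ^^ n) a) (L - n)" using chain_add[of a n "L - n"] that by simp
    then have "take n (chain a L) = chain a n" by simp
    then have "f (tail G a, take n (chain a L)) = 0"
      using f short_chain[OF a that] by (simp add: long_ideal_def)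
    then show ?thesis by simp
  qed
  then have "(\<Sum>n\<le>length (chain a L). ?t n) = (\<Sum>n\<in>{L}. ?t n)"
    by (intro sum.mono_neutral_right) auto
  also have "\<dots> = f (top_path a) * g (tail G ((nxt ^^ L) a), [])"
    using awlast_chain[OF a, of L] by (simp add: top_path_def)
  finally show ?thesis by (simp only: top_path_def path_algebra_mult)
qed

lemma mult_top_r:
  assumes f: "f \<in> long_ideal" and a: "a \<in> arcs G"
  shows "(g \<otimes>\<^bsub>path_algebra G\<^esub> f) (top_path a) = g (tail G a, []) * f (top_path a)"
proof -
  let ?t = "\<lambda>n. g (tail G a, take n (chain a L)) * f (awlast (tail G a) (take n (chain a L)), drop n (chain a L))"
  have "?t n = 0" if "n \<le> L" "n \<noteq> 0" for n
  proof -
    have "chain a L = chain a n @ chain ((nxt ^^ n) a) (L - n)" using chain_add[of a n "L - n"] that by simp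
    then have "take n (chain a L) = chain a n" "drop n (chain a L) = chain ((nxt ^^ n) a) (L - n)" by simp_all
    then have "f (awlast (tail G a) (take n (chain a L)), drop n (chain a L)) = 0"
      using f short_chain[OF nxt_pow_arc[OF a, of n], of "L - n"] that awlast_chain[OF a, of n]
      by (simp add: long_ideal_def)
    then show ?thesis by simp
  qed
  then have "(\<Sum>n\<le>length (chain a L). ?t n) = (\<Sum>n\<in>{0}. ?t n)"
    by (intro sum.mono_neutral_right) auto
  also have "\<dots> = g (tail G a, []) * f (top_path a)"
    by (simp add: top_path_def)
  finally show ?thesis by (simp only: top_path_def path_algebra_mult)
qed

lemma long_ideal_zero: "(\<lambda>x. 0) \<in> long_ideal"
  by (simp add: long_ideal_def zero_closed)

lemma long_ideal_smult: "f \<in> long_ideal \<Longrightarrow> (\<lambda>x. c * f x) \<in> long_ideal"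
  by (simp add: long_ideal_def smult_closed)

lemma long_ideal_add: "f \<in> long_ideal \<Longrightarrow> g \<in> long_ideal \<Longrightarrow> (\<lambda>x. f x + g x) \<in> long_ideal"
  by (simp add: long_ideal_def add_closed)

lemma ideal_long_ideal: "ideal long_ideal (path_algebra G :: ('k::field, _) module)"
proof (rule path_algebra_idealI)
  fix f g :: "'v \<times> 'e list \<Rightarrow> 'k" assume f: "f \<in> long_ideal" and g: "g \<in> carrier (path_algebra G)"
  have fc: "f \<in> carrier (path_algebra G)" using f long_ideal_carrier by blast
  show "g \<otimes>\<^bsub>path_algebra G\<^esub> f \<in> long_ideal"
    unfolding long_ideal_def using mult_closed[OF g fc] mult_short_r[OF f] by blast
  show "f \<otimes>\<^bsub>path_algebra G\<^esub> g \<in> long_ideal"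
    unfolding long_ideal_def using mult_closed[OF fc g] mult_short_l[OF f] by blast
qed (auto simp: long_ideal_carrier long_ideal_zero long_ideal_add long_ideal_smult)

lemma chain_idealI:
  assumes "f \<in> long_ideal" "\<And>a. a \<in> arcs G \<Longrightarrow> a \<notin> D \<Longrightarrow> a \<notin> E \<Longrightarrow> f (top_path a) = 0"
    and "\<And>a. a \<in> D \<Longrightarrow> f (top_path a) = - (\<nu> a * f (top_path (\<sigma> a)))"
  shows "f \<in> chain_ideal \<nu>"
  using assms by (auto simp: chain_ideal_def long_ideal_def)

lemma chain_ideal_top:
  assumes "f \<in> chain_ideal \<nu>" "a \<in> arcs G" "a \<notin> D" "a \<notin> E"
  shows "f (top_path a) = 0"
  using assms by (auto simp: chain_ideal_def)

lemma chain_ideal_top_D: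
  assumes "f \<in> chain_ideal \<nu>" "a \<in> D"
  shows "f (top_path a) = - (\<nu> a * f (top_path (\<sigma> a)))"
  using assms by (auto simp: chain_ideal_def add_eq_0_iff2)

text \<open>The two paths \<open>top_path a\<close> and \<open>top_path (\<sigma> a)\<close> share
  start and end vertex. Multiplying on either side scales both coefficients by the same vertex
  coefficient, so the equation linking them persists.\<close>

lemma ideal_chain_ideal: "ideal (chain_ideal \<nu>) (path_algebra G :: ('k::field, _) module)"
proof (rule path_algebra_idealI)
  interpret M: ideal long_ideal "path_algebra G :: ('k, _) module" by (rule ideal_long_ideal)
  fix f g :: "'v \<times> 'e list \<Rightarrow> 'k" and c
  assume f: "f \<in> chain_ideal \<nu>"
  then have fl: "f \<in> long_ideal" using chain_ideal_long by auto
  have Da: "a \<in> arcs G" if "a \<in> D" for a using that D_arcs by blast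
  note fD = chain_ideal_top_D[OF f] and f0 = chain_ideal_top[OF f]
  show "(\<lambda>x. c * f x) \<in> chain_ideal \<nu>"
  proof (rule chain_idealI)
    show "(\<lambda>x. c * f x) \<in> long_ideal" by (rule long_ideal_smult[OF fl])
    show "c * f (top_path a) = - (\<nu> a * (c * f (top_path (\<sigma> a))))" if "a \<in> D" for a
      unfolding fD[OF that] by simp
    show "c * f (top_path a) = 0" if "a \<in> arcs G" "a \<notin> D" "a \<notin> E" for a
      unfolding f0[OF that] by simp
  qed
  show "(\<lambda>x. f x + g x) \<in> chain_ideal \<nu>" if g: "g \<in> chain_ideal \<nu>"
  proof (rule chain_idealI)
    show "(\<lambda>x. f x + g x) \<in> long_ideal"
      using g chain_ideal_long by (intro long_ideal_add fl) blast
    show "f (top_path a) + g (top_path a) = - (\<nu> a * (f (top_path (\<sigma> a)) + g (top_path (\<sigma> a))))"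
      if "a \<in> D" for a
      unfolding fD[OF that] chain_ideal_top_D[OF g that] by (simp add: distrib_left)
    show "f (top_path a) + g (top_path a) = 0" if "a \<in> arcs G" "a \<notin> D" "a \<notin> E" for a
      unfolding f0[OF that] chain_ideal_top[OF g that] by simp
  qed
  assume g: "g \<in> carrier (path_algebra G)"
  show "g \<otimes>\<^bsub>path_algebra G\<^esub> f \<in> chain_ideal \<nu>"
  proof (rule chain_idealI)
    show "(g \<otimes>\<^bsub>path_algebra G\<^esub> f) (top_path a)
      = - (\<nu> a * (g \<otimes>\<^bsub>path_algebra G\<^esub> f) (top_path (\<sigma> a)))" if "a \<in> D" for a
      unfolding mult_top_r[OF fl Da[OF that]] mult_top_r[OF fl \<sigma>_arc[OF that]] fD[OF that] tail_\<sigma>[OF that]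
      by simp
    show "(g \<otimes>\<^bsub>path_algebra G\<^esub> f) (top_path a) = 0" if "a \<in> arcs G" "a \<notin> D" "a \<notin> E" for a
      unfolding mult_top_r[OF fl that(1)] f0[OF that] by simp
  qed (rule M.I_l_closed[OF fl g])
  show "f \<otimes>\<^bsub>path_algebra G\<^esub> g \<in> chain_ideal \<nu>"
  proof (rule chain_idealI)
    show "(f \<otimes>\<^bsub>path_algebra G\<^esub> g) (top_path a)
      = - (\<nu> a * (f \<otimes>\<^bsub>path_algebra G\<^esub> g) (top_path (\<sigma> a)))" if "a \<in> D" for a
      unfolding mult_top_l[OF fl Da[OF that]] mult_top_l[OF fl \<sigma>_arc[OF that]] fD[OF that] end_\<sigma>[OF that]
      by simp
    show "(f \<otimes>\<^bsub>path_algebra G\<^esub> g) (top_path a) = 0" if "a \<in> arcs G" "a \<notin> D" "a \<notin> E" for a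
      unfolding mult_top_l[OF fl that(1)] f0[OF that] by simp
  qed (rule M.I_r_closed[OF fl g])
next
  show "chain_ideal \<nu> \<subseteq> carrier (path_algebra G)" by (rule chain_ideal_carrier)
  show "(\<lambda>x. 0) \<in> chain_ideal \<nu>" by (simp add: chain_ideal_def zero_closed)
qed

lemma ideal_top_ideal: "ideal (top_ideal a) (path_algebra G :: ('k::field, _) module)"
proof -
  interpret M: ideal long_ideal "path_algebra G :: ('k, _) module" by (rule ideal_long_ideal)
  show ?thesis
  proof (rule path_algebra_idealI)
    fix f g :: "'v \<times> 'e list \<Rightarrow> 'k" and c
    assume f: "f \<in> top_ideal a"
    then have fl: "f \<in> long_ideal" using top_ideal_long by auto
    show "(\<lambda>x. c * f x) \<in> top_ideal a"
      using f by (simp add: top_ideal_def long_ideal_smult)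
    show "(\<lambda>x. f x + g x) \<in> top_ideal a" if "g \<in> top_ideal a"
      using f that by (simp add: top_ideal_def long_ideal_add)
    assume g: "g \<in> carrier (path_algebra G)"
    show "g \<otimes>\<^bsub>path_algebra G\<^esub> f \<in> top_ideal a"
      using f M.I_l_closed[OF fl g] by (simp add: top_ideal_def mult_top_r[OF fl])
    show "f \<otimes>\<^bsub>path_algebra G\<^esub> g \<in> top_ideal a"
      using f M.I_r_closed[OF fl g] by (simp add: top_ideal_def mult_top_l[OF fl])
  next
    show "top_ideal a \<subseteq> carrier (path_algebra G)" using top_ideal_long long_ideal_carrier by blast
    show "(\<lambda>x. 0) \<in> top_ideal a" by (simp add: top_ideal_def long_ideal_zero)
  qed
qed

lemma chain_ideal_top_0I:
  assumes "f \<in> long_ideal" "\<And>a. a \<in> arcs G \<Longrightarrow> f (top_path a) = 0"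
  shows "f \<in> chain_ideal \<nu>"
  using D_arcs by (intro chain_idealI assms(1)) (auto simp: assms(2) \<sigma>_arc)

section \<open>Normal paths form a basis modulo the ideal\<close>

definition normal_paths :: "('v \<times> 'e list) set" where
  "normal_paths = {x. short x} \<union> top_path ` (arcs G - E)"

lemma finite_normal_paths: "finite normal_paths"
  by (simp add: normal_paths_def finite_short)

lemma normal_path_is_path: "x \<in> normal_paths \<Longrightarrow> is_path x"
  by (auto simp: normal_paths_def short_def is_path_top)

text \<open>Linear independence modulo the ideal. For \<open>a\<close> in \<open>D\<close> the
  equation couples \<open>top_path a\<close> only with \<open>top_path (\<sigma> a)\<close>, which
  is not normal; so the second term is zero and the first must vanish, whatever the value of
  \<nu>.\<close>

lemma chain_ideal_normal_eq_0:
  assumes f: "f \<in> chain_ideal \<nu>" and B: "\<And>x. f x \<noteq> 0 \<Longrightarrow> x \<in> normal_paths"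
  shows "f x = 0"
proof (rule ccontr)
  assume "f x \<noteq> 0"
  then have "x \<in> normal_paths" "\<not> short x" using B f unfolding chain_ideal_def by blast+
  then obtain a where a: "a \<in> arcs G" "a \<notin> E" "x = top_path a" by (auto simp: normal_paths_def)
  show False
  proof (cases "a \<in> D")
    case True
    have "top_path (\<sigma> a) \<notin> normal_paths"
      using \<sigma>_in_E[OF True] by (auto simp: normal_paths_def top_path_not_short top_path_inj)
    then have "f (top_path (\<sigma> a)) = 0" using B by blast
    then show False using f \<open>f x \<noteq> 0\<close> a True by (auto simp: chain_ideal_def)
  next
    case False
    then show False using f \<open>f x \<noteq> 0\<close> a by (auto simp: chain_ideal_def)
  qed
qed

text \<open>What an ideal must contain so that every path can be reduced to normal ones: the turns,
  the chains of length L + 1, and the rule replacing \<open>top_path (\<sigma> a)\<close>. It bounds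
  the ideal from below only.\<close>

definition rewriting_ideal :: "('e \<Rightarrow> 'k::field) \<Rightarrow> ('v \<times> 'e list \<Rightarrow> 'k) set \<Rightarrow> bool" where
  "rewriting_ideal \<nu> I \<longleftrightarrow> ideal I (path_algebra G)
     \<and> (\<forall>a\<in>arcs G. \<forall>b\<in>arcs G. tail G b = head G a \<longrightarrow> b \<noteq> nxt a \<longrightarrow> single (tail G a, [a, b]) 1 \<in> I)
     \<and> (\<forall>a\<in>arcs G. single (tail G a, chain a (Suc L)) 1 \<in> I)
     \<and> (\<forall>a\<in>D. (\<lambda>x. single (top_path (\<sigma> a)) 1 x - \<nu> a * single (top_path a) 1 x) \<in> I)"

lemma single_turn_or_long:
  assumes I: "rewriting_ideal \<nu> I" and x: "is_path x" "\<not> short x" "\<And>a. a \<in> arcs G \<Longrightarrow> x \<noteq> top_path a"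
  shows "single x c \<in> I"
  using x(1)
proof (cases rule: path_cases)
  case (turn u v a b v')
  have ab: "a \<in> arcs G" "b \<in> arcs G" "tail G b = head G a"
    using x(1) by (auto simp: turn is_path_append_iff is_path_Cons_iff)
  show ?thesis
    using I ab turn(2) x(1) unfolding turn(1)
    by (intro ideal_single) (auto simp: rewriting_ideal_def)
next
  case (long a v)
  show ?thesis
    using I long(1) x(1) unfolding long(2)
    by (intro ideal_single) (auto simp: rewriting_ideal_def chain_Suc simp del: append_Nil)
qed (use x in auto)

text \<open>Spanning. By additivity one path suffices: a normal path stays, a path of maximal length
  starting in \<open>E\<close> is rewritten to its partner starting in \<open>D\<close>, and every
  other path is in \<open>I\<close>. One rewriting step is enough because \<open>D\<close> and
  \<open>E\<close> are disjoint.\<close>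

lemma reduce_mod:
  assumes I: "rewriting_ideal \<nu> I" and f: "f \<in> carrier (path_algebra G)"
  shows "\<exists>g\<in>carrier (path_algebra G). (\<forall>x. g x \<noteq> 0 \<longrightarrow> x \<in> normal_paths) \<and> (\<lambda>x. f x - g x) \<in> I"
proof -
  interpret I: ideal I "path_algebra G" using I by (simp add: rewriting_ideal_def)
  interpret K: K_algebra "path_algebra G :: ('a, _) module" by (rule path_algebra_K_algebra)
  have I0: "(\<lambda>x. 0) \<in> I" using additive_subgroup.zero_closed[OF I.additive_subgroup_axioms] by (simp add: path_algebra_zero)
  let ?S = "{f. \<exists>g\<in>carrier (path_algebra G). (\<forall>x. g x \<noteq> 0 \<longrightarrow> x \<in> normal_paths) \<and> (\<lambda>x. f x - g x) \<in> I}"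
  have "f \<in> ?S" using f
  proof (induction rule: path_algebra_induct)
    case zero
    show ?case using I0 zero_closed by (intro CollectI bexI[of _ "\<lambda>x. 0"]) simp_all
  next
    case (add g h)
    then obtain g' h' where
      g: "g' \<in> carrier (path_algebra G)" "\<forall>x. g' x \<noteq> 0 \<longrightarrow> x \<in> normal_paths" "(\<lambda>x. g x - g' x) \<in> I" and
      h: "h' \<in> carrier (path_algebra G)" "\<forall>x. h' x \<noteq> 0 \<longrightarrow> x \<in> normal_paths" "(\<lambda>x. h x - h' x) \<in> I"
      by auto
    have "(\<lambda>x. (g x - g' x) + (h x - h' x)) \<in> I"
      using additive_subgroup.a_closed[OF I.additive_subgroup_axioms g(3) h(3)] by (simp add: path_algebra_add)
    moreover have "(g x - g' x) + (h x - h' x) = (g x + h x) - (g' x + h' x)" for x by simp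
    ultimately have "(\<lambda>x. (g x + h x) - (g' x + h' x)) \<in> I" by simp
    moreover have "\<forall>x. g' x + h' x \<noteq> 0 \<longrightarrow> x \<in> normal_paths"
      using g(2) h(2) by (metis add.right_neutral)
    ultimately show ?case
      using add_closed[OF g(1) h(1)] by (intro CollectI bexI[of _ "\<lambda>x. g' x + h' x"] conjI)
  next
    case (single x)
    let ?c = "f x"
    have path: "is_path x" using path_algebra_is_path[OF f single] .
    show ?case
    proof (cases "x \<in> normal_paths")
      case True
      then show ?thesis
        using path_algebra_single[OF path, of ?c] I0
        by (intro CollectI bexI[of _ "single x ?c"]) (auto simp: single_apply)
    next
      case nn: False
      show ?thesis
      proof (cases "\<exists>b\<in>arcs G. x = top_path b")
        case True
        then obtain b where "x = top_path b" "b \<in> E" using nn by (auto simp: normal_paths_def)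
        then obtain a where a: "a \<in> D" "x = top_path (\<sigma> a)" using E_obtain by blast
        then have aa: "a \<in> arcs G" "a \<notin> E" using D_arcs D_E by auto
        have "(\<lambda>x. single (top_path (\<sigma> a)) 1 x - \<nu> a * single (top_path a) 1 x) \<in> I"
          using I a by (auto simp: rewriting_ideal_def)
        from K.ideal_smult_closed[OF I.ideal_axioms this, of ?c]
        have "(\<lambda>y. ?c * (single (top_path (\<sigma> a)) 1 y - \<nu> a * single (top_path a) 1 y)) \<in> I"
          by (simp add: path_algebra_smult)
        moreover have "(\<lambda>y. ?c * (single (top_path (\<sigma> a)) 1 y - \<nu> a * single (top_path a) 1 y))
          = (\<lambda>y. single x ?c y - single (top_path a) (?c * \<nu> a) y)"
          using a by (auto simp: single_apply fun_eq_iff top_path_inj algebra_simps)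
        ultimately have "(\<lambda>y. single x ?c y - single (top_path a) (?c * \<nu> a) y) \<in> I" by simp
        moreover have "\<forall>y. single (top_path a) (?c * \<nu> a) y \<noteq> 0 \<longrightarrow> y \<in> normal_paths"
          using aa by (auto simp: single_apply normal_paths_def)
        ultimately show ?thesis using path_algebra_single[OF is_path_top[OF aa(1)]] by blast
      next
        case False
        have "\<not> short x" using nn by (auto simp: normal_paths_def)
        then have "single x ?c \<in> I" using single_turn_or_long[OF I path] False by blast
        then show ?thesis using zero_closed by (intro CollectI bexI[of _ "\<lambda>x. 0"]) auto
      qed
    qed
  qed
  then show ?thesis by simp
qed

text \<open>A squeeze. Reduce an element f of the larger ideal modulo \<open>I\<close> to a
  combination g of normal paths; f - g lies in \<open>I\<close>, hence in
  \<open>chain_ideal\<close>, and so does g. By independence g = 0, so f is in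
  \<open>I\<close>.\<close>

lemma rewriting_ideal_eq:
  assumes I: "rewriting_ideal \<nu> I" and sub: "I \<subseteq> chain_ideal \<nu>"
  shows "I = chain_ideal \<nu>"
proof
  interpret I: ideal I "path_algebra G" using I by (simp add: rewriting_ideal_def)
  interpret J: ideal "chain_ideal \<nu>" "path_algebra G" by (rule ideal_chain_ideal)
  show "chain_ideal \<nu> \<subseteq> I"
  proof
    fix f assume f: "f \<in> chain_ideal \<nu>"
    then have fc: "f \<in> carrier (path_algebra G)" using chain_ideal_carrier by auto
    obtain g where g: "g \<in> carrier (path_algebra G)" "\<forall>x. g x \<noteq> 0 \<longrightarrow> x \<in> normal_paths"
      "(\<lambda>x. f x - g x) \<in> I"
      using reduce_mod[OF I fc] by blast
    have d: "(\<lambda>x. f x - g x) \<in> carrier (path_algebra G)" using I.a_Hcarr[OF g(3)] .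
    have "f \<ominus>\<^bsub>path_algebra G\<^esub> (\<lambda>x. f x - g x) \<in> chain_ideal \<nu>"
      unfolding a_minus_def
      using g(3) sub
      by (intro additive_subgroup.a_closed[OF J.additive_subgroup_axioms f]
          additive_subgroup.a_inv_closed[OF J.additive_subgroup_axioms]) blast
    then have "g \<in> chain_ideal \<nu>" by (simp add: path_algebra_minus[OF fc d])
    then have "g x = 0" for x using chain_ideal_normal_eq_0 g(2) by blast
    then show "f \<in> I" using g(3) by simp
  qed
qed (rule sub)

text \<open>Makes the reduction available for \<open>chain_ideal\<close> itself, so that membership
  of turns and overlong paths need not be recomputed from coefficients.\<close>

lemma rewriting_chain_ideal: "rewriting_ideal \<nu> (chain_ideal \<nu>)"
proof -
  have "single (tail G a, [a, b]) 1 \<in> chain_ideal \<nu>"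
    if "a \<in> arcs G" "b \<in> arcs G" "tail G b = head G a" "b \<noteq> nxt a" for a b
  proof (rule chain_ideal_top_0I)
    have nc: "\<not> is_chain [a, b]" using that(4) by (simp add: is_chain_def)
    have "is_path (tail G a, [a, b])" using that by (simp add: is_path_Cons_iff is_path_Nil_iff)
    then show "single (tail G a, [a, b]) 1 \<in> long_ideal"
      using nc path_algebra_single by (auto simp: long_ideal_def single_apply short_def)
    show "single (tail G a, [a, b]) 1 (top_path c) = 0" for c
      using nc is_chain_chain[of c L] by (auto simp: single_apply top_path_def)
  qed
  moreover have "single (tail G a, chain a (Suc L)) 1 \<in> chain_ideal \<nu>" if "a \<in> arcs G" for a
  proof (rule chain_ideal_top_0I)
    show "single (tail G a, chain a (Suc L)) 1 \<in> long_ideal"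
      using path_algebra_single[OF is_path_chain[OF that]] by (auto simp: long_ideal_def single_apply short_def)
    show "single (tail G a, chain a (Suc L)) 1 (top_path c) = 0" for c
    proof -
      have "length (snd (top_path c)) \<noteq> length (chain a (Suc L))" by (simp add: top_path_def)
      then have "top_path c \<noteq> (tail G a, chain a (Suc L))" by (metis snd_conv)
      then show ?thesis by (simp add: single_apply)
    qed
  qed
  moreover have "(\<lambda>x. single (top_path (\<sigma> a)) 1 x - \<nu> a * single (top_path a) 1 x) \<in> chain_ideal \<nu>"
    if a: "a \<in> D" for a
  proof -
    let ?f = "\<lambda>x. single (top_path (\<sigma> a)) 1 x - \<nu> a * single (top_path a) 1 x"
    have aa: "a \<in> arcs G" "a \<notin> E" "\<sigma> a \<in> E" using a D_arcs D_E \<sigma>_in_E by auto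
    have "?f \<in> carrier (path_algebra G)"
      using add_closed[OF path_algebra_single[OF is_path_top[OF \<sigma>_arc[OF a]], of 1]
          path_algebra_single[OF is_path_top[OF aa(1)], of "- \<nu> a"]]
      by (rule back_subst[where P = "\<lambda>f. f \<in> _"]) (auto simp: single_apply)
    moreover have "?f x = 0" if "short x" for x
      using that top_path_not_short by (auto simp: single_apply)
    moreover have "?f (top_path b) = 0" if "b \<in> arcs G - D - E" for b
      using that aa a by (auto simp: single_apply top_path_inj)
    moreover have "?f (top_path b) + \<nu> b * ?f (top_path (\<sigma> b)) = 0" if b: "b \<in> D" for b
    proof -
      have "b \<noteq> \<sigma> a" "\<sigma> b \<noteq> a" using a b D_E \<sigma>_in_E by auto
      moreover have "\<sigma> b = \<sigma> a \<longleftrightarrow> b = a"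
        using inj_on_eq_iff[OF bij_betw_imp_inj_on[OF \<sigma>_bij] b a] .
      ultimately show ?thesis using \<sigma>_neq[OF a] by (auto simp: single_apply top_path_inj)
    qed
    ultimately show ?thesis by (simp add: chain_ideal_def)
  qed
  ultimately show ?thesis using ideal_chain_ideal by (simp add: rewriting_ideal_def)
qed

lemma not_in_chain_idealI:
  assumes "f (top_path a) \<noteq> 0" "a \<in> arcs G" "a \<notin> E" and "\<And>b. b \<in> E \<Longrightarrow> f (top_path b) = 0"
  shows "f \<notin> chain_ideal \<nu>"
proof
  assume f: "f \<in> chain_ideal \<nu>"
  then have "f (top_path a) = 0"
  proof (cases "a \<in> D")
    case True
    then have "f (top_path (\<sigma> a)) = 0" using assms(4) \<sigma>_in_E by blast
    then show ?thesis using f True by (auto simp: chain_ideal_def)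
  qed (use f assms in \<open>auto simp: chain_ideal_def\<close>)
  then show False using assms(1) by simp
qed

section \<open>Annihilators of the arrows and socles\<close>

definition arrow :: "'e \<Rightarrow> 'v \<times> 'e list \<Rightarrow> 'k::field" where
  "arrow a = single (tail G a, [a]) 1"

lemma arrow_carrier: "a \<in> arcs G \<Longrightarrow> arrow a \<in> carrier (path_algebra G)"
  unfolding arrow_def by (rule path_algebra_single[OF is_path_arrow])

lemma mult_arrow:
  assumes "a \<in> arcs G"
  shows "(f \<otimes>\<^bsub>path_algebra G\<^esub> arrow ((nxt ^^ n) a)) (tail G a, chain a (Suc n)) = f (tail G a, chain a n)"
  using mult_single_append[of "tail G a" "chain a n" "(tail G ((nxt ^^ n) a), [(nxt ^^ n) a])" f 1]
    awlast_chain[OF assms, of n]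
  by (simp add: arrow_def chain_Suc_end)

lemma mult_arrow_eq_0:
  assumes "(nxt ^^ n) b \<noteq> c"
  shows "(f \<otimes>\<^bsub>path_algebra G\<^esub> arrow c) (u, chain b (Suc n)) = 0"
  unfolding arrow_def by (rule mult_single_eq_0) (use assms in \<open>simp add: chain_Suc_end\<close>)

lemma arrow_mult:
  assumes "d \<in> arcs G"
  shows "(arrow d \<otimes>\<^bsub>path_algebra G\<^esub> f) (tail G d, chain d (Suc n)) = f (tail G (nxt d), chain (nxt d) n)"
  using single_mult_append[of "(tail G d, [d])" 1 f "chain (nxt d) n"] tail_nxt[OF assms]
  by (simp add: arrow_def chain_Suc path_end_def)

lemma arrow_mult_eq_0:
  assumes "b \<noteq> d"
  shows "(arrow d \<otimes>\<^bsub>path_algebra G\<^esub> f) (u, chain b (Suc n)) = 0"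
  unfolding arrow_def by (rule single_mult_eq_0) (use assms in \<open>simp add: chain_Suc\<close>)

text \<open>Appending the next arrow turns \<open>chain a n\<close> into
  \<open>chain a (Suc n)\<close>, and injectivity of the powers of \<open>nxt\<close> keeps the
  chains of that length from other arrows out of the product. Below length L the coefficient must
  vanish at once. At length L it is isolated by the defining equation, except that for a = \<sigma>
  d it appears with the factor \<open>\<nu> d\<close>, which then has to be invertible.\<close>

lemma right_annihilator:
  assumes f: "\<And>b. b \<in> arcs G \<Longrightarrow> f \<otimes>\<^bsub>path_algebra G\<^esub> arrow b \<in> chain_ideal \<nu>"
    and a: "a \<in> arcs G" and n: "n < L"
    and \<nu>: "\<And>d. d \<in> D \<Longrightarrow> a = \<sigma> d \<Longrightarrow> \<nu> d \<noteq> 0"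
  shows "f (tail G a, chain a n) = 0"
proof -
  let ?b = "(nxt ^^ n) a"
  define g where "g = f \<otimes>\<^bsub>path_algebra G\<^esub> arrow ?b"
  have g: "g \<in> chain_ideal \<nu>" unfolding g_def by (rule f[OF nxt_pow_arc[OF a]])
  have ga: "g (tail G a, chain a (Suc n)) = f (tail G a, chain a n)"
    unfolding g_def by (rule mult_arrow[OF a])
  have g0: "g (tail G c, chain c (Suc n)) = 0" if "c \<in> arcs G" "c \<noteq> a" for c
    unfolding g_def using nxt_pow_inj[OF that(1) a, of n] that(2) by (intro mult_arrow_eq_0) simp
  show ?thesis
  proof (cases "Suc n < L")
    case True
    then show ?thesis using g ga short_chain[OF a True] by (simp add: chain_ideal_def)
  next
    case False
    then have L: "Suc n = L" using n by simp
    have top: "g (top_path a) = f (tail G a, chain a n)" using ga unfolding L top_path_def .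
    have top0: "g (top_path c) = 0" if "c \<in> arcs G" "c \<noteq> a" for c
      using g0[OF that] unfolding L top_path_def .
    consider "a \<in> D" | "a \<in> E" | "a \<notin> D" "a \<notin> E" by blast
    then have "g (top_path a) = 0"
    proof cases
      case 1
      then show ?thesis
        using chain_ideal_top_D[OF g 1] top0[OF \<sigma>_arc[OF 1] \<sigma>_neq[OF 1]] by simp
    next
      case 2
      then obtain d where d: "d \<in> D" "a = \<sigma> d" using E_obtain by blast
      then have "d \<in> arcs G" "d \<noteq> a" using D_arcs \<sigma>_neq[OF d(1)] by auto
      then show ?thesis using chain_ideal_top_D[OF g d(1)] top0[of d] \<nu>[OF d] d(2) by simp
    next
      case 3
      then show ?thesis using chain_ideal_top[OF g a] by simp
    qed
    then show ?thesis using top by simp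
  qed
qed

text \<open>Mirror image: prepending \<open>d\<close> extends the chain that begins with
  \<open>nxt d\<close>. The critical coefficient now belongs to the prepended arrow
  \<open>d\<close>, not to the first arrow of the chain being tested.\<close>

lemma left_annihilator:
  assumes f: "arrow d \<otimes>\<^bsub>path_algebra G\<^esub> f \<in> chain_ideal \<nu>"
    and d: "d \<in> arcs G" and n: "n < L"
    and \<nu>: "\<And>c. c \<in> D \<Longrightarrow> d = \<sigma> c \<Longrightarrow> \<nu> c \<noteq> 0"
  shows "f (tail G (nxt d), chain (nxt d) n) = 0"
proof -
  define g where "g = arrow d \<otimes>\<^bsub>path_algebra G\<^esub> f"
  have g: "g \<in> chain_ideal \<nu>" unfolding g_def by (rule f)
  have ga: "g (tail G d, chain d (Suc n)) = f (tail G (nxt d), chain (nxt d) n)"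
    unfolding g_def by (rule arrow_mult[OF d])
  have g0: "g (tail G c, chain c (Suc n)) = 0" if "c \<noteq> d" for c
    unfolding g_def by (rule arrow_mult_eq_0[OF that])
  show ?thesis
  proof (cases "Suc n < L")
    case True
    then show ?thesis using g ga short_chain[OF d True] by (simp add: chain_ideal_def)
  next
    case False
    then have L: "Suc n = L" using n by simp
    have top: "g (top_path d) = f (tail G (nxt d), chain (nxt d) n)" using ga unfolding L top_path_def .
    have top0: "g (top_path c) = 0" if "c \<noteq> d" for c
      using g0[OF that] unfolding L top_path_def .
    consider "d \<in> D" | "d \<in> E" | "d \<notin> D" "d \<notin> E" by blast
    then have "g (top_path d) = 0"
    proof cases
      case 1
      then show ?thesis using chain_ideal_top_D[OF g 1] top0[OF \<sigma>_neq[OF 1]] by simp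
    next
      case 2
      then obtain c where c: "c \<in> D" "d = \<sigma> c" using E_obtain by blast
      then have "c \<noteq> d" using \<sigma>_neq[OF c(1)] by auto
      then show ?thesis using chain_ideal_top_D[OF g c(1)] top0[of c] \<nu>[OF c] c(2) by simp
    next
      case 3
      then show ?thesis using chain_ideal_top[OF g d] by simp
    qed
    then show ?thesis using top by simp
  qed
qed

lemma long_idealI:
  assumes "f \<in> carrier (path_algebra G)" "\<And>a n. a \<in> arcs G \<Longrightarrow> n < L \<Longrightarrow> f (tail G a, chain a n) = 0"
  shows "f \<in> long_ideal"
proof -
  have "f x = 0" if "short x" for x using that assms(2) by (cases rule: short_cases) simp
  then show ?thesis using assms(1) unfolding long_ideal_def by blast
qed

lemma right_annihilator_long:
  assumes "f \<in> carrier (path_algebra G)" "\<And>d. d \<in> D \<Longrightarrow> \<nu> d \<noteq> 0"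
    and "\<And>b. b \<in> arcs G \<Longrightarrow> f \<otimes>\<^bsub>path_algebra G\<^esub> arrow b \<in> chain_ideal \<nu>"
  shows "f \<in> long_ideal"
  using assms(2) by (intro long_idealI assms(1) right_annihilator[OF assms(3)])

lemma left_annihilator_long:
  assumes "f \<in> carrier (path_algebra G)" "\<And>d. d \<in> D \<Longrightarrow> \<nu> d \<noteq> 0"
    and "\<And>b. b \<in> arcs G \<Longrightarrow> arrow b \<otimes>\<^bsub>path_algebra G\<^esub> f \<in> chain_ideal \<nu>"
  shows "f \<in> long_ideal"
proof (rule long_idealI[OF assms(1)])
  fix a n assume "a \<in> arcs G" and n: "n < L"
  then obtain d where d: "d \<in> arcs G" "a = nxt d" using prev_arc by blast
  show "f (tail G a, chain a n) = 0"
    unfolding d(2) by (rule left_annihilator[OF assms(3)[OF d(1)] d(1) n assms(2)])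
qed

text \<open>
  For arbitrary \<open>\<nu>\<close> a chain of length \<open>L - 1\<close> starting in \<open>E\<close> may be killed by all arrows on the right;
  extending it to the left instead starts outside \<open>E\<close>, because no two consecutive arrows of a
  chain lie in \<open>E\<close>.
\<close>

lemma two_sided_annihilator_long:
  assumes "f \<in> carrier (path_algebra G)"
    and r: "\<And>b. b \<in> arcs G \<Longrightarrow> f \<otimes>\<^bsub>path_algebra G\<^esub> arrow b \<in> chain_ideal \<nu>"
    and l: "\<And>b. b \<in> arcs G \<Longrightarrow> arrow b \<otimes>\<^bsub>path_algebra G\<^esub> f \<in> chain_ideal \<nu>"
  shows "f \<in> long_ideal"
proof (rule long_idealI[OF assms(1)])
  fix a n assume a: "a \<in> arcs G" and n: "n < L"
  show "f (tail G a, chain a n) = 0"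
  proof (cases "a \<in> E")
    case True
    obtain d where d: "d \<in> arcs G" "a = nxt d" using a prev_arc by blast
    then have "d \<notin> E" using nxt_E True by blast
    then show ?thesis
      unfolding d(2) using \<sigma>_in_E by (intro left_annihilator[OF l[OF d(1)] d(1) n]) blast
  next
    case False
    then show ?thesis using \<sigma>_in_E by (intro right_annihilator[OF r a n]) blast+
  qed
qed

section \<open>Filtration by length and descent to the longest paths\<close>

definition filt :: "nat \<Rightarrow> ('v \<times> 'e list \<Rightarrow> 'k::field) set" where
  "filt n = {f \<in> carrier (path_algebra G). \<forall>x. short x \<longrightarrow> length (snd x) < n \<longrightarrow> f x = 0}"

lemma filt_0: "filt 0 = carrier (path_algebra G)"
  by (simp add: filt_def)

lemma filt_L: "filt L = long_ideal"
  by (auto simp: filt_def long_ideal_def short_def)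

lemma filt_mult_arrow:
  assumes f: "f \<in> filt n" and b: "b \<in> arcs G"
  shows "f \<otimes>\<^bsub>path_algebra G\<^esub> arrow b \<in> filt (Suc n)"
proof -
  have fc: "f \<in> carrier (path_algebra G)" using f by (simp add: filt_def)
  have "(f \<otimes>\<^bsub>path_algebra G\<^esub> arrow b) x = 0" if x: "short x" "length (snd x) < Suc n" for x
  proof -
    obtain u w where uw: "x = (u, w)" by (cases x)
    show ?thesis
    proof (cases "\<exists>v. w = v @ [b] \<and> awlast u v = tail G b")
      case True
      then obtain v where v: "w = v @ [b]" "awlast u v = tail G b" by blast
      have "f (u, v) = 0"
        using f x short_append(1)[of u v "[b]"] by (simp add: uw v filt_def)
      then show ?thesis
        using mult_single_append[of u v "(tail G b, [b])" f 1] v uw by (simp add: arrow_def)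
    next
      case False
      then show ?thesis unfolding uw arrow_def by (intro mult_single_eq_0) auto
    qed
  qed
  then show ?thesis using mult_closed[OF fc arrow_carrier[OF b]] unfolding filt_def by blast
qed

lemma filt_arrow_mult:
  assumes f: "f \<in> filt n" and b: "b \<in> arcs G"
  shows "arrow b \<otimes>\<^bsub>path_algebra G\<^esub> f \<in> filt (Suc n)"
proof -
  have fc: "f \<in> carrier (path_algebra G)" using f by (simp add: filt_def)
  have "(arrow b \<otimes>\<^bsub>path_algebra G\<^esub> f) x = 0" if x: "short x" "length (snd x) < Suc n" for x
  proof -
    obtain u w where uw: "x = (u, w)" by (cases x)
    show ?thesis
    proof (cases "\<exists>v. (u, w) = (tail G b, [b] @ v)")
      case True
      then obtain v where v: "u = tail G b" "w = [b] @ v" by blast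
      have "f (head G b, v) = 0"
        using f x short_append(2)[of u "[b]" v] by (simp add: uw v filt_def)
      then show ?thesis
        using single_mult_append[of "(tail G b, [b])" 1 f v] v uw by (simp add: arrow_def path_end_def)
    next
      case False
      then show ?thesis unfolding uw arrow_def by (intro single_mult_eq_0) auto
    qed
  qed
  then show ?thesis using mult_closed[OF arrow_carrier[OF b] fc] unfolding filt_def by blast
qed

text \<open>Each application of \<open>push\<close> raises the filtration degree by one and stays
  nonzero modulo the ideal. Since degree L is \<open>long_ideal\<close>, at most L applications are
  needed. This replaces the usual argument with powers of the radical.\<close>

lemma descend_to_long:
  assumes push: "\<And>f. f \<in> T \<Longrightarrow> f \<notin> long_ideal \<Longrightarrow>
      \<exists>g\<in>T. g \<notin> chain_ideal \<nu> \<and> (\<forall>n. f \<in> filt n \<longrightarrow> g \<in> filt (Suc n))"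
    and f: "f \<in> T" "f \<in> carrier (path_algebra G)" "f \<notin> chain_ideal \<nu>"
  shows "\<exists>g\<in>T. g \<in> long_ideal \<and> g \<notin> chain_ideal \<nu>"
proof -
  \<comment> \<open>\<open>m\<close> counts the degrees still to climb: m = L is the whole path
    algebra, m = 0 is \<open>long_ideal\<close>.\<close>
  have "\<exists>g\<in>T. g \<in> long_ideal \<and> g \<notin> chain_ideal \<nu>"
    if "f \<in> T" "f \<in> filt (L - m)" "m \<le> L" "f \<notin> chain_ideal \<nu>" for f m
    using that
  proof (induction m arbitrary: f)
    case 0
    then show ?case using filt_L by auto
  next
    case (Suc m)
    show ?case
    proof (cases "f \<in> long_ideal")
      case False
      then obtain g where g: "g \<in> T" "g \<notin> chain_ideal \<nu>" "f \<in> filt (L - Suc m) \<Longrightarrow> g \<in> filt (Suc (L - Suc m))"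
        using push[OF Suc.prems(1)] by blast
      have "Suc (L - Suc m) = L - m" using Suc.prems(3) by simp
      then show ?thesis using Suc.IH[OF g(1) _ _ g(2)] g(3) Suc.prems by simp
    qed (use Suc.prems in blast)
  qed
  from this[OF f(1) _ order_refl f(3)] show ?thesis using f(2) by (simp add: filt_0)
qed

section \<open>The quotient algebra and its projection\<close>

abbreviation chain_algebra :: "('e \<Rightarrow> 'k::field) \<Rightarrow> ('k, ('v \<times> 'e list \<Rightarrow> 'k) set) module" where
  "chain_algebra \<nu> \<equiv> quot_algebra (path_algebra G) (chain_ideal \<nu>)"

definition proj :: "('e \<Rightarrow> 'k::field) \<Rightarrow> ('v \<times> 'e list \<Rightarrow> 'k) \<Rightarrow> ('v \<times> 'e list \<Rightarrow> 'k) set" where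
  "proj \<nu> f = chain_ideal \<nu> +>\<^bsub>path_algebra G\<^esub> f"

lemma chain_algebra_K_algebra: "K_algebra (chain_algebra \<nu>)"
  by (rule K_algebra.quot_K_algebra[OF path_algebra_K_algebra ideal_chain_ideal])

lemma proj_hom: "proj \<nu> \<in> algebra_hom (path_algebra G) (chain_algebra \<nu>)"
  using K_algebra.quot_hom[OF path_algebra_K_algebra ideal_chain_ideal]
  by (simp add: proj_def[abs_def])

lemma proj_carrier: "carrier (chain_algebra \<nu>) = proj \<nu> ` carrier (path_algebra G)"
  by (simp add: K_algebra.quot_carrier[OF path_algebra_K_algebra] proj_def[abs_def])

lemma proj_ring_hom_ring: "ring_hom_ring (path_algebra G) (chain_algebra \<nu>) (proj \<nu>)"
proof (rule ring_hom_ringI2)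
  show "ring (chain_algebra \<nu>)" using chain_algebra_K_algebra by (rule K_algebra.axioms)
  show "proj \<nu> \<in> ring_hom (path_algebra G) (chain_algebra \<nu>)"
    using proj_hom[of \<nu>] unfolding algebra_hom_def by blast
qed (rule path_algebra_ring)

lemma proj_smult: "f \<in> carrier (path_algebra G) \<Longrightarrow>
    proj \<nu> (\<lambda>x. c * f x) = c \<odot>\<^bsub>chain_algebra \<nu>\<^esub> proj \<nu> f"
  using proj_hom[of \<nu>] unfolding algebra_hom_def by (simp add: path_algebra_smult)

lemma proj_mult: "f \<in> carrier (path_algebra G) \<Longrightarrow> g \<in> carrier (path_algebra G) \<Longrightarrow>
    proj \<nu> (f \<otimes>\<^bsub>path_algebra G\<^esub> g) = proj \<nu> f \<otimes>\<^bsub>chain_algebra \<nu>\<^esub> proj \<nu> g"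
  using proj_hom[of \<nu>] unfolding algebra_hom_def by (simp add: ring_hom_mult)

lemma proj_add: "f \<in> carrier (path_algebra G) \<Longrightarrow> g \<in> carrier (path_algebra G) \<Longrightarrow>
    proj \<nu> (\<lambda>x. f x + g x) = proj \<nu> f \<oplus>\<^bsub>chain_algebra \<nu>\<^esub> proj \<nu> g"
  using proj_hom[of \<nu>] ring_hom_add[of "proj \<nu>" "path_algebra G" "chain_algebra \<nu>" f g]
  unfolding algebra_hom_def by (simp add: path_algebra_add)

lemma proj_eq_0_iff: "f \<in> carrier (path_algebra G) \<Longrightarrow>
    proj \<nu> f = \<zero>\<^bsub>chain_algebra \<nu>\<^esub> \<longleftrightarrow> f \<in> chain_ideal \<nu>"
  unfolding proj_def by (rule K_algebra.quot_eq_zero_iff[OF path_algebra_K_algebra ideal_chain_ideal])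

lemma proj_eq_iff:
  assumes "f \<in> carrier (path_algebra G)" "g \<in> carrier (path_algebra G)"
  shows "proj \<nu> f = proj \<nu> g \<longleftrightarrow> (\<lambda>x. f x - g x) \<in> chain_ideal \<nu>"
  using ring.quotient_eq_iff_same_a_r_cos[OF path_algebra_ring ideal_chain_ideal assms, of \<nu>]
  by (simp add: proj_def path_algebra_minus[OF assms])

lemma proj_ideal: "ideal I (path_algebra G) \<Longrightarrow> ideal (proj \<nu> ` I) (chain_algebra \<nu>)"
  by (rule ideal_image[OF proj_ring_hom_ring proj_carrier[symmetric]])

text \<open>\<open>long_ideal\<close> contains the kernel of the projection, so it is the full
  preimage of its image.\<close>

lemma proj_in_image_long_iff:
  assumes "f \<in> carrier (path_algebra G)"
  shows "proj \<nu> f \<in> proj \<nu> ` long_ideal \<longleftrightarrow> f \<in> long_ideal"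
proof
  assume "proj \<nu> f \<in> proj \<nu> ` long_ideal"
  then obtain g where g: "g \<in> long_ideal" "proj \<nu> f = proj \<nu> g" by blast
  then have "g \<in> carrier (path_algebra G)" using long_ideal_carrier by blast
  then have "(\<lambda>x. f x - g x) \<in> long_ideal"
    using g(2) proj_eq_iff[OF assms] chain_ideal_long by blast
  from long_ideal_add[OF this g(1)] show "f \<in> long_ideal" by simp
qed blast

section \<open>Socles of the quotient algebra\<close>

lemma top_ideal_scalar:
  assumes f: "f \<in> top_ideal a" and fJ: "f \<notin> chain_ideal \<nu>" and g: "g \<in> top_ideal a"
  shows "\<exists>c. proj \<nu> g = c \<odot>\<^bsub>chain_algebra \<nu>\<^esub> proj \<nu> f"
proof -
  have long: "f \<in> long_ideal" "g \<in> long_ideal" using f g top_ideal_long by blast+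
  then have carr: "f \<in> carrier (path_algebra G)" "g \<in> carrier (path_algebra G)"
    using long_ideal_carrier by blast+
  have "f (top_path a) \<noteq> 0"
  proof
    assume "f (top_path a) = 0"
    then have "f (top_path b) = 0" if "b \<in> arcs G" for b
      using f that unfolding top_ideal_def by (cases "b = a") auto
    then show False using chain_ideal_top_0I[OF long(1)] fJ by blast
  qed
  define c where "c = g (top_path a) / f (top_path a)"
  have "(\<lambda>x. g x + (- c) * f x) \<in> chain_ideal \<nu>"
  proof (rule chain_ideal_top_0I)
    show "(\<lambda>x. g x + (- c) * f x) \<in> long_ideal" by (intro long_ideal_add long_ideal_smult long)
    show "g (top_path b) + (- c) * f (top_path b) = 0" if "b \<in> arcs G" for b
      using f g that \<open>f (top_path a) \<noteq> 0\<close> unfolding top_ideal_def c_def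
      by (cases "b = a") auto
  qed
  then have "proj \<nu> g = proj \<nu> (\<lambda>x. c * f x)"
    using proj_eq_iff[OF carr(2) smult_closed[OF carr(1)]] by simp
  then show ?thesis using proj_smult[OF carr(1)] by auto
qed

text \<open>One argument for all three kinds of ideals. The kind enters through \<open>push\<close>:
  an element of \<open>T\<close> outside \<open>long_ideal\<close> can be multiplied by an arrow on
  a permitted side without becoming zero. Hence every nonzero \<open>T\<close> meets the image of
  \<open>long_ideal\<close>. That image is in turn spanned by the images of the
  \<open>top_ideal a\<close>, each zero or one-dimensional and therefore minimal for any kind of
  ideal that is stable under scalars.\<close>

lemma socle_chain_algebra:
  fixes \<nu> :: "'e \<Rightarrow> 'k::field"
  assumes sub: "\<And>T. P T (chain_algebra \<nu>) \<Longrightarrow> additive_subgroup T (chain_algebra \<nu>)"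
    and int: "\<And>S T. P S (chain_algebra \<nu>) \<Longrightarrow> P T (chain_algebra \<nu>) \<Longrightarrow> P (S \<inter> T) (chain_algebra \<nu>)"
    and ideal: "\<And>T. ideal T (chain_algebra \<nu>) \<Longrightarrow> P T (chain_algebra \<nu>)"
    and smult: "\<And>T Y c. P T (chain_algebra \<nu>) \<Longrightarrow> Y \<in> T \<Longrightarrow> c \<odot>\<^bsub>chain_algebra \<nu>\<^esub> Y \<in> T"
    and push: "\<And>T f. P T (chain_algebra \<nu>) \<Longrightarrow> f \<in> carrier (path_algebra G) \<Longrightarrow> proj \<nu> f \<in> T \<Longrightarrow>
        f \<notin> long_ideal \<Longrightarrow> \<exists>g\<in>carrier (path_algebra G). proj \<nu> g \<in> T \<and> g \<notin> chain_ideal \<nu> \<and>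
          (\<forall>n. f \<in> filt n \<longrightarrow> g \<in> filt (Suc n))"
  shows "socle_wrt P (chain_algebra \<nu>) = proj \<nu> ` long_ideal"
proof (rule socle_wrt_eqI)
  show P_long: "P (proj \<nu> ` long_ideal) (chain_algebra \<nu>)"
    by (intro ideal proj_ideal ideal_long_ideal)
  show "P (proj \<nu> ` long_ideal \<inter> T) (chain_algebra \<nu>)" if "P T (chain_algebra \<nu>)" for T
    by (rule int[OF P_long that])
  show "proj \<nu> ` long_ideal \<inter> T \<noteq> {\<zero>\<^bsub>chain_algebra \<nu>\<^esub>}"
    if T: "P T (chain_algebra \<nu>)" "T \<noteq> {\<zero>\<^bsub>chain_algebra \<nu>\<^esub>}" for T
  proof -
    have "\<zero>\<^bsub>chain_algebra \<nu>\<^esub> \<in> T" by (rule additive_subgroup.zero_closed[OF sub[OF T(1)]])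
    then obtain Y where Y: "Y \<in> T" "Y \<noteq> \<zero>\<^bsub>chain_algebra \<nu>\<^esub>" using T(2) by blast
    have "T \<subseteq> carrier (chain_algebra \<nu>)" by (rule additive_subgroup.a_subset[OF sub[OF T(1)]])
    then obtain f where f: "f \<in> carrier (path_algebra G)" "Y = proj \<nu> f"
      using Y(1) unfolding proj_carrier by blast
    let ?T = "{f \<in> carrier (path_algebra G). proj \<nu> f \<in> T}"
    have "\<exists>g\<in>?T. g \<in> long_ideal \<and> g \<notin> chain_ideal \<nu>"
    proof (rule descend_to_long)
      show "f \<in> ?T" "f \<in> carrier (path_algebra G)" using f Y by auto
      show "f \<notin> chain_ideal \<nu>" using Y(2) proj_eq_0_iff[OF f(1)] f(2) by simp
      show "\<exists>g\<in>?T. g \<notin> chain_ideal \<nu> \<and> (\<forall>n. h \<in> filt n \<longrightarrow> g \<in> filt (Suc n))"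
        if "h \<in> ?T" "h \<notin> long_ideal" for h
        using push[OF T(1), of h] that by blast
    qed
    then obtain g where g: "g \<in> carrier (path_algebra G)" "proj \<nu> g \<in> T" "g \<in> long_ideal"
      "g \<notin> chain_ideal \<nu>" by blast
    then have "proj \<nu> g \<noteq> \<zero>\<^bsub>chain_algebra \<nu>\<^esub>" using proj_eq_0_iff by blast
    then show ?thesis using g by blast
  qed
  show "proj \<nu> ` long_ideal \<subseteq> U"
    if U: "additive_subgroup U (chain_algebra \<nu>)"
      and min: "\<And>T. minimal_wrt P (chain_algebra \<nu>) T \<Longrightarrow> T \<subseteq> U" for U
  proof
    have zero: "\<zero>\<^bsub>chain_algebra \<nu>\<^esub> \<in> U" by (rule additive_subgroup.zero_closed[OF U])
    have top: "proj \<nu> ` top_ideal a \<subseteq> U" for a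
    proof (cases "proj \<nu> ` top_ideal a = {\<zero>\<^bsub>chain_algebra \<nu>\<^esub>}")
      \<comment> \<open>This happens for a = \<sigma> d with \<nu> d = 0, where the path itself
        vanishes in the quotient.\<close>
      case True
      then show ?thesis using zero by simp
    next
      case False
      have "minimal_wrt P (chain_algebra \<nu>) (proj \<nu> ` top_ideal a)"
        unfolding minimal_wrt_def
      proof (intro conjI allI impI False)
        show "P (proj \<nu> ` top_ideal a) (chain_algebra \<nu>)" by (intro ideal proj_ideal ideal_top_ideal)
        fix T assume T: "P T (chain_algebra \<nu>) \<and> T \<subseteq> proj \<nu> ` top_ideal a"
        show "T = {\<zero>\<^bsub>chain_algebra \<nu>\<^esub>} \<or> T = proj \<nu> ` top_ideal a"
        proof (cases "T = {\<zero>\<^bsub>chain_algebra \<nu>\<^esub>}")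
          case False
          have "\<zero>\<^bsub>chain_algebra \<nu>\<^esub> \<in> T" using T sub additive_subgroup.zero_closed by blast
          then obtain Y where "Y \<in> T" "Y \<noteq> \<zero>\<^bsub>chain_algebra \<nu>\<^esub>" using False by blast
          then obtain f where f: "f \<in> top_ideal a" "proj \<nu> f \<in> T" "proj \<nu> f \<noteq> \<zero>\<^bsub>chain_algebra \<nu>\<^esub>"
            using T by blast
          then have "f \<in> carrier (path_algebra G)" using top_ideal_long long_ideal_carrier by blast
          then have fJ: "f \<notin> chain_ideal \<nu>" using f(3) proj_eq_0_iff by blast
          have "proj \<nu> g \<in> T" if g: "g \<in> top_ideal a" for g
            using top_ideal_scalar[OF f(1) fJ g] smult[OF conjunct1[OF T] f(2)] by auto
          then show ?thesis using T by blast
        qed simp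
      qed
      then show ?thesis by (rule min)
    qed
    fix Y assume "Y \<in> proj \<nu> ` long_ideal"
    then obtain f where f: "f \<in> long_ideal" "Y = proj \<nu> f" by blast
    then have fc: "f \<in> carrier (path_algebra G)" using long_ideal_carrier by blast
    have "f \<in> {h \<in> carrier (path_algebra G). proj \<nu> h \<in> U}" using fc
    proof (induction rule: path_algebra_induct)
      case zero
      have "(\<lambda>x. 0) \<in> chain_ideal \<nu>" by (simp add: chain_ideal_def zero_closed)
      then have "proj \<nu> (\<lambda>x. 0) \<in> U" using zero_closed proj_eq_0_iff \<open>\<zero>\<^bsub>chain_algebra \<nu>\<^esub> \<in> U\<close> by metis
      then show ?case using zero_closed by blast
    next
      case (add g h)
      then show ?case
        using additive_subgroup.a_closed[OF U, of "proj \<nu> g" "proj \<nu> h"] add_closed[of g h]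
        by (simp add: proj_add)
    next
      case (single x)
      have x: "is_path x" "\<not> short x"
        using single path_algebra_is_path[OF fc single] f(1) unfolding long_ideal_def by blast+
      have sc: "single x (f x) \<in> carrier (path_algebra G)" by (rule path_algebra_single[OF x(1)])
      have "proj \<nu> (single x (f x)) \<in> U"
      proof (cases "\<exists>a\<in>arcs G. x = top_path a")
        case True
        then obtain a where a: "x = top_path a" by blast
        have "single x (f x) \<in> top_ideal a"
          using x(2) sc unfolding top_ideal_def long_ideal_def a
          by (auto simp: single_apply top_path_inj)
        then show ?thesis using top by blast
      next
        case False
        then have "single x (f x) \<in> chain_ideal \<nu>"
          using single_turn_or_long[OF rewriting_chain_ideal x] by blast
        then show ?thesis using proj_eq_0_iff[OF sc] zero by metis
      qed
      then show ?case using sc by blast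
    qed
    then show "Y \<in> U" using f(2) by blast
  qed
qed (rule sub)

lemma push_right:
  assumes "f \<in> carrier (path_algebra G)" "b \<in> arcs G" "f \<otimes>\<^bsub>path_algebra G\<^esub> arrow b \<notin> chain_ideal \<nu>"
    and T: "\<And>Y r. Y \<in> T \<Longrightarrow> r \<in> carrier (chain_algebra \<nu>) \<Longrightarrow> Y \<otimes>\<^bsub>chain_algebra \<nu>\<^esub> r \<in> T"
    and "proj \<nu> f \<in> T"
  shows "\<exists>g\<in>carrier (path_algebra G). proj \<nu> g \<in> T \<and> g \<notin> chain_ideal \<nu> \<and>
          (\<forall>n. f \<in> filt n \<longrightarrow> g \<in> filt (Suc n))"
proof (intro bexI conjI allI impI)
  note b = arrow_carrier[OF assms(2)]
  show "f \<otimes>\<^bsub>path_algebra G\<^esub> arrow b \<in> carrier (path_algebra G)" by (rule mult_closed[OF assms(1) b])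
  have "proj \<nu> (arrow b) \<in> carrier (chain_algebra \<nu>)" unfolding proj_carrier using b by blast
  then show "proj \<nu> (f \<otimes>\<^bsub>path_algebra G\<^esub> arrow b) \<in> T"
    unfolding proj_mult[OF assms(1) b] by (rule T[OF assms(5)])
qed (auto simp: assms filt_mult_arrow)

lemma push_left:
  assumes "f \<in> carrier (path_algebra G)" "b \<in> arcs G" "arrow b \<otimes>\<^bsub>path_algebra G\<^esub> f \<notin> chain_ideal \<nu>"
    and T: "\<And>Y r. Y \<in> T \<Longrightarrow> r \<in> carrier (chain_algebra \<nu>) \<Longrightarrow> r \<otimes>\<^bsub>chain_algebra \<nu>\<^esub> Y \<in> T"
    and "proj \<nu> f \<in> T"
  shows "\<exists>g\<in>carrier (path_algebra G). proj \<nu> g \<in> T \<and> g \<notin> chain_ideal \<nu> \<and>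
          (\<forall>n. f \<in> filt n \<longrightarrow> g \<in> filt (Suc n))"
proof (intro bexI conjI allI impI)
  note b = arrow_carrier[OF assms(2)]
  show "arrow b \<otimes>\<^bsub>path_algebra G\<^esub> f \<in> carrier (path_algebra G)" by (rule mult_closed[OF b assms(1)])
  have "proj \<nu> (arrow b) \<in> carrier (chain_algebra \<nu>)" unfolding proj_carrier using b by blast
  then show "proj \<nu> (arrow b \<otimes>\<^bsub>path_algebra G\<^esub> f) \<in> T"
    unfolding proj_mult[OF b assms(1)] by (rule T[OF assms(5)])
qed (auto simp: assms filt_arrow_mult)

lemma chain_ideal_zero: "(\<lambda>x. 0) \<in> chain_ideal \<nu>"
  by (simp add: chain_ideal_def zero_closed)

lemma socle_ideal: "socle_wrt ideal (chain_algebra \<nu>) = proj \<nu> ` long_ideal"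
proof (rule socle_chain_algebra)
  interpret Q: K_algebra "chain_algebra \<nu>" by (rule chain_algebra_K_algebra)
  show "ideal (S \<inter> T) (chain_algebra \<nu>)"
    if "ideal S (chain_algebra \<nu>)" "ideal T (chain_algebra \<nu>)" for S T
    using that by (rule Q.i_intersect)
  fix T assume T: "ideal T (chain_algebra \<nu>)"
  show "additive_subgroup T (chain_algebra \<nu>)" by (rule ideal.axioms(1)[OF T])
  show "c \<odot>\<^bsub>chain_algebra \<nu>\<^esub> Y \<in> T" if "Y \<in> T" for Y c
    by (rule Q.ideal_smult_closed[OF T that])
  fix f assume f: "f \<in> carrier (path_algebra G)" "proj \<nu> f \<in> T" "f \<notin> long_ideal"
  from two_sided_annihilator_long[OF f(1)] f(3) obtain b where b: "b \<in> arcs G"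
    and "f \<otimes>\<^bsub>path_algebra G\<^esub> arrow b \<notin> chain_ideal \<nu> \<or> arrow b \<otimes>\<^bsub>path_algebra G\<^esub> f \<notin> chain_ideal \<nu>"
    by blast
  then show "\<exists>g\<in>carrier (path_algebra G). proj \<nu> g \<in> T \<and> g \<notin> chain_ideal \<nu> \<and>
      (\<forall>n. f \<in> filt n \<longrightarrow> g \<in> filt (Suc n))"
    using push_right[OF f(1) b _ ideal.I_r_closed[OF T] f(2)]
      push_left[OF f(1) b _ ideal.I_l_closed[OF T] f(2)] by blast
qed

lemma socle_right:
  assumes \<nu>: "\<And>d. d \<in> D \<Longrightarrow> \<nu> d \<noteq> 0"
  shows "socle_wrt right_ideal (chain_algebra \<nu>) = proj \<nu> ` long_ideal"
proof (rule socle_chain_algebra)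
  interpret Q: K_algebra "chain_algebra \<nu>" by (rule chain_algebra_K_algebra)
  show "right_ideal (S \<inter> T) (chain_algebra \<nu>)"
    if "right_ideal S (chain_algebra \<nu>)" "right_ideal T (chain_algebra \<nu>)" for S T
    using that Q.additive_subgroup_Int unfolding right_ideal_def by blast
  show "right_ideal T (chain_algebra \<nu>)" if "ideal T (chain_algebra \<nu>)" for T
    using ideal.axioms(1)[OF that] ideal.I_r_closed[OF that] unfolding right_ideal_def by blast
  fix T assume T: "right_ideal T (chain_algebra \<nu>)"
  then show sub: "additive_subgroup T (chain_algebra \<nu>)" unfolding right_ideal_def by blast
  have rc: "Y \<otimes>\<^bsub>chain_algebra \<nu>\<^esub> r \<in> T" if "Y \<in> T" "r \<in> carrier (chain_algebra \<nu>)" for Y r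
    using T that unfolding right_ideal_def by blast
  \<comment> \<open>A right ideal is stable under scalars because scaling is right multiplication by
    c 1.\<close>
  show "c \<odot>\<^bsub>chain_algebra \<nu>\<^esub> Y \<in> T" if "Y \<in> T" for Y c
    using rc[OF that Q.smult_closed[OF Q.one_closed]]
      Q.mult_smult_one[OF additive_subgroup.a_Hcarr[OF sub that]] by simp
  fix f assume f: "f \<in> carrier (path_algebra G)" "proj \<nu> f \<in> T" "f \<notin> long_ideal"
  from right_annihilator_long[where \<nu> = \<nu>, OF f(1) \<nu>] f(3) obtain b where b: "b \<in> arcs G"
    "f \<otimes>\<^bsub>path_algebra G\<^esub> arrow b \<notin> chain_ideal \<nu>" by blast
  then show "\<exists>g\<in>carrier (path_algebra G). proj \<nu> g \<in> T \<and> g \<notin> chain_ideal \<nu> \<and>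
      (\<forall>n. f \<in> filt n \<longrightarrow> g \<in> filt (Suc n))"
    using push_right[OF f(1) b rc f(2)] by blast
qed

lemma socle_left:
  assumes \<nu>: "\<And>d. d \<in> D \<Longrightarrow> \<nu> d \<noteq> 0"
  shows "socle_wrt left_ideal (chain_algebra \<nu>) = proj \<nu> ` long_ideal"
proof (rule socle_chain_algebra)
  interpret Q: K_algebra "chain_algebra \<nu>" by (rule chain_algebra_K_algebra)
  show "left_ideal (S \<inter> T) (chain_algebra \<nu>)"
    if "left_ideal S (chain_algebra \<nu>)" "left_ideal T (chain_algebra \<nu>)" for S T
    using that Q.additive_subgroup_Int unfolding left_ideal_def by blast
  show "left_ideal T (chain_algebra \<nu>)" if "ideal T (chain_algebra \<nu>)" for T
    using ideal.axioms(1)[OF that] ideal.I_l_closed[OF that] unfolding left_ideal_def by blast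
  fix T assume T: "left_ideal T (chain_algebra \<nu>)"
  then show sub: "additive_subgroup T (chain_algebra \<nu>)" unfolding left_ideal_def by blast
  have lc: "r \<otimes>\<^bsub>chain_algebra \<nu>\<^esub> Y \<in> T" if "Y \<in> T" "r \<in> carrier (chain_algebra \<nu>)" for Y r
    using T that unfolding left_ideal_def by blast
  show "c \<odot>\<^bsub>chain_algebra \<nu>\<^esub> Y \<in> T" if "Y \<in> T" for Y c
    using lc[OF that Q.smult_closed[OF Q.one_closed]]
      Q.smult_one_mult[OF additive_subgroup.a_Hcarr[OF sub that]] by simp
  fix f assume f: "f \<in> carrier (path_algebra G)" "proj \<nu> f \<in> T" "f \<notin> long_ideal"
  from left_annihilator_long[where \<nu> = \<nu>, OF f(1) \<nu>] f(3) obtain b where b: "b \<in> arcs G"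
    "arrow b \<otimes>\<^bsub>path_algebra G\<^esub> f \<notin> chain_ideal \<nu>" by blast
  then show "\<exists>g\<in>carrier (path_algebra G). proj \<nu> g \<in> T \<and> g \<notin> chain_ideal \<nu> \<and>
      (\<forall>n. f \<in> filt n \<longrightarrow> g \<in> filt (Suc n))"
    using push_left[OF f(1) b lc f(2)] by blast
qed

text \<open>Both sides are the path algebra modulo \<open>long_ideal\<close>, by the third
  isomorphism theorem.\<close>

lemma quotient_by_long_isomorphic:
  fixes \<nu> \<nu>' :: "'e \<Rightarrow> 'k::field"
  shows "isomorphic_algebras (quot_algebra (chain_algebra \<nu>) (proj \<nu> ` long_ideal))
    (quot_algebra (chain_algebra \<nu>') (proj \<nu>' ` long_ideal))"
proof -
  interpret P: K_algebra "path_algebra G :: ('k, _) module" by (rule path_algebra_K_algebra)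
  have iso: "isomorphic_algebras (quot_algebra (path_algebra G) long_ideal)
      (quot_algebra (chain_algebra \<nu>) (proj \<nu> ` long_ideal))" for \<nu> :: "'e \<Rightarrow> 'k"
  proof (rule isomorphic_algebras_double_quotient[OF path_algebra_K_algebra ideal_chain_ideal])
    show "ideal (proj \<nu> ` long_ideal) (chain_algebra \<nu>)" by (rule proj_ideal[OF ideal_long_ideal])
    show "long_ideal = {x \<in> carrier (path_algebra G).
        chain_ideal \<nu> +>\<^bsub>path_algebra G\<^esub> x \<in> proj \<nu> ` long_ideal}"
      using proj_in_image_long_iff long_ideal_carrier unfolding proj_def[symmetric] by blast
  qed
  show ?thesis
    by (rule isomorphic_algebras_trans[OF isomorphic_algebras_sym[OF _ iso] iso])
      (rule P.quot_K_algebra[OF ideal_long_ideal])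
qed

text \<open>The basis is adjoined path by path. Independence of the normal paths shows that each new
  vector lies outside the span of the earlier ones, and reduction shows that the final span is
  everything. The resulting number does not mention \<nu>.\<close>

lemma chain_algebra_dimension:
  fixes \<nu> :: "'e \<Rightarrow> 'k::field"
  shows "algebra_dimension (chain_algebra \<nu>) (card normal_paths)"
proof -
  interpret Q: K_algebra "chain_algebra \<nu>" by (rule chain_algebra_K_algebra)
  let ?K = "range (\<lambda>c. c \<odot>\<^bsub>chain_algebra \<nu>\<^esub> \<one>\<^bsub>chain_algebra \<nu>\<^esub>)"
  let ?V = "\<lambda>F. {f \<in> carrier (path_algebra G). \<forall>x. f x \<noteq> 0 \<longrightarrow> x \<in> F}"
  have V_carr: "f \<in> carrier (path_algebra G)" if "f \<in> ?V F" for f F using that by blast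
  have "Q.dimension (card F) ?K (proj \<nu> ` ?V F)" if "finite F" "F \<subseteq> normal_paths" for F
    using that
  proof (induction F rule: finite_induct)
    case empty
    have V0: "?V {} = {\<lambda>x. 0}" using zero_closed by auto
    have p0: "proj \<nu> (\<lambda>x. 0) = \<zero>\<^bsub>chain_algebra \<nu>\<^esub>"
      using proj_eq_0_iff[OF zero_closed] chain_ideal_zero by blast
    have "proj \<nu> ` ?V {} = {\<zero>\<^bsub>chain_algebra \<nu>\<^esub>}"
      unfolding V0 image_insert image_empty p0 ..
    then show ?case using Q.zero_dim by simp
  next
    case (insert y F)
    have y: "y \<in> normal_paths" using insert.prems by blast
    let ?s = "single y (1::'k)"
    have s: "?s \<in> carrier (path_algebra G)"
      by (rule path_algebra_single[OF normal_path_is_path[OF y]])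
    have v: "proj \<nu> ?s \<in> carrier (chain_algebra \<nu>)" unfolding proj_carrier using s by blast
    have "proj \<nu> ?s \<notin> proj \<nu> ` ?V F"
    proof
      assume "proj \<nu> ?s \<in> proj \<nu> ` ?V F"
      then obtain f where f: "f \<in> ?V F" "proj \<nu> ?s = proj \<nu> f" by blast
      then have J: "(\<lambda>x. ?s x - f x) \<in> chain_ideal \<nu>" using proj_eq_iff[OF s V_carr] by blast
      have "x \<in> normal_paths" if "?s x - f x \<noteq> 0" for x
      proof (cases "x = y")
        case False
        then have "f x \<noteq> 0" using that by (simp add: single_apply)
        then show ?thesis using f(1) insert.prems by blast
      qed (simp add: y)
      then have "?s y - f y = 0" using chain_ideal_normal_eq_0[OF J] by blast
      then have "f y \<noteq> 0" by (simp add: single_apply)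
      then show False using f(1) insert.hyps(2) by blast
    qed
    moreover have "Q.dimension (card F) ?K (proj \<nu> ` ?V F)" using insert by blast
    ultimately have "Q.dimension (Suc (card F)) ?K (Q.line_extension ?K (proj \<nu> ?s) (proj \<nu> ` ?V F))"
      by (rule Q.Suc_dim[OF v])
    moreover have "Q.line_extension ?K (proj \<nu> ?s) (proj \<nu> ` ?V F) = proj \<nu> ` ?V (insert y F)"
    proof -
      have comb: "(c \<odot>\<^bsub>chain_algebra \<nu>\<^esub> \<one>\<^bsub>chain_algebra \<nu>\<^esub>) \<otimes>\<^bsub>chain_algebra \<nu>\<^esub> proj \<nu> ?s
          \<oplus>\<^bsub>chain_algebra \<nu>\<^esub> proj \<nu> f = proj \<nu> (\<lambda>x. c * ?s x + f x)"
        if "f \<in> ?V F" for c f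
        using Q.smult_one_mult[OF v, of c] proj_smult[OF s, of \<nu> c]
          proj_add[OF smult_closed[OF s, of c] V_carr[OF that], of \<nu>] by simp
      have "Q.line_extension ?K (proj \<nu> ?s) (proj \<nu> ` ?V F)
          = {proj \<nu> (\<lambda>x. c * ?s x + f x) | c f. f \<in> ?V F}"
        unfolding Q.line_extension_def set_add_def' r_coset_def using comb by blast
      also have "\<dots> = proj \<nu> ` ?V (insert y F)"
      proof (intro equalityI subsetI)
        fix Y assume "Y \<in> {proj \<nu> (\<lambda>x. c * ?s x + f x) | c f. f \<in> ?V F}"
        then obtain c f where Y: "Y = proj \<nu> (\<lambda>x. c * ?s x + f x)" "f \<in> ?V F" by blast
        have "(\<lambda>x. c * ?s x + f x) \<in> ?V (insert y F)"
          using Y(2) add_closed[OF smult_closed[OF s] V_carr[OF Y(2)]] by (auto simp: single_apply)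
        then show "Y \<in> proj \<nu> ` ?V (insert y F)" using Y(1) by blast
      next
        fix Y assume "Y \<in> proj \<nu> ` ?V (insert y F)"
        then obtain f where f: "f \<in> ?V (insert y F)" "Y = proj \<nu> f" by blast
        \<comment> \<open>Subtracting the component at \<open>y\<close> leaves a combination of
          paths in \<open>F\<close>.\<close>
        let ?g = "\<lambda>x. f x + (- f y) * ?s x"
        have "?g \<in> ?V F"
          using f(1) add_closed[OF V_carr[OF f(1)] smult_closed[OF s, of "- f y"]]
          by (auto simp: single_apply)
        moreover have "f = (\<lambda>x. f y * ?s x + ?g x)" by (simp add: fun_eq_iff)
        ultimately have "Y = proj \<nu> (\<lambda>x. f y * ?s x + ?g x) \<and> ?g \<in> ?V F" using f(2) by simp
        then show "Y \<in> {proj \<nu> (\<lambda>x. c * ?s x + f x) | c f. f \<in> ?V F}"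
          by (intro CollectI exI[of _ "f y"] exI[of _ ?g])
      qed
      finally show ?thesis .
    qed
    ultimately show ?case using insert.hyps by simp
  qed
  then have "Q.dimension (card normal_paths) ?K (proj \<nu> ` ?V normal_paths)"
    using finite_normal_paths by blast
  moreover have "proj \<nu> ` ?V normal_paths = carrier (chain_algebra \<nu>)"
  proof (intro equalityI subsetI)
    fix Y assume "Y \<in> carrier (chain_algebra \<nu>)"
    then obtain f where f: "f \<in> carrier (path_algebra G)" "Y = proj \<nu> f" unfolding proj_carrier by blast
    obtain g where g: "g \<in> carrier (path_algebra G)" "\<forall>x. g x \<noteq> 0 \<longrightarrow> x \<in> normal_paths"
      "(\<lambda>x. f x - g x) \<in> chain_ideal \<nu>"
      using reduce_mod[OF rewriting_chain_ideal f(1)] by blast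
    then have "Y = proj \<nu> g" using proj_eq_iff[OF f(1) g(1)] f(2) by blast
    then show "Y \<in> proj \<nu> ` ?V normal_paths" using g by blast
  qed (use V_carr in \<open>unfold proj_carrier, blast\<close>)
  ultimately show ?thesis unfolding algebra_dimension_def by simp
qed

section \<open>Square-zero elements and one-sided annihilators\<close>

lemma arrow_square:
  fixes \<nu> :: "'e \<Rightarrow> 'k::field"
  assumes b: "b \<in> arcs G"
  shows "arrow b \<otimes>\<^bsub>path_algebra G\<^esub> arrow b \<in> chain_ideal \<nu>"
proof (cases "head G b = tail G b")
  \<comment> \<open>Loops do occur, for instance the \<beta> arrows when p = 0 and s = k - 1. Since
    \<open>nxt b\<close> differs from \<open>b\<close>, running through a loop twice is a
    turn.\<close>
  case True
  then have "arrow b \<otimes>\<^bsub>path_algebra G\<^esub> arrow b = single (tail G b, [b, b]) (1 :: 'k)"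
    unfolding arrow_def by (simp add: mult_single path_end_def)
  then show ?thesis
    using rewriting_chain_ideal[of \<nu>] b True nxt_neq[OF b] unfolding rewriting_ideal_def by metis
next
  case False
  have "(arrow b \<otimes>\<^bsub>path_algebra G\<^esub> arrow b) (u, w) = (0 :: 'k)" for u w
  proof (cases "\<exists>v. (u, w) = (tail G b, [b] @ v)")
    case True
    then obtain v where v: "u = tail G b" "w = [b] @ v" by blast
    then show ?thesis
      using single_mult_append[of "(tail G b, [b])" "1 :: 'k" "arrow b" v] False
      by (simp add: arrow_def single_apply path_end_def)
  next
    case False
    then show ?thesis unfolding arrow_def by (intro single_mult_eq_0) auto
  qed
  then have "arrow b \<otimes>\<^bsub>path_algebra G\<^esub> arrow b = (\<lambda>x. 0 :: 'k)" by auto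
  then show ?thesis using chain_ideal_zero by simp
qed

text \<open>Arrows are square-zero, so an element killed on the right by all square-zero elements
  comes from \<open>long_ideal\<close>. A square-zero element has zero coefficients at trivial
  paths, since the square has there the squares of these coefficients. By \<open>mult_top_r\<close>
  it therefore kills everything from \<open>long_ideal\<close> on the left.\<close>

lemma square_zero_annihilators_nonzero:
  fixes \<nu> :: "'e \<Rightarrow> 'k::field"
  assumes \<nu>: "\<And>d. d \<in> D \<Longrightarrow> \<nu> d \<noteq> 0"
  shows "square_zero_annihilators_right_to_left (chain_algebra \<nu>)"
  unfolding square_zero_annihilators_right_to_left_def
proof (intro ballI impI)
  fix Y Z assume "Y \<in> carrier (chain_algebra \<nu>)" "Z \<in> carrier (chain_algebra \<nu>)"
    and r: "\<forall>Z\<in>carrier (chain_algebra \<nu>). Z \<otimes>\<^bsub>chain_algebra \<nu>\<^esub> Z = \<zero>\<^bsub>chain_algebra \<nu>\<^esub> \<longrightarrow>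
      Y \<otimes>\<^bsub>chain_algebra \<nu>\<^esub> Z = \<zero>\<^bsub>chain_algebra \<nu>\<^esub>"
    and ZZ: "Z \<otimes>\<^bsub>chain_algebra \<nu>\<^esub> Z = \<zero>\<^bsub>chain_algebra \<nu>\<^esub>"
  then obtain f g where f: "f \<in> carrier (path_algebra G)" "Y = proj \<nu> f"
    and g: "g \<in> carrier (path_algebra G)" "Z = proj \<nu> g" unfolding proj_carrier by blast
  have tr: "proj \<nu> a \<otimes>\<^bsub>chain_algebra \<nu>\<^esub> proj \<nu> b = \<zero>\<^bsub>chain_algebra \<nu>\<^esub> \<longleftrightarrow>
      a \<otimes>\<^bsub>path_algebra G\<^esub> b \<in> chain_ideal \<nu>"
    if "a \<in> carrier (path_algebra G)" "b \<in> carrier (path_algebra G)" for a b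
    using proj_eq_0_iff[OF mult_closed[OF that]] by (simp add: proj_mult[OF that])
  have "f \<otimes>\<^bsub>path_algebra G\<^esub> arrow b \<in> chain_ideal \<nu>" if b: "b \<in> arcs G" for b
  proof -
    note bc = arrow_carrier[OF b]
    have "arrow b \<otimes>\<^bsub>path_algebra G\<^esub> arrow b \<in> chain_ideal \<nu>" by (rule arrow_square[OF b])
    then have "Y \<otimes>\<^bsub>chain_algebra \<nu>\<^esub> proj \<nu> (arrow b) = \<zero>\<^bsub>chain_algebra \<nu>\<^esub>"
      using r tr[OF bc bc] bc unfolding proj_carrier by blast
    then show ?thesis using tr[OF f(1) bc] f(2) by simp
  qed
  then have fl: "f \<in> long_ideal" using right_annihilator_long[where \<nu> = \<nu>, OF f(1) \<nu>] by blast
  have gg: "g \<otimes>\<^bsub>path_algebra G\<^esub> g \<in> chain_ideal \<nu>" using ZZ tr[OF g(1) g(1)] g(2) by simp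
  have gv: "g (v, []) = 0" if "v \<in> verts G" for v
  proof -
    have "short (v, [])" using that two_le_L by (simp add: short_def is_path_Nil_iff is_chain_def)
    then have "(g \<otimes>\<^bsub>path_algebra G\<^esub> g) (v, []) = 0" using gg unfolding chain_ideal_def by blast
    then show ?thesis by (simp add: path_algebra_mult)
  qed
  have "g \<otimes>\<^bsub>path_algebra G\<^esub> f \<in> chain_ideal \<nu>"
  proof (rule chain_ideal_top_0I)
    show "g \<otimes>\<^bsub>path_algebra G\<^esub> f \<in> long_ideal"
      by (rule ideal.I_l_closed[OF ideal_long_ideal fl g(1)])
    show "(g \<otimes>\<^bsub>path_algebra G\<^esub> f) (top_path a) = 0" if "a \<in> arcs G" for a
      using mult_top_r[OF fl that, of g] gv[OF tail_in_verts[OF that]] by simp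
  qed
  then show "Z \<otimes>\<^bsub>chain_algebra \<nu>\<^esub> Y = \<zero>\<^bsub>chain_algebra \<nu>\<^esub>" using tr[OF g(1) f(1)] f(2) g(2) by simp
qed

text \<open>
  When \<open>\<nu> e = 0\<close>, the chain of length \<open>L - 1\<close> starting with \<open>\<sigma> e\<close> is killed by the radical on the
  right but not on the left.
\<close>

lemma square_zero_annihilators_zero:
  fixes \<nu> :: "'e \<Rightarrow> 'k::field"
  assumes e: "e \<in> D" "\<nu> e = 0"
  shows "\<not> square_zero_annihilators_right_to_left (chain_algebra \<nu>)"
proof
  assume P: "square_zero_annihilators_right_to_left (chain_algebra \<nu>)"
  have tr: "proj \<nu> a \<otimes>\<^bsub>chain_algebra \<nu>\<^esub> proj \<nu> b = \<zero>\<^bsub>chain_algebra \<nu>\<^esub> \<longleftrightarrow>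
      a \<otimes>\<^bsub>path_algebra G\<^esub> b \<in> chain_ideal \<nu>"
    if "a \<in> carrier (path_algebra G)" "b \<in> carrier (path_algebra G)" for a b
    using proj_eq_0_iff[OF mult_closed[OF that]] by (simp add: proj_mult[OF that])
  define b where "b = \<sigma> e"
  have b: "b \<in> E" "b \<in> arcs G" using e(1) \<sigma>_in_E \<sigma>_arc by (auto simp: b_def)
  \<comment> \<open>The witness chain has length n + 1 = L - 1. Being nonempty, it determines its
    first arrow \<open>b\<close>.\<close>
  define n where "n = L - 2"
  have L: "Suc (Suc n) = L" using two_le_L by (simp add: n_def)
  obtain d where d: "d \<in> arcs G" "nxt d = b" using prev_arc[OF b(2)] by blast
  then have dE: "d \<notin> E" using nxt_E b(1) by blast
  let ?x = "(tail G b, chain b (Suc n))"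
  define f where "f = single ?x (1::'k)"
  have f: "f \<in> carrier (path_algebra G)" unfolding f_def by (rule path_algebra_single[OF is_path_chain[OF b(2)]])
  have "f \<otimes>\<^bsub>path_algebra G\<^esub> g \<in> chain_ideal \<nu>"
    if g: "g \<in> carrier (path_algebra G)" "g \<otimes>\<^bsub>path_algebra G\<^esub> g \<in> chain_ideal \<nu>" for g
  proof (rule chain_idealI)
    have gv: "g (v, []) = 0" if "v \<in> verts G" for v
    proof -
      have "short (v, [])" using that two_le_L by (simp add: short_def is_path_Nil_iff is_chain_def)
      then have "(g \<otimes>\<^bsub>path_algebra G\<^esub> g) (v, []) = 0" using g(2) unfolding chain_ideal_def by blast
      then show ?thesis by (simp add: path_algebra_mult)
    qed
    \<comment> \<open>A chain of length at most L that extends the witness starts with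
      \<open>b\<close>. With \<open>top_path b\<close> excluded it is the witness itself, where the
      product has the coefficient of \<open>g\<close> at a trivial path, which is zero.\<close>
    have fg: "(f \<otimes>\<^bsub>path_algebra G\<^esub> g) (tail G c, chain c m) = 0"
      if "c \<in> arcs G" "m \<le> L" "c = b \<Longrightarrow> m < L" for c m
    proof (cases "\<exists>v. (tail G c, chain c m) = (fst ?x, snd ?x @ v)")
      case True
      then obtain v where v: "chain c m = chain b (Suc n) @ v" "tail G c = tail G b" by auto
      then have "length (chain c m) \<ge> Suc n" by simp
      then have m: "Suc n \<le> m" by simp
      then have "c = b" using v(1) hd_chain[of m c] by (simp add: chain_Suc)
      then have "m = Suc n" using that(3) m L by simp
      then have "v = []" using arg_cong[OF v(1), of length] by simp
      then have "(f \<otimes>\<^bsub>path_algebra G\<^esub> g) (tail G c, chain c m) = g (path_end ?x, [])"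
        using single_mult_append[of ?x "1::'k" g "[]"] v by (simp add: f_def)
      then show ?thesis using gv path_end_in_verts[OF is_path_chain[OF b(2)]] by simp
    next
      case False
      then show ?thesis unfolding f_def by (intro single_mult_eq_0) auto
    qed
    have top0: "(f \<otimes>\<^bsub>path_algebra G\<^esub> g) (top_path c) = 0" if "c \<in> arcs G" "c \<noteq> b" for c
      unfolding top_path_def using that by (intro fg) auto
    show "f \<otimes>\<^bsub>path_algebra G\<^esub> g \<in> long_ideal"
      by (rule long_idealI[OF mult_closed[OF f g(1)] fg]) simp_all
    show "(f \<otimes>\<^bsub>path_algebra G\<^esub> g) (top_path a) = 0" if "a \<in> arcs G" "a \<notin> D" "a \<notin> E" for a
      using that b(1) by (intro top0) auto
    show "(f \<otimes>\<^bsub>path_algebra G\<^esub> g) (top_path a) = - (\<nu> a * (f \<otimes>\<^bsub>path_algebra G\<^esub> g) (top_path (\<sigma> a)))"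
      if a: "a \<in> D" for a
    proof -
      have "a \<in> arcs G" "a \<noteq> b" using a D_arcs D_E b(1) by auto
      then have 1: "(f \<otimes>\<^bsub>path_algebra G\<^esub> g) (top_path a) = 0" by (rule top0)
      show ?thesis
      \<comment> \<open>For a = e the coefficient at \<open>top_path b\<close> is uncontrolled, but
        it is multiplied by \<open>\<nu> e\<close>, which is 0.\<close>
      proof (cases "a = e")
        case True
        then show ?thesis using 1 e(2) by simp
      next
        case False
        then have "\<sigma> a \<noteq> b"
          unfolding b_def using inj_on_eq_iff[OF bij_betw_imp_inj_on[OF \<sigma>_bij] a e(1)] by simp
        then show ?thesis using 1 top0[OF \<sigma>_arc[OF a]] by simp
      qed
    qed
  qed
  then have "proj \<nu> f \<otimes>\<^bsub>chain_algebra \<nu>\<^esub> Z = \<zero>\<^bsub>chain_algebra \<nu>\<^esub>"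
    if "Z \<in> carrier (chain_algebra \<nu>)" "Z \<otimes>\<^bsub>chain_algebra \<nu>\<^esub> Z = \<zero>\<^bsub>chain_algebra \<nu>\<^esub>" for Z
    using that tr f unfolding proj_carrier by blast
  moreover have "proj \<nu> f \<in> carrier (chain_algebra \<nu>)" "proj \<nu> (arrow d) \<in> carrier (chain_algebra \<nu>)"
    unfolding proj_carrier using f arrow_carrier[OF d(1)] by blast+
  moreover have "proj \<nu> (arrow d) \<otimes>\<^bsub>chain_algebra \<nu>\<^esub> proj \<nu> (arrow d) = \<zero>\<^bsub>chain_algebra \<nu>\<^esub>"
    using tr[OF arrow_carrier[OF d(1)] arrow_carrier[OF d(1)]] arrow_square[OF d(1)] by blast
  ultimately have "proj \<nu> (arrow d) \<otimes>\<^bsub>chain_algebra \<nu>\<^esub> proj \<nu> f = \<zero>\<^bsub>chain_algebra \<nu>\<^esub>"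
    using P unfolding square_zero_annihilators_right_to_left_def by blast
  then have J: "arrow d \<otimes>\<^bsub>path_algebra G\<^esub> f \<in> chain_ideal \<nu>"
    using tr[OF arrow_carrier[OF d(1)] f] by blast
  have "arrow d \<otimes>\<^bsub>path_algebra G\<^esub> f \<notin> chain_ideal \<nu>"
  \<comment> \<open>Prepending \<open>d\<close> completes the witness to \<open>top_path d\<close>.
    As \<open>d\<close> is outside \<open>E\<close>, this path is normal and hence nonzero in the
    quotient.\<close>
  proof (rule not_in_chain_idealI[OF _ d(1) dE])
    have "(arrow d \<otimes>\<^bsub>path_algebra G\<^esub> f) (top_path d) = f (tail G (nxt d), chain (nxt d) (Suc n))"
      using arrow_mult[OF d(1), of f "Suc n"] unfolding L top_path_def .
    then show "(arrow d \<otimes>\<^bsub>path_algebra G\<^esub> f) (top_path d) \<noteq> 0"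
      by (simp add: d(2) f_def single_apply)
    show "(arrow d \<otimes>\<^bsub>path_algebra G\<^esub> f) (top_path c) = 0" if "c \<in> E" for c
      using arrow_mult_eq_0[of c d f "tail G c" "Suc n"] that dE unfolding L top_path_def by blast
  qed
  then show False using J by blast
qed

section \<open>Overlong zero relations from commutativity relations\<close>

lemma single_turn:
  assumes I: "ideal I (path_algebra G)"
    and turns: "\<forall>a\<in>arcs G. \<forall>b\<in>arcs G. tail G b = head G a \<longrightarrow> b \<noteq> nxt a \<longrightarrow>
      single (tail G a, [a, b]) 1 \<in> I"
    and x: "is_path (u, v @ [a, b] @ v')" "b \<noteq> nxt a"
  shows "single (u, v @ [a, b] @ v') c \<in> I"
  using turns x
  by (intro ideal_single[OF I]) (auto simp: is_path_append_iff is_path_Cons_iff)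

text \<open>
  Extending the commutativity relation by one arrow turns one of its two paths into a path with
  a turn. This is why the overlong zero relations with extreme index are absent from the
  generators of \<open>\<Lambda>\<^sub>\<eta>\<close>.
\<close>

lemma single_long_from_relation:
  fixes I :: "('v \<times> 'e list \<Rightarrow> 'k::field) set"
  assumes I: "ideal I (path_algebra G)"
    and turns: "\<forall>a\<in>arcs G. \<forall>b\<in>arcs G. tail G b = head G a \<longrightarrow> b \<noteq> nxt a \<longrightarrow>
      single (tail G a, [a, b]) 1 \<in> I"
    and a: "a \<in> arcs G" and b: "b \<in> arcs G" and neq: "a \<noteq> b" and start: "tail G a = tail G b"
    and stop: "tail G ((nxt ^^ L) a) = tail G ((nxt ^^ L) b)"
    and rel: "(\<lambda>x. single (top_path a) 1 x - c * single (top_path b) 1 x) \<in> I"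
  shows "single (tail G a, chain a (Suc L)) 1 \<in> I"
    and "d \<in> arcs G \<Longrightarrow> nxt d = a \<Longrightarrow> single (tail G d, chain d (Suc L)) 1 \<in> I"
proof -
  interpret I: ideal I "path_algebra G" by (rule I)
  have split: "(\<lambda>x. single x1 1 x - c * single x2 1 x) = single x1 1 \<oplus>\<^bsub>path_algebra G\<^esub> single x2 (- c)"
    for x1 x2 :: "'v \<times> 'e list"
    by (auto simp: path_algebra_add single_apply)
  have carr: "single (top_path a) 1 \<in> carrier (path_algebra G)" "single (top_path b) (- c) \<in> carrier (path_algebra G)"
    using a b by (simp_all add: path_algebra_single is_path_top)
  have cancel: "f \<in> I" if "f \<oplus>\<^bsub>path_algebra G\<^esub> g \<in> I" "g \<in> I" for f g :: "'v \<times> 'e list \<Rightarrow> 'k"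
  proof -
    have "(f \<oplus>\<^bsub>path_algebra G\<^esub> g) \<oplus>\<^bsub>path_algebra G\<^esub> (\<lambda>x. - 1 * g x) \<in> I"
      using K_algebra.ideal_smult_closed[OF path_algebra_K_algebra I that(2), of "- 1"]
      by (intro additive_subgroup.a_closed[OF I.additive_subgroup_axioms that(1)])
        (simp add: path_algebra_smult)
    then show ?thesis by (simp add: path_algebra_add)
  qed
  have ends: "path_end (top_path a) = tail G ((nxt ^^ L) a)" "path_end (top_path b) = tail G ((nxt ^^ L) a)"
    using awlast_chain[OF a, of L] awlast_chain[OF b, of L] stop by (simp_all add: path_end_def top_path_def)
  define n where "n = L - 1"
  have L: "Suc n = L" using two_le_L by (simp add: n_def)
  show "single (tail G a, chain a (Suc L)) 1 \<in> I"
  proof (rule cancel)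
    let ?c = "(nxt ^^ L) a"
    have c: "?c \<in> arcs G" by (rule nxt_pow_arc[OF a])
    have "(single (top_path a) 1 \<oplus>\<^bsub>path_algebra G\<^esub> single (top_path b) (- c)) \<otimes>\<^bsub>path_algebra G\<^esub> arrow ?c \<in> I"
      using I.I_r_closed[OF rel arrow_carrier[OF c]] unfolding split .
    then have "single (top_path a) 1 \<otimes>\<^bsub>path_algebra G\<^esub> arrow ?c
        \<oplus>\<^bsub>path_algebra G\<^esub> single (top_path b) (- c) \<otimes>\<^bsub>path_algebra G\<^esub> arrow ?c \<in> I"
      using ring.ring_simprules(13)[OF path_algebra_ring carr arrow_carrier[OF c]] by simp
    then show "single (tail G a, chain a (Suc L)) 1 \<oplus>\<^bsub>path_algebra G\<^esub>
        single (tail G b, chain b L @ [?c]) (- c) \<in> I"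
      unfolding arrow_def by (simp add: mult_single ends) (simp add: chain_Suc_end top_path_def)
    have pc: "is_path (tail G b, chain b L @ [?c])"
      using awlast_chain[OF b, of L] is_path_arrow[OF c]
      by (simp add: is_path_append_iff is_path_chain[OF b] stop)
    have "chain b L @ [?c] = chain b n @ [(nxt ^^ n) b, ?c] @ []"
      using chain_Suc_end[of b n] L by simp
    \<comment> \<open>\<open>?c\<close> continues the chain from \<open>a\<close>; by injectivity of
      the L-th power of \<open>nxt\<close> it cannot also continue the chain from \<open>b\<close>,
      although both chains end at the same vertex.\<close>
    moreover have "?c \<noteq> nxt ((nxt ^^ n) b)"
      using nxt_pow_inj[OF a b, of "Suc n"] neq unfolding L by (simp add: L[symmetric])
    ultimately show "single (tail G b, chain b L @ [?c]) (- c) \<in> I"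
      using single_turn[OF I turns] pc by metis
  qed
  assume d: "d \<in> arcs G" "nxt d = a"
  have hd: "head G d = tail G a" using tail_nxt[OF d(1)] d(2) by simp
  show "single (tail G d, chain d (Suc L)) 1 \<in> I"
  proof (rule cancel)
    have "arrow d \<otimes>\<^bsub>path_algebra G\<^esub> (single (top_path a) 1 \<oplus>\<^bsub>path_algebra G\<^esub> single (top_path b) (- c)) \<in> I"
      using I.I_l_closed[OF rel arrow_carrier[OF d(1)]] unfolding split .
    then have "arrow d \<otimes>\<^bsub>path_algebra G\<^esub> single (top_path a) 1
        \<oplus>\<^bsub>path_algebra G\<^esub> arrow d \<otimes>\<^bsub>path_algebra G\<^esub> single (top_path b) (- c) \<in> I"
      using ring.ring_simprules(23)[OF path_algebra_ring carr arrow_carrier[OF d(1)]] by simp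
    then show "single (tail G d, chain d (Suc L)) 1 \<oplus>\<^bsub>path_algebra G\<^esub>
        single (tail G d, d # chain b L) (- c) \<in> I"
      unfolding arrow_def
      by (simp add: mult_single path_end_def top_path_def hd start[symmetric] chain_Suc d(2))
    have pd: "is_path (tail G d, d # chain b L)"
      using d(1) hd start is_path_chain[OF b, of L] by (simp add: is_path_Cons_iff)
    have "d # chain b L = [] @ [d, b] @ chain (nxt b) n"
      using chain_Suc[of b n] L by simp
    moreover have "b \<noteq> nxt d" using d(2) neq by simp
    ultimately show "single (tail G d, d # chain b L) (- c) \<in> I"
      using single_turn[OF I turns] pd by metis
  qed
qed

end

section \<open>The quiver of \<open>\<Lambda>\<close>\<close>

lemma idx_mod: "idx k n mod k = n mod k"
  by (simp add: idx_def)

lemma idx_range: "0 < k \<Longrightarrow> idx k n \<in> {1..k}"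
  by (auto simp: idx_def Suc_leI intro: less_imp_le)

lemma idx_eq_iff: "0 < k \<Longrightarrow> idx k m = idx k n \<longleftrightarrow> m mod k = n mod k"
  by (metis idx_def idx_mod)

lemma idx_id: "i \<in> {1..k} \<Longrightarrow> idx k i = i"
  by (cases "i = k") (auto simp: idx_def)

lemma idx_add_idx: "0 < k \<Longrightarrow> idx k (idx k m + n) = idx k (m + n)"
  by (simp add: idx_eq_iff mod_add_left_eq[of "idx k m", symmetric] idx_mod mod_add_left_eq)

lemma idx_add_cancel:
  assumes "0 < k" "idx k (m + c) = idx k (n + c)"
  shows "idx k m = idx k n"
proof -
  have "(m + c) mod k = (n + c) mod k" using assms by (simp add: idx_eq_iff)
  \<comment> \<open>Adding c (k - 1) completes the shift c to a multiple of k, which replaces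
    subtraction on natural numbers.\<close>
  then have "(m + c + c * (k - 1)) mod k = (n + c + c * (k - 1)) mod k"
    by (metis mod_add_left_eq)
  moreover have "l + c + c * (k - 1) = l + c * k" for l
    using assms(1) by (cases k) simp_all
  ultimately have "(m + c * k) mod k = (n + c * k) mod k" by (simp only:)
  then have "m mod k = n mod k" by simp
  then show ?thesis using assms(1) by (simp add: idx_eq_iff)
qed

text \<open>The subtraction is never truncated, because the representatives start at 1 and not at
  0.\<close>

lemma idx_pred: "0 < k \<Longrightarrow> idx k (idx k (Suc n) - 1) = idx k n"
proof (rule idx_add_cancel[where c = 1])
  assume k: "0 < k"
  then have "idx k (Suc n) - 1 + 1 = idx k (Suc n)" using idx_range[of k "Suc n"] by auto
  then show "idx k (idx k (Suc n) - 1 + 1) = idx k (n + 1)"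
    using k by (simp add: idx_eq_iff idx_mod)
qed assumption

text \<open>After the last arrow of A_i, at vertex i - 1, the relations \<open>f3\<close> forbid
  A_{i-1}, so B_i follows; after the last arrow of B_i, at vertex i + s, the relations
  \<open>f2\<close> forbid B_{s+i+1}, so A_{i+s} follows.\<close>

fun quiver_next :: "nat \<Rightarrow> nat \<Rightarrow> nat \<Rightarrow> nat \<Rightarrow> arrow \<Rightarrow> arrow" where
  "quiver_next p q k s (Al i j) = (if j < q then Al i (Suc j) else Be i 0)"
| "quiver_next p q k s (Be i j) = (if j < p then Be i (Suc j) else Al (idx k (i + s)) 0)"

text \<open>Only the values at the arrows \<open>Al i 0\<close> are meaningful.\<close>

fun partner :: "nat \<Rightarrow> arrow \<Rightarrow> arrow" where
  "partner k (Al i j) = Be (idx k (Suc i)) 0"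
| "partner k (Be i j) = Be i j"

text \<open>The bound on \<open>s\<close> keeps s + 1 inside {1..k}, so that the unreduced vertex
  \<open>V (s + 1)\<close> in \<open>relI_eta\<close> is really the end of rho_1.\<close>

locale lambda_quiver =
  fixes p q k s :: nat
  assumes k2: "2 \<le> k" and s_le: "s \<le> k - 1"
begin

abbreviation "Q \<equiv> quiver p q k s"
abbreviation "nx \<equiv> quiver_next p q k s"

definition max_length :: nat where
  "max_length = p + q + 2"

text \<open>The first arrows of the paths A_i B_i, taken as \<open>D\<close>. The first arrows of
  the parallel paths, all of the form B_i A_{i+s}, make up \<open>\<beta>_starts\<close>, taken as
  \<open>E\<close>.\<close>

definition \<alpha>_starts :: "arrow set" where
  "\<alpha>_starts = (\<lambda>i. Al i 0) ` {1..k}"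

definition \<beta>_starts :: "arrow set" where
  "\<beta>_starts = (\<lambda>i. Be i 0) ` {1..k}"

lemma k0: "0 < k"
  using k2 by simp

lemma verts_Q: "verts Q = {V i | i. i \<in> {1..k}} \<union> {VA i j | i j. i \<in> {1..k} \<and> j \<in> {1..q}}
    \<union> {VB i j | i j. i \<in> {1..k} \<and> j \<in> {1..p}}"
  by (simp add: quiver_def)

lemma arcs_Q: "arcs Q = {Al i j | i j. i \<in> {1..k} \<and> j \<in> {0..q}} \<union> {Be i j | i j. i \<in> {1..k} \<and> j \<in> {0..p}}"
  by (simp add: quiver_def)

lemma Al_arc: "Al i j \<in> arcs Q \<longleftrightarrow> i \<in> {1..k} \<and> j \<le> q"
  by (auto simp: arcs_Q)

lemma Be_arc: "Be i j \<in> arcs Q \<longleftrightarrow> i \<in> {1..k} \<and> j \<le> p"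
  by (auto simp: arcs_Q)

lemma V_vert: "V i \<in> verts Q \<longleftrightarrow> i \<in> {1..k}"
  and VA_vert: "VA i j \<in> verts Q \<longleftrightarrow> i \<in> {1..k} \<and> j \<in> {1..q}"
  and VB_vert: "VB i j \<in> verts Q \<longleftrightarrow> i \<in> {1..k} \<and> j \<in> {1..p}"
  by (auto simp: verts_Q)

lemma tail_Q: "tail Q = quiver_tail k" and head_Q: "head Q = quiver_head p q k s"
  by (simp_all add: quiver_def)

lemma nx_Al: "j \<le> q \<Longrightarrow> (nx ^^ (Suc q - j)) (Al i j) = Be i 0"
proof (induction "q - j" arbitrary: j)
  case 0
  then show ?case by simp
next
  case (Suc n)
  then have "Suc q - j = Suc (Suc q - Suc j)" "j < q" by simp_all
  then show ?case using Suc.hyps(1)[of "Suc j"] Suc.hyps(2) by (simp add: funpow_swap1 del: funpow.simps) (simp add: funpow_swap1)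
qed

lemma nx_Be: "j \<le> p \<Longrightarrow> (nx ^^ (Suc p - j)) (Be i j) = Al (idx k (i + s)) 0"
proof (induction "p - j" arbitrary: j)
  case 0
  then show ?case by simp
next
  case (Suc n)
  then have "Suc p - j = Suc (Suc p - Suc j)" "j < p" by simp_all
  then show ?case using Suc.hyps(1)[of "Suc j"] Suc.hyps(2) by (simp add: funpow_swap1 del: funpow.simps) (simp add: funpow_swap1)
qed

lemma nx_L_Al: "(nx ^^ max_length) (Al i 0) = Al (idx k (i + s)) 0"
proof -
  have "max_length = Suc p + Suc q" by (simp add: max_length_def)
  then show ?thesis using nx_Al[of 0 i] nx_Be[of 0 i] by (simp only: funpow_add o_apply) simp
qed

lemma nx_L_Be: "(nx ^^ max_length) (Be i 0) = Be (idx k (i + s)) 0"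
proof -
  have "max_length = Suc q + Suc p" by (simp add: max_length_def)
  then show ?thesis using nx_Al[of 0 "idx k (i + s)"] nx_Be[of 0 i] by (simp only: funpow_add o_apply) simp
qed

lemma nx_arc: "a \<in> arcs Q \<Longrightarrow> nx a \<in> arcs Q"
  using idx_range[OF k0] by (cases a) (auto simp: Al_arc Be_arc simp del: atLeastAtMost_iff)

lemma nx_inj: "inj_on nx (arcs Q)"
proof (rule inj_onI)
  fix a b assume a: "a \<in> arcs Q" and b: "b \<in> arcs Q" and eq: "nx a = nx b"
  have "i = i'" if "i \<in> {1..k}" "i' \<in> {1..k}" "idx k (i + s) = idx k (i' + s)" for i i'
    using idx_add_cancel[OF k0 that(3)] idx_id that by simp
  then show "a = b"
    using a b eq
    by (cases a; cases b) (auto simp: Al_arc Be_arc split: if_splits simp del: atLeastAtMost_iff)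
qed

sublocale fin_digraph Q
proof
  fix a assume "a \<in> arcs Q"
  then show "tail Q a \<in> verts Q" "head Q a \<in> verts Q"
    using idx_range[OF k0] 
    by (cases a; force simp: Al_arc Be_arc V_vert VA_vert VB_vert tail_Q head_Q)+
next
  have "verts Q \<subseteq> V ` {1..k} \<union> (\<lambda>(i, j). VA i j) ` ({1..k} \<times> {1..q}) \<union> (\<lambda>(i, j). VB i j) ` ({1..k} \<times> {1..p})"
    by (auto simp: verts_Q)
  then show "finite (verts Q)" by (rule finite_subset) simp
  have "arcs Q \<subseteq> (\<lambda>(i, j). Al i j) ` ({1..k} \<times> {0..q}) \<union> (\<lambda>(i, j). Be i j) ` ({1..k} \<times> {0..p})"
    by (auto simp: arcs_Q)
  then show "finite (arcs Q)" by (rule finite_subset) simp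
qed

lemma tail_nx: "a \<in> arcs Q \<Longrightarrow> tail Q (nx a) = head Q a"
  by (cases a) (auto simp: Al_arc Be_arc tail_Q head_Q)

text \<open>The two paths of length p + q + 2 to be linked are A_i B_i and B_{i+1} A_{s+i+1}. Both
  run from i to i + s, which is the content of the two conditions on
  \<open>partner k\<close>.\<close>

sublocale chain_quiver Q nx max_length \<alpha>_starts \<beta>_starts "partner k"
proof
  show "bij_betw nx (arcs Q) (arcs Q)"
    unfolding bij_betw_def using nx_inj nx_arc by (intro conjI endo_inj_surj) auto
  show "tail Q (nx a) = head Q a" if "a \<in> arcs Q" for a using that by (rule tail_nx)
  show "nx a \<noteq> a" for a by (cases a) auto
  show "2 \<le> max_length" by (simp add: max_length_def)
  show "\<exists>a\<in>arcs Q. tail Q a = v" if v: "v \<in> verts Q" for v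
  proof (cases v)
    case (V i)
    then show ?thesis using v by (intro bexI[of _ "Al i 0"]) (auto simp: Al_arc V_vert tail_Q)
  next
    case (VA i j)
    then show ?thesis using v by (intro bexI[of _ "Al i j"]) (auto simp: Al_arc VA_vert tail_Q)
  next
    case (VB i j)
    then show ?thesis using v by (intro bexI[of _ "Be i j"]) (auto simp: Be_arc VB_vert tail_Q)
  qed
  show "\<alpha>_starts \<subseteq> arcs Q" "\<beta>_starts \<subseteq> arcs Q"
    by (auto simp: Al_arc Be_arc \<alpha>_starts_def \<beta>_starts_def)
  show "\<alpha>_starts \<inter> \<beta>_starts = {}" by (auto simp: \<alpha>_starts_def \<beta>_starts_def)
  show "bij_betw (partner k) (\<alpha>_starts) (\<beta>_starts)"
  proof (rule bij_betw_imageI)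
    show "inj_on (partner k) (\<alpha>_starts)"
    proof (rule inj_onI)
      fix a b assume "a \<in> \<alpha>_starts" "b \<in> \<alpha>_starts" "partner k a = partner k b"
      then obtain i i' where i: "i \<in> {1..k}" "i' \<in> {1..k}" "a = Al i 0" "b = Al i' 0"
        "idx k (i + 1) = idx k (i' + 1)" by (auto simp: \<alpha>_starts_def)
      then have "i = i'" using idx_add_cancel[OF k0 i(5)] idx_id by simp
      then show "a = b" using i by simp
    qed
    have "Be i 0 \<in> partner k ` \<alpha>_starts" if i: "i \<in> {1..k}" for i
    proof -
      have "idx k (Suc (idx k (i - 1))) = idx k (Suc (i - 1))"
        using idx_add_idx[OF k0, of "i - 1" 1] by simp
      also have "\<dots> = i" using i idx_id by simp
      finally have "Be i 0 = partner k (Al (idx k (i - 1)) 0)" by simp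
      then show ?thesis using idx_range[OF k0] unfolding \<alpha>_starts_def by blast
    qed
    then show "partner k ` \<alpha>_starts = \<beta>_starts"
      using idx_range[OF k0] by (auto simp: \<alpha>_starts_def \<beta>_starts_def)
  qed
  fix a assume "a \<in> \<alpha>_starts"
  then obtain i where i: "i \<in> {1..k}" "a = Al i 0" unfolding \<alpha>_starts_def by blast
  show "tail Q (partner k a) = tail Q a"
    using idx_pred[OF k0, of i] idx_id[OF i(1)] by (simp add: i(2) tail_Q)
  have "idx k (idx k (Suc i) + s) = idx k (Suc (i + s))"
    using idx_add_idx[OF k0, of "Suc i" s] by simp
  then show "tail Q ((nx ^^ max_length) (partner k a)) = tail Q ((nx ^^ max_length) a)"
    using idx_pred[OF k0, of "i + s"] by (simp only: i(2) partner.simps nx_L_Al nx_L_Be) (simp add: tail_Q)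
next
  fix a assume "a \<in> \<beta>_starts"
  \<comment> \<open>The arrow after \<open>Be i 0\<close> is \<open>Be i 1\<close>, or an \<alpha>
    arrow when p = 0.\<close>
  then show "nx a \<notin> \<beta>_starts" by (auto simp: \<beta>_starts_def split: if_splits)
qed

section \<open>The paths occurring in the relations as chains\<close>

lemma chain_Al: "j + n \<le> Suc q \<Longrightarrow> chain (Al i j) n = map (Al i) [j..<j + n]"
proof (induction n arbitrary: j)
  case (Suc n)
  show ?case
  proof (cases n)
    case (Suc m)
    then have "j < q" using Suc.prems by simp
    then show ?thesis using Suc.IH[of "Suc j"] Suc.prems by (simp add: chain_Suc upt_conv_Cons del: upt_Suc)
  qed (simp add: chain_Suc)
qed simp

lemma chain_Be: "j + n \<le> Suc p \<Longrightarrow> chain (Be i j) n = map (Be i) [j..<j + n]"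
proof (induction n arbitrary: j)
  case (Suc n)
  show ?case
  proof (cases n)
    case (Suc m)
    then have "j < p" using Suc.prems by simp
    then show ?thesis using Suc.IH[of "Suc j"] Suc.prems by (simp add: chain_Suc upt_conv_Cons del: upt_Suc)
  qed (simp add: chain_Suc)
qed simp

lemma seg\<alpha>_chain: "a \<le> Suc b \<Longrightarrow> b \<le> q \<Longrightarrow> seg\<alpha> k i a b = chain (Al (idx k i) a) (Suc b - a)"
  by (simp add: seg\<alpha>_def chain_Al del: upt_Suc)

lemma seg\<beta>_chain: "a \<le> Suc b \<Longrightarrow> b \<le> p \<Longrightarrow> seg\<beta> k i a b = chain (Be (idx k i) a) (Suc b - a)"
  by (simp add: seg\<beta>_def chain_Be del: upt_Suc)

lemma pathA_chain: "pathA q k i = chain (Al (idx k i) 0) (Suc q)"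
  unfolding pathA_def by (subst seg\<alpha>_chain) simp_all

lemma pathB_chain: "pathB p k i = chain (Be (idx k i) 0) (Suc p)"
  unfolding pathB_def by (subst seg\<beta>_chain) simp_all

lemma chain_Al_append: "j \<le> q \<Longrightarrow> chain (Al i j) (Suc q - j) @ chain (Be i 0) n = chain (Al i j) (Suc q - j + n)"
  unfolding chain_add nx_Al ..

lemma chain_Be_append: "j \<le> p \<Longrightarrow>
    chain (Be i j) (Suc p - j) @ chain (Al (idx k (i + s)) 0) n = chain (Be i j) (Suc p - j + n)"
  unfolding chain_add nx_Be ..

lemma AB_chain: "pathA q k i @ pathB p k i = chain (Al (idx k i) 0) max_length"
proof -
  have "Suc q - 0 + Suc p = max_length" by (simp add: max_length_def)
  then show ?thesis using chain_Al_append[of 0 "idx k i" "Suc p"] by (simp only: pathA_chain pathB_chain) simp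
qed

lemma BA_chain: "pathB p k (i + 1) @ pathA q k (s + i + 1) = chain (partner k (Al i 0)) max_length"
proof -
  have "idx k (idx k (i + 1) + s) = idx k (s + i + 1)" using idx_add_idx[OF k0, of "i + 1" s] by (simp add: ac_simps)
  then show ?thesis
    using chain_Be_append[of 0 "idx k (i + 1)" "Suc q"]
    by (simp add: pathA_chain pathB_chain ac_simps max_length_def)
qed

text \<open>The three pieces have q + 1 - j, p + 1 and j + 1 arrows. The index j cancels, so all
  these relations are chains of length L + 1, one for each \<alpha> arrow.\<close>

lemma long_Al_chain:
  assumes i: "i \<in> {1..k}" and j: "j \<le> q"
  shows "seg\<alpha> k i j q @ pathB p k i @ seg\<alpha> k (s + i) 0 j = chain (Al i j) (Suc max_length)"
proof -
  have "pathB p k i @ seg\<alpha> k (s + i) 0 j = chain (Be i 0) (Suc p + Suc j)"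
    using chain_Be_append[of 0 i "Suc j"] seg\<alpha>_chain[of 0 j "s + i"] j
    by (simp add: pathB_chain idx_id[OF i] ac_simps)
  moreover have "Suc q - j + (Suc p + Suc j) = Suc max_length" using j by (simp add: max_length_def)
  ultimately show ?thesis
    using chain_Al_append[OF j, of i "Suc p + Suc j"] seg\<alpha>_chain[of j q i] j
    by (simp add: idx_id[OF i] add.commute)
qed

lemma long_Be_chain:
  assumes i: "i \<in> {1..k}" and j: "j \<le> p"
  shows "seg\<beta> k i j p @ pathA q k (s + i) @ seg\<beta> k (s + i) 0 j = chain (Be i j) (Suc max_length)"
proof -
  have "pathA q k (s + i) @ seg\<beta> k (s + i) 0 j = chain (Al (idx k (i + s)) 0) (Suc q + Suc j)"
    using chain_Al_append[of 0 "idx k (i + s)" "Suc j"] seg\<beta>_chain[of 0 j "s + i"] j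
    by (simp add: pathA_chain ac_simps)
  moreover have "Suc p - j + (Suc q + Suc j) = Suc max_length" using j by (simp add: max_length_def)
  ultimately show ?thesis
    using chain_Be_append[OF j, of i "Suc q + Suc j"] seg\<beta>_chain[of j p i] j
    by (simp add: idx_id[OF i] add.commute)
qed

lemma path_elem_chain: "0 < n \<Longrightarrow> path_elem Q (chain a n) = single (tail Q a, chain a n) 1"
  by (simp add: path_elem_eq_single hd_chain)

lemma path_elem_top: "path_elem Q (chain a max_length) = single (top_path a) 1"
  unfolding top_path_def by (rule path_elem_chain) (simp add: max_length_def)

section \<open>The generators as relations between chains\<close>

definition relation :: "'k::field \<Rightarrow> 'k \<Rightarrow> nat \<Rightarrow> 'k kq" where
  "relation c d i = (\<lambda>x. c * single (top_path (Al i 0)) 1 x - d * single (top_path (partner k (Al i 0))) 1 x)"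

lemma D_arc: "i \<in> {1..k} \<Longrightarrow> Al i 0 \<in> arcs Q"
  and D_mem: "i \<in> {1..k} \<Longrightarrow> Al i 0 \<in> \<alpha>_starts"
  by (auto simp: Al_arc \<alpha>_starts_def)

lemma top_carrier: "a \<in> arcs Q \<Longrightarrow> single (top_path a) c \<in> carrier (path_algebra Q)"
  by (rule path_algebra_single[OF is_path_top])

lemma f1_relation:
  assumes i: "i \<in> {1..k}"
  shows "f1 p q k s lam i = relation 1 (if i = 1 then lam else 1) i"
proof -
  let ?d = "if i = 1 then lam else 1"
  let ?b = "partner k (Al i 0)"
  have carr: "single (top_path (Al i 0)) (1::'a) \<in> carrier (path_algebra Q)"
    "(\<lambda>x. ?d * single (top_path ?b) 1 x) \<in> carrier (path_algebra Q)"
    using top_carrier D_arc[OF i] smult_closed[OF top_carrier[OF \<sigma>_arc[OF D_mem[OF i]]]] by blast+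
  have "f1 p q k s lam i = single (top_path (Al i 0)) 1 \<ominus>\<^bsub>path_algebra Q\<^esub> (\<lambda>x. ?d * single (top_path ?b) 1 x)"
    unfolding f1_def AB_chain BA_chain path_elem_top idx_id[OF i] path_algebra_smult ..
  then show ?thesis unfolding path_algebra_minus[OF carr] relation_def by simp
qed

text \<open>As rho_1 is A_1 B_1, subtracting t rho_1 only moves its coefficient from 1 to 1 -
  t.\<close>

lemma f1_eta_relation:
  "f1 p q k s lam 1 \<ominus>\<^bsub>path_algebra Q\<^esub> t \<odot>\<^bsub>path_algebra Q\<^esub> path_elem Q (rho p q k) = relation (1 - t) lam 1"
proof -
  have i: "1 \<in> {1..k}" using k0 by simp
  have rho: "path_elem Q (rho p q k) = single (top_path (Al 1 0)) 1"
    unfolding rho_def AB_chain path_elem_top idx_id[OF i] ..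
  have c: "(\<lambda>x. c * single (top_path a) 1 x) = single (top_path a) c" for c :: 'a and a
    by (auto simp: single_apply)
  have carr: "single (top_path (Al 1 0)) (c::'a) \<in> carrier (path_algebra Q)"
    "single (top_path (partner k (Al 1 0))) (c::'a) \<in> carrier (path_algebra Q)" for c
    using top_carrier D_arc[OF i] top_carrier[OF \<sigma>_arc[OF D_mem[OF i]]] by blast+
  have "relation 1 lam 1 \<in> carrier (path_algebra Q)"
    using add_closed[OF carr(1)[of 1] carr(2)[of "- lam"]]
    by (rule back_subst[where P = "\<lambda>f. f \<in> _"]) (auto simp: single_apply relation_def)
  then have "relation 1 lam 1 \<ominus>\<^bsub>path_algebra Q\<^esub> single (top_path (Al 1 0)) t
      = (\<lambda>x. relation 1 lam 1 x - single (top_path (Al 1 0)) t x)"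
    by (rule path_algebra_minus[OF _ carr(1)])
  also have "\<dots> = relation (1 - t) lam 1"
    unfolding relation_def by (rule ext) (auto simp: single_apply top_path_inj)
  finally show ?thesis
    unfolding rho path_algebra_smult c using f1_relation[OF i, of lam] by simp
qed

text \<open>Only the coefficient \<open>d\<close> of B A is inverted, which is 1 or lam in all
  cases. The coefficient \<open>c\<close> of A B may be zero, as it is in the deformed relation at t
  = 1.\<close>

lemma relation_in_ideal_iff:
  assumes I: "ideal I (path_algebra Q)" and d: "d \<noteq> 0"
  shows "relation c d i \<in> I \<longleftrightarrow>
    (\<lambda>x. single (top_path (partner k (Al i 0))) 1 x - (c / d) * single (top_path (Al i 0)) 1 x) \<in> I"
    (is "_ \<longleftrightarrow> ?g \<in> I")
proof
  assume r: "relation c d i \<in> I"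
  have "(- 1 / d) \<odot>\<^bsub>path_algebra Q\<^esub> relation c d i = ?g"
    using d by (auto simp: path_algebra_smult relation_def single_apply fun_eq_iff field_simps)
  then show "?g \<in> I"
    using K_algebra.ideal_smult_closed[OF path_algebra_K_algebra I r, of "- 1 / d"] by (simp only:)
next
  assume g: "?g \<in> I"
  have "(- d) \<odot>\<^bsub>path_algebra Q\<^esub> ?g = relation c d i"
    using d by (auto simp: path_algebra_smult relation_def single_apply fun_eq_iff field_simps)
  then show "relation c d i \<in> I"
    using K_algebra.ideal_smult_closed[OF path_algebra_K_algebra I g, of "- d"] by (simp only:)
qed

lemma f2_eq: "i \<in> {1..k} \<Longrightarrow> f2 p q k s i = single (tail Q (Be i p), [Be i p, Be (idx k (s + i + 1)) 0]) 1"
  by (simp add: f2_def seg\<beta>_def path_elem_eq_single idx_id)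

lemma f3_eq: "i \<in> {1..k} \<Longrightarrow> f3 p q k s i = single (tail Q (Al i q), [Al i q, Al (idx k (i - 1)) 0]) 1"
  by (simp add: f3_def seg\<alpha>_def path_elem_eq_single idx_id)

lemma f2_turn:
  assumes "i \<in> {1..k}"
  shows "\<exists>a\<in>arcs Q. \<exists>b\<in>arcs Q. tail Q b = head Q a \<and> b \<noteq> nx a \<and> f2 p q k s i = single (tail Q a, [a, b]) 1"
  using assms idx_range[OF k0, of "s + i + 1"] idx_pred[OF k0, of "s + i"]
  by (intro bexI[of _ "Be i p"] bexI[of _ "Be (idx k (s + i + 1)) 0"])
    (auto simp: f2_eq Be_arc tail_Q head_Q ac_simps)

lemma f3_turn:
  assumes "i \<in> {1..k}"
  shows "\<exists>a\<in>arcs Q. \<exists>b\<in>arcs Q. tail Q b = head Q a \<and> b \<noteq> nx a \<and> f3 p q k s i = single (tail Q a, [a, b]) 1"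
  using assms idx_range[OF k0, of "i - 1"]
  by (intro bexI[of _ "Al i q"] bexI[of _ "Al (idx k (i - 1)) 0"])
    (auto simp: f3_eq Al_arc tail_Q head_Q)

text \<open>Only the vertices \<open>V i\<close> have two outgoing arrows, so a turn can occur only
  after the last arrow of some A_i or B_i. The wrong continuation there is precisely the one in
  \<open>f3\<close> or \<open>f2\<close>.\<close>

lemma turn_cases:
  assumes a: "a \<in> arcs Q" and b: "b \<in> arcs Q" and ab: "tail Q b = head Q a" "b \<noteq> nx a"
  shows "\<exists>i\<in>{1..k}. single (tail Q a, [a, b]) (1::'k::field) = f2 p q k s i \<or> single (tail Q a, [a, b]) 1 = f3 p q k s i"
proof (cases a)
  case (Al i j)
  then have i: "i \<in> {1..k}" and "j \<le> q" using a by (auto simp: Al_arc)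
  have j: "j = q" using ab Al \<open>j \<le> q\<close> by (cases b) (auto simp: tail_Q head_Q split: if_splits)
  have "b = Al (idx k (i - 1)) 0"
  proof (cases b)
    case (Al i' j')
    then show ?thesis using ab b \<open>a = Al i j\<close> j by (auto simp: tail_Q head_Q split: if_splits)
  next
    case (Be i' j')
    then have i': "i' \<in> {1..k}" using b by (simp add: Be_arc)
    have "j' = 0" "idx k (i' - 1) = idx k (i - 1)"
      using ab Be Al j by (auto simp: tail_Q head_Q split: if_splits)
    then have "idx k (i' - 1 + 1) = idx k (i - 1 + 1)"
      using idx_add_idx[OF k0, of "i' - 1" 1] idx_add_idx[OF k0, of "i - 1" 1] by simp
    then have "i' = i" using i i' idx_id by simp
    then show ?thesis using ab(2) Be Al j \<open>j' = 0\<close> by simp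
  qed
  then show ?thesis using Al j by (intro bexI[OF _ i] disjI2) (simp add: f3_eq[OF i])
next
  case (Be i j)
  then have i: "i \<in> {1..k}" and "j \<le> p" using a by (auto simp: Be_arc)
  have j: "j = p" using ab Be \<open>j \<le> p\<close> by (cases b) (auto simp: tail_Q head_Q split: if_splits)
  have "b = Be (idx k (s + i + 1)) 0"
  proof (cases b)
    case (Al i' j')
    then show ?thesis using ab b \<open>a = Be i j\<close> j by (auto simp: tail_Q head_Q split: if_splits)
  next
    case (Be i' j')
    then have i': "i' \<in> {1..k}" using b by (simp add: Be_arc)
    have "j' = 0" "idx k (i' - 1) = idx k (i + s)"
      using ab Be \<open>a = Be i j\<close> j by (auto simp: tail_Q head_Q split: if_splits)
    then have "idx k (i' - 1 + 1) = idx k (i + s + 1)"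
      using idx_add_idx[OF k0, of "i' - 1" 1] idx_add_idx[OF k0, of "i + s" 1] by simp
    then have "i' = idx k (s + i + 1)" using i' idx_id by (simp add: ac_simps)
    then show ?thesis using Be \<open>j' = 0\<close> by simp
  qed
  then show ?thesis using Be j by (intro bexI[OF _ i] disjI1) (simp add: f2_eq[OF i])
qed

lemma f4_eq: "i \<in> {1..k} \<Longrightarrow> j \<le> p \<Longrightarrow>
    f4 p q k s i j = single (tail Q (Be i j), chain (Be i j) (Suc max_length)) 1"
  unfolding f4_def long_Be_chain by (rule path_elem_chain) simp

lemma f5_eq: "i \<in> {1..k} \<Longrightarrow> j \<le> q \<Longrightarrow>
    f5 p q k s i j = single (tail Q (Al i j), chain (Al i j) (Suc max_length)) 1"
  unfolding f5_def long_Al_chain by (rule path_elem_chain) simp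

text \<open>The family \<nu> in closed form: it deviates from 1 at index 1 alone, with c = 1 / lam
  for the original algebra and c = (1 - t) / lam for the deformed one.\<close>

fun coefficient :: "'k::field \<Rightarrow> arrow \<Rightarrow> 'k" where
  "coefficient c (Al i j) = (if i = 1 then c else 1)"
| "coefficient c (Be i j) = 1"

lemma relation_in_chain_ideal:
  assumes "i \<in> {1..k}" "d \<noteq> 0" "c / d = coefficient e (Al i 0)"
  shows "relation c d i \<in> chain_ideal (coefficient e)"
  using rewriting_chain_ideal[of "coefficient e"] D_mem[OF assms(1)]
  unfolding relation_in_ideal_iff[OF ideal_chain_ideal assms(2)] assms(3) rewriting_ideal_def by blast

lemma turn_in_chain_ideal:
  fixes \<nu> :: "arrow \<Rightarrow> 'k::field"
  assumes "i \<in> {1..k}"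
  shows "f2 p q k s i \<in> chain_ideal \<nu>" "f3 p q k s i \<in> chain_ideal \<nu>"
proof -
  have turn: "single (tail Q a, [a, b]) 1 \<in> chain_ideal \<nu>"
    if "a \<in> arcs Q" "b \<in> arcs Q" "tail Q b = head Q a" "b \<noteq> nx a" for a b
    using rewriting_chain_ideal[of \<nu>] that unfolding rewriting_ideal_def by blast
  obtain a b where "a \<in> arcs Q" "b \<in> arcs Q" "tail Q b = head Q a" "b \<noteq> nx a"
    "f2 p q k s i = single (tail Q a, [a, b]) (1::'k)" using f2_turn[OF assms] by blast
  then show "f2 p q k s i \<in> chain_ideal \<nu>" using turn by (simp only:)
  obtain a b where "a \<in> arcs Q" "b \<in> arcs Q" "tail Q b = head Q a" "b \<noteq> nx a"
    "f3 p q k s i = single (tail Q a, [a, b]) (1::'k)" using f3_turn[OF assms] by blast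
  then show "f3 p q k s i \<in> chain_ideal \<nu>" using turn by (simp only:)
qed

lemma long_in_chain_ideal:
  assumes "i \<in> {1..k}"
  shows "j \<le> p \<Longrightarrow> f4 p q k s i j \<in> chain_ideal \<nu>" "j \<le> q \<Longrightarrow> f5 p q k s i j \<in> chain_ideal \<nu>"
  using assms rewriting_chain_ideal[of \<nu>]
  unfolding rewriting_ideal_def by (simp_all add: f4_eq f5_eq Al_arc Be_arc del: chain_Suc)

section \<open>The ideal of the undeformed algebra\<close>

lemma relI_chain_ideal:
  assumes lam: "lam \<noteq> 0"
  shows "relI p q k s lam \<subseteq> chain_ideal (coefficient (1 / lam))"
proof
  fix r assume "r \<in> relI p q k s lam"
  then consider (f1) i where "i \<in> {1..k}" "r = f1 p q k s lam i"
    | (f2) i where "i \<in> {1..k}" "r = f2 p q k s i"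
    | (f3) i where "i \<in> {1..k}" "r = f3 p q k s i"
    | (f4) i j where "i \<in> {1..k}" "j \<le> p" "r = f4 p q k s i j"
    | (f5) i j where "i \<in> {1..k}" "j \<le> q" "r = f5 p q k s i j"
    unfolding relI_def by force
  then show "r \<in> chain_ideal (coefficient (1 / lam))"
  proof cases
    case f1
    show ?thesis
      unfolding f1(2) f1_relation[OF f1(1)] by (rule relation_in_chain_ideal[OF f1(1)]) (use lam in auto)
  qed (simp_all only: turn_in_chain_ideal long_in_chain_ideal)
qed

text \<open>Here the generators are literally the rewriting rules: \<open>f2\<close> and
  \<open>f3\<close> are the turns, \<open>f5\<close> and \<open>f4\<close> with all values of j are
  the chains of length L + 1 from each arrow, and \<open>f1\<close> relates the parallel paths up to
  a nonzero factor.\<close>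

lemma Lambda_ideal:
  fixes lam :: "'k::field"
  assumes lam: "lam \<noteq> 0"
  shows "Idl\<^bsub>path_algebra Q\<^esub> (relI p q k s lam) = chain_ideal (coefficient (1 / lam))"
proof -
  interpret P: ring "path_algebra Q :: ('k, _) module" by (rule path_algebra_ring)
  let ?S = "relI p q k s lam" and ?I = "Idl\<^bsub>path_algebra Q\<^esub> (relI p q k s lam)"
  have S: "?S \<subseteq> carrier (path_algebra Q)"
    using relI_chain_ideal[OF lam] chain_ideal_carrier by blast
  have I: "ideal ?I (path_algebra Q)" by (rule P.genideal_ideal[OF S])
  note S_I = P.genideal_self[OF S]
  show ?thesis
  proof (rule rewriting_ideal_eq)
    show "?I \<subseteq> chain_ideal (coefficient (1 / lam))"
      by (rule P.genideal_minimal[OF ideal_chain_ideal relI_chain_ideal[OF lam]])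
    show "rewriting_ideal (coefficient (1 / lam)) ?I"
      unfolding rewriting_ideal_def
    proof (intro conjI ballI impI I)
      fix a b assume "a \<in> arcs Q" "b \<in> arcs Q" "tail Q b = head Q a" "b \<noteq> nx a"
      from turn_cases[OF this] obtain i where i: "i \<in> {1..k}"
        "single (tail Q a, [a, b]) (1::'k) = f2 p q k s i \<or> single (tail Q a, [a, b]) (1::'k) = f3 p q k s i"
        by blast
      have "f2 p q k s i \<in> ?S" "f3 p q k s i \<in> ?S" unfolding relI_def using i(1) by blast+
      then show "single (tail Q a, [a, b]) 1 \<in> ?I"
        using S_I i(2) by (metis subsetD)
    next
      fix a assume a: "a \<in> arcs Q"
      show "single (tail Q a, chain a (Suc max_length)) 1 \<in> ?I"
      proof (cases a)
        case (Al i j)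
        then have ij: "i \<in> {1..k}" "j \<le> q" using a by (auto simp: Al_arc)
        then have "f5 p q k s i j \<in> ?S" unfolding relI_def by auto
        then have "f5 p q k s i j \<in> ?I" using S_I by blast
        then show ?thesis unfolding f5_eq[OF ij] Al .
      next
        case (Be i j)
        then have ij: "i \<in> {1..k}" "j \<le> p" using a by (auto simp: Be_arc)
        then have "f4 p q k s i j \<in> ?S" unfolding relI_def by auto
        then have "f4 p q k s i j \<in> ?I" using S_I by blast
        then show ?thesis unfolding f4_eq[OF ij] Be .
      qed
    next
      fix a assume "a \<in> \<alpha>_starts"
      then obtain i where i: "i \<in> {1..k}" "a = Al i 0" unfolding \<alpha>_starts_def by blast
      let ?d = "if i = 1 then lam else 1"
      have d: "?d \<noteq> 0" "1 / ?d = coefficient (1 / lam) (Al i 0)" using lam by auto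
      have "f1 p q k s lam i \<in> ?S" unfolding relI_def using i(1) by blast
      then have "relation 1 ?d i \<in> ?I" using S_I f1_relation[OF i(1), of lam] by (metis subsetD)
      then show "(\<lambda>x. single (top_path (partner k a)) 1 x
          - coefficient (1 / lam) a * single (top_path a) 1 x) \<in> ?I"
        unfolding relation_in_ideal_iff[OF I d(1)] d(2) i(2) .
    qed
  qed
qed

lemma Lambda_eq:
  assumes "lam \<noteq> 0"
  shows "Lambda p q k s lam = chain_algebra (coefficient (1 / lam))"
  unfolding Lambda_def Lambda_ideal[OF assms] ..

section \<open>The ideal of the deformed algebra\<close>

lemma next_one: "(nx ^^ max_length) (Al 1 0) = Al (s + 1) 0"
proof -
  have "s + 1 \<in> {1..k}" using s_le k2 by auto
  then show ?thesis using nx_L_Al[of 1] idx_id by simp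
qed

lemma rho_chain: "rho p q k = chain (Al 1 0) max_length"
  using idx_id[of 1 k] k0 by (simp add: rho_def AB_chain)

text \<open>A path of length L + 1 is neither short nor of maximal nonzero length, so it lies in the
  ideal whether the appended arrow continues the chain or makes a turn.\<close>

lemma rho_snoc_in_chain_ideal:
  assumes a: "a \<in> arcs Q" "tail Q a = V (s + 1)"
  shows "path_elem Q (rho p q k @ [a]) \<in> chain_ideal \<nu>"
proof -
  have arc: "Al 1 0 \<in> arcs Q" using D_arc[of 1] k0 by simp
  let ?x = "(tail Q (Al 1 0), chain (Al 1 0) max_length @ [a])"
  have "tail Q a = tail Q ((nx ^^ max_length) (Al 1 0))" unfolding next_one a(2) by (simp add: tail_Q)
  then have "is_path ?x"
    unfolding is_path_append_iff awlast_chain[OF arc]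
    using is_path_chain[OF arc, of max_length] is_path_arrow[OF a(1)] by (simp only: simp_thms)
  moreover have "\<not> short ?x" by (simp add: short_def)
  moreover have "?x \<noteq> top_path b" for b
  proof
    assume "?x = top_path b"
    then have "length (snd ?x) = length (snd (top_path b))" by (rule arg_cong)
    then show False by (simp add: top_path_def)
  qed
  ultimately have "single ?x 1 \<in> chain_ideal \<nu>" by (rule single_turn_or_long[OF rewriting_chain_ideal])
  moreover have "hd (chain (Al 1 0) max_length @ [a]) = Al 1 0"
    using chain_Suc[of "Al 1 0" "p + q + 1"] by (simp add: max_length_def)
  ultimately show ?thesis by (simp only: rho_chain path_elem_eq_single)
qed

lemma Cons_rho_in_chain_ideal:
  assumes a: "a \<in> arcs Q" "head Q a = V 1"
  shows "path_elem Q (a # rho p q k) \<in> chain_ideal \<nu>"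
proof -
  have arc: "Al 1 0 \<in> arcs Q" using D_arc[of 1] k0 by simp
  let ?x = "(tail Q a, a # chain (Al 1 0) max_length)"
  have "head Q a = tail Q (Al 1 0)" by (simp add: a(2) tail_Q)
  then have "is_path ?x" using is_path_chain[OF arc, of max_length] a(1) by (simp add: is_path_Cons_iff)
  moreover have "\<not> short ?x" by (simp add: short_def)
  moreover have "?x \<noteq> top_path b" for b
  proof
    assume "?x = top_path b"
    then have "length (snd ?x) = length (snd (top_path b))" by (rule arg_cong)
    then show False by (simp add: top_path_def)
  qed
  ultimately have "single ?x 1 \<in> chain_ideal \<nu>" by (rule single_turn_or_long[OF rewriting_chain_ideal])
  then show ?thesis by (simp only: rho_chain path_elem_eq_single list.sel)
qed

text \<open>The index ranges of \<open>f4\<close> and \<open>f5\<close> are widened to j <= p and j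
  <= q, so that the membership facts already proved for the original generators apply
  unchanged.\<close>

lemma relI_eta_cases:
  assumes "r \<in> relI_eta p q k s lam t"
  obtains (eta) "r = relation (1 - t) lam 1"
    | (f1) i where "i \<in> {2..k}" "r = f1 p q k s lam i"
    | (f2) i where "i \<in> {1..k}" "r = f2 p q k s i"
    | (f3) i where "i \<in> {1..k}" "r = f3 p q k s i"
    | (f4) i j where "i \<in> {1..k}" "j \<le> p" "r = f4 p q k s i j"
    | (f5) i j where "i \<in> {1..k}" "j \<le> q" "r = f5 p q k s i j"
    | (snoc) a where "a \<in> arcs Q" "tail Q a = V (s + 1)" "r = path_elem Q (rho p q k @ [a])"
    | (cons) a where "a \<in> arcs Q" "head Q a = V 1" "r = path_elem Q (a # rho p q k)"
  using assms unfolding relI_eta_def f1_eta_relation Un_iff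
proof (elim disjE)
  assume "r \<in> {f4 p q k s i j | i j. i \<in> {1..k} \<and> j \<in> {1..p - 1}}"
  then obtain i j where "i \<in> {1..k}" "j \<in> {1..p - 1}" "r = f4 p q k s i j" by blast
  moreover from this(2) have "j \<le> p" by auto
  ultimately show thesis using f4 by blast
next
  assume "r \<in> {f5 p q k s i j | i j. i \<in> {1..k} \<and> j \<in> {1..q - 1}}"
  then obtain i j where "i \<in> {1..k}" "j \<in> {1..q - 1}" "r = f5 p q k s i j" by blast
  moreover from this(2) have "j \<le> q" by auto
  ultimately show thesis using f5 by blast
qed (use eta f1 f2 f3 snoc cons in blast)+

lemma relI_eta_chain_ideal:
  assumes lam: "lam \<noteq> 0"
  shows "relI_eta p q k s lam t \<subseteq> chain_ideal (coefficient ((1 - t) / lam))"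
proof
  fix r assume "r \<in> relI_eta p q k s lam t"
  then show "r \<in> chain_ideal (coefficient ((1 - t) / lam))"
  proof (cases rule: relI_eta_cases)
    case eta
    have "1 \<in> {1..k}" using k0 by simp
    then show ?thesis unfolding eta by (rule relation_in_chain_ideal[OF _ lam]) simp
  next
    case (f1 i)
    then have i: "i \<in> {1..k}" "i \<noteq> 1" by auto
    show ?thesis
      unfolding f1(2) f1_relation[OF i(1)] by (rule relation_in_chain_ideal[OF i(1)]) (use i(2) in auto)
  qed (simp_all only: turn_in_chain_ideal long_in_chain_ideal
      rho_snoc_in_chain_ideal Cons_rho_in_chain_ideal)
qed

text \<open>The work lies in the chains of length L + 1 that are no longer generators: those from
  the first or last arrow of some A_i or B_i. They start at, or one arrow before, the start of a
  path in a commutativity relation, so they arise by extending that relation by one arrow.\<close>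

lemma Lambda_eta_ideal:
  fixes lam :: "'k::field"
  assumes lam: "lam \<noteq> 0"
  shows "Idl\<^bsub>path_algebra Q\<^esub> (relI_eta p q k s lam t) = chain_ideal (coefficient ((1 - t) / lam))"
proof -
  interpret P: ring "path_algebra Q :: ('k, _) module" by (rule path_algebra_ring)
  let ?S = "relI_eta p q k s lam t" and ?I = "Idl\<^bsub>path_algebra Q\<^esub> (relI_eta p q k s lam t)"
  let ?\<nu> = "coefficient ((1 - t) / lam)"
  have S: "?S \<subseteq> carrier (path_algebra Q)"
    using relI_eta_chain_ideal[OF lam] chain_ideal_carrier by blast
  have I: "ideal ?I (path_algebra Q)" by (rule P.genideal_ideal[OF S])
  note S_I = P.genideal_self[OF S]
  have turns: "\<forall>a\<in>arcs Q. \<forall>b\<in>arcs Q. tail Q b = head Q a \<longrightarrow> b \<noteq> nx a \<longrightarrow>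
      single (tail Q a, [a, b]) 1 \<in> ?I"
  proof (intro ballI impI)
    fix a b assume "a \<in> arcs Q" "b \<in> arcs Q" "tail Q b = head Q a" "b \<noteq> nx a"
    from turn_cases[OF this] obtain i where i: "i \<in> {1..k}"
      "single (tail Q a, [a, b]) (1::'k) = f2 p q k s i \<or> single (tail Q a, [a, b]) (1::'k) = f3 p q k s i"
      by blast
    have "f2 p q k s i \<in> ?S" "f3 p q k s i \<in> ?S" unfolding relI_eta_def using i(1) by blast+
    then show "single (tail Q a, [a, b]) 1 \<in> ?I"
      using S_I i(2) by (metis subsetD)
  qed
  have rel1: "relation (1 - t) lam 1 \<in> ?I"
    using S_I unfolding relI_eta_def f1_eta_relation by blast
  have rel: "relation 1 1 i \<in> ?I" if "i \<in> {1..k}" "i \<noteq> 1" for i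
  proof -
    have "i \<in> {2..k}" using that by auto
    then have "f1 p q k s lam i \<in> ?S" unfolding relI_eta_def by blast
    then show ?thesis using S_I f1_relation[OF that(1), of lam] that(2) by auto
  qed
  have basic: "(\<lambda>x. single (top_path (partner k (Al i 0))) 1 x
      - ?\<nu> (Al i 0) * single (top_path (Al i 0)) 1 x) \<in> ?I" if i: "i \<in> {1..k}" for i
  proof (cases "i = 1")
    case True
    then show ?thesis using rel1 unfolding relation_in_ideal_iff[OF I lam] by simp
  next
    case False
    then show ?thesis
      using rel[OF i] unfolding relation_in_ideal_iff[OF I one_neq_zero] by simp
  qed
  let ?long = "\<lambda>a. single (tail Q a, chain a (Suc max_length)) (1::'k) \<in> ?I"
  \<comment> \<open>In the solved form B A has coefficient 1 for every t and every index, so its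
    extensions by one arrow on either side are obtained uniformly.\<close>
  have long_Be: "?long (Be i 0)" "d \<in> arcs Q \<Longrightarrow> nx d = Be i 0 \<Longrightarrow> ?long d" if "i \<in> {1..k}" for i d
  proof -
    have "Be i 0 \<in> \<beta>_starts" using that by (simp add: \<beta>_starts_def)
    then obtain a where "a \<in> \<alpha>_starts" and b: "Be i 0 = partner k a" using E_obtain by blast
    then obtain i' where i': "i' \<in> {1..k}" and a: "a = Al i' 0" unfolding \<alpha>_starts_def by blast
    note D = D_mem[OF i']
    note long = single_long_from_relation[OF I turns \<sigma>_arc[OF D] D_arc[OF i'] \<sigma>_neq[OF D] tail_\<sigma>[OF D]
      end_\<sigma>[OF D] basic[OF i']]
    show "?long (Be i 0)" unfolding b a by (rule long(1))
    show "?long d" if "d \<in> arcs Q" "nx d = Be i 0" using that unfolding b a by (rule long(2))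
  qed
  have long_Al: "?long (Al i 0)" "d \<in> arcs Q \<Longrightarrow> nx d = Al i 0 \<Longrightarrow> ?long d" if i: "i \<in> {1..k}" for i d
  proof -
    note D = D_mem[OF i]
    have *: "?long (Al i 0) \<and> (d \<in> arcs Q \<longrightarrow> nx d = Al i 0 \<longrightarrow> ?long d)"
    proof (cases "i = 1")
      \<comment> \<open>The coefficient 1 - t of A_1 B_1 may vanish, so the relation cannot be used.
        The generators extending rho_1 by one arrow are the required chains when the arrow is chosen
        along \<open>nx\<close>.\<close>
      case True
      have arc: "Al 1 0 \<in> arcs Q" using D_arc i True by simp
      have "tail Q (Al (s + 1) 0) = V (s + 1)" by (simp add: tail_Q)
      moreover have "Al (s + 1) 0 \<in> arcs Q" using nxt_pow_arc[OF arc, of max_length] unfolding next_one .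
      ultimately have "path_elem Q (rho p q k @ [Al (s + 1) 0]) \<in> ?S" unfolding relI_eta_def by blast
      moreover have "rho p q k @ [Al (s + 1) 0] = chain (Al 1 0) (Suc max_length)"
        unfolding rho_chain chain_Suc_end next_one ..
      ultimately have "path_elem Q (chain (Al 1 0) (Suc max_length)) \<in> ?I" using S_I by auto
      then have "?long (Al i 0)" unfolding True path_elem_chain[OF zero_less_Suc] .
      moreover have "?long d" if d: "d \<in> arcs Q" "nx d = Al i 0"
      proof -
        have "head Q d = V 1" using tail_nx[OF d(1)] d(2) True by (simp add: tail_Q)
        then have "path_elem Q (d # rho p q k) \<in> ?S" using d(1) unfolding relI_eta_def by blast
        moreover have "d # rho p q k = chain d (Suc max_length)"
          unfolding rho_chain chain_Suc d(2) True ..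
        ultimately have "path_elem Q (chain d (Suc max_length)) \<in> ?I" using S_I by auto
        then show ?thesis unfolding path_elem_chain[OF zero_less_Suc] .
      qed
      ultimately show ?thesis by blast
    next
      case False
      \<comment> \<open>Away from index 1 both coefficients are 1, so the relation can also be read
        with A_i B_i as leading path.\<close>
      have "(\<lambda>x. single (top_path (Al i 0)) 1 x - 1 * single (top_path (partner k (Al i 0))) 1 x) \<in> ?I"
        using rel[OF i False] by (simp add: relation_def)
      note long = single_long_from_relation[OF I turns D_arc[OF i] \<sigma>_arc[OF D] \<sigma>_neq[OF D, symmetric]
        tail_\<sigma>[OF D, symmetric] end_\<sigma>[OF D, symmetric] this]
      show ?thesis using long by blast
    qed
    show "?long (Al i 0)" using * by blast
    show "?long d" if "d \<in> arcs Q" "nx d = Al i 0" using * that by blast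
  qed
  show ?thesis
  proof (rule rewriting_ideal_eq)
    show "?I \<subseteq> chain_ideal ?\<nu>"
      by (rule P.genideal_minimal[OF ideal_chain_ideal relI_eta_chain_ideal[OF lam]])
    have long: "?long a" if a: "a \<in> arcs Q" for a
    proof (cases a)
      case (Al i j)
      then have ij: "i \<in> {1..k}" "j \<le> q" using a by (auto simp: Al_arc)
      \<comment> \<open>At j = 0 the chain starts with A_i, at j = q it starts one arrow before B_i,
        and in between a generator is available. For q <= 1 the truncated range {1..q - 1} is empty
        and the first two cases cover everything.\<close>
      consider "j = 0" | "j = q" | "j \<in> {1..q - 1}" using ij(2) by fastforce
      then show ?thesis
      proof cases
        case 1
        then show ?thesis using long_Al(1)[OF ij(1)] Al by blast
      next
        case 2
        then show ?thesis using long_Be(2)[OF ij(1) a] Al by simp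
      next
        case 3
        then have "f5 p q k s i j \<in> ?S" using ij(1) unfolding relI_eta_def by blast
        then have "f5 p q k s i j \<in> ?I" using S_I by blast
        then show ?thesis unfolding f5_eq[OF ij] Al .
      qed
    next
      case (Be i j)
      then have ij: "i \<in> {1..k}" "j \<le> p" using a by (auto simp: Be_arc)
      consider "j = 0" | "j = p" | "j \<in> {1..p - 1}" using ij(2) by fastforce
      then show ?thesis
      proof cases
        case 1
        then show ?thesis using long_Be(1)[OF ij(1)] Be by blast
      next
        case 2
        then show ?thesis using long_Al(2)[OF idx_range[OF k0] a] Be by simp
      next
        case 3
        then have "f4 p q k s i j \<in> ?S" using ij(1) unfolding relI_eta_def by blast
        then have "f4 p q k s i j \<in> ?I" using S_I by blast
        then show ?thesis unfolding f4_eq[OF ij] Be .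
      qed
    qed
    have "(\<lambda>x. single (top_path (partner k a)) 1 x - ?\<nu> a * single (top_path a) 1 x) \<in> ?I"
      if "a \<in> \<alpha>_starts" for a
      using that basic unfolding \<alpha>_starts_def by blast
    then show "rewriting_ideal ?\<nu> ?I"
      unfolding rewriting_ideal_def using I turns long by blast
  qed
qed

lemma Lambda_eta_eq:
  assumes "lam \<noteq> 0"
  shows "Lambda_eta p q k s lam t = chain_algebra (coefficient ((1 - t) / lam))"
  unfolding Lambda_eta_def Lambda_eta_ideal[OF assms] ..

lemma coefficient_nonzero: "c \<noteq> 0 \<Longrightarrow> coefficient c a \<noteq> 0"
  by (cases a) auto

end

section \<open>Nontriviality of the deformation and comparison of the socle quotients\<close>

theorem theorem3p10:
  fixes p q k s :: nat and lam :: "'k::alg_closed_field"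
  assumes "k \<ge> 2" and "1 \<le> s" and "s \<le> k - 1"
    and "gcd s k = 1" and "gcd (s + 2) k = 1" and "lam \<noteq> 0"
  shows "nontrivial_deformation (Lambda p q k s lam) (Lambda_eta p q k s lam)
    \<and> (\<forall>t. socle_equivalent (Lambda p q k s lam) (Lambda_eta p q k s lam t))
    \<and> (\<forall>t. t \<noteq> 1 \<longrightarrow>
          right_socle_equivalent (Lambda p q k s lam) (Lambda_eta p q k s lam t)
        \<and> left_socle_equivalent (Lambda p q k s lam) (Lambda_eta p q k s lam t))"
proof -
  interpret lambda_quiver p q k s by unfold_locales (use assms in auto)
  note lam = \<open>lam \<noteq> 0\<close>
  let ?\<nu> = "coefficient (1 / lam)" and ?\<nu>\<^sub>\<eta> = "\<lambda>t. coefficient ((1 - t) / lam)"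
  have \<nu>: "?\<nu> a \<noteq> 0" for a using lam by (intro coefficient_nonzero) simp
  have \<nu>\<^sub>\<eta>: "?\<nu>\<^sub>\<eta> t a \<noteq> 0" if "t \<noteq> 1" for t a using lam that by (intro coefficient_nonzero) simp
  have "\<not> isomorphic_algebras (Lambda_eta p q k s lam 1) (Lambda p q k s lam)"
  proof
    assume "isomorphic_algebras (Lambda_eta p q k s lam 1) (Lambda p q k s lam)"
    then obtain h where "h \<in> ring_iso (chain_algebra (?\<nu>\<^sub>\<eta> 1)) (chain_algebra ?\<nu>)"
      unfolding isomorphic_algebras_def algebra_iso_def Lambda_eq[OF lam] Lambda_eta_eq[OF lam] by blast
    then have "square_zero_annihilators_right_to_left (chain_algebra (?\<nu>\<^sub>\<eta> 1))"
      using square_zero_annihilators_iso[OF _ _ _ square_zero_annihilators_nonzero[of ?\<nu>, OF \<nu>]]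
        K_algebra.axioms(1)[OF chain_algebra_K_algebra] by blast
    \<comment> \<open>The vanishing coefficient sits at \<open>Al 1 0\<close> and equals (1 - 1) /
      lam.\<close>
    moreover have "\<not> square_zero_annihilators_right_to_left (chain_algebra (?\<nu>\<^sub>\<eta> 1))"
      by (rule square_zero_annihilators_zero[OF D_mem[of 1]]) (use k0 in simp_all)
    ultimately show False by blast
  qed
  then have "nontrivial_deformation (Lambda p q k s lam) (Lambda_eta p q k s lam)"
    unfolding nontrivial_deformation_def is_deformation_def Lambda_eq[OF lam] Lambda_eta_eq[OF lam]
    \<comment> \<open>Both dimensions are \<open>card normal_paths\<close>; the witness for
      nontriviality is t = 1.\<close>
    using chain_algebra_dimension by blast
  moreover have "socle_equivalent (Lambda p q k s lam) (Lambda_eta p q k s lam t)" for t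
    unfolding socle_equivalent_def Lambda_eq[OF lam] Lambda_eta_eq[OF lam] socle_ideal
    by (rule quotient_by_long_isomorphic)
  moreover have "right_socle_equivalent (Lambda p q k s lam) (Lambda_eta p q k s lam t)" if "t \<noteq> 1" for t
    unfolding right_socle_equivalent_def Lambda_eq[OF lam] Lambda_eta_eq[OF lam]
      socle_right[of ?\<nu>, OF \<nu>] socle_right[of "?\<nu>\<^sub>\<eta> t", OF \<nu>\<^sub>\<eta>[OF that]]
    by (rule quotient_by_long_isomorphic)
  moreover have "left_socle_equivalent (Lambda p q k s lam) (Lambda_eta p q k s lam t)" if "t \<noteq> 1" for t
    unfolding left_socle_equivalent_def Lambda_eq[OF lam] Lambda_eta_eq[OF lam]
      socle_left[of ?\<nu>, OF \<nu>] socle_left[of "?\<nu>\<^sub>\<eta> t", OF \<nu>\<^sub>\<eta>[OF that]]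
    by (rule quotient_by_long_isomorphic)
  ultimately show ?thesis by blast
qed

end
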